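(* Let $n\ge 2$, $0\le r<R\le\infty$, and let $f$ be a continuous (complex-valued) function on the open annulus $\mathrm{Ann}(r,R)=\{x\in\mathbb B^n: r<d(x,o)<R\}$ in the real hyperbolic space $\mathbb B^n$. Let $a_{kj}(\rho)$ ($k\ge 0$, $1\le j\le d_k$, $\tanh\frac r2<\rho<\tanh\frac R2$) be the spherical harmonic coefficients of $f$; for $k=0$ write $a_0$ for the single coefficient $a_{01}$. Then $f\in Z_{r,R}$ if and only if $a_0(\rho)=0$ for all $\tanh\frac r2<\rho<\tanh\frac R2$ and, for all $k\ge1$ and $1\le j\le d_k$, there are constants $C_{kj}^i\in\mathbb C$ ($1\le i\le k$) such that \[a_{kj}(\rho)=\sum_{i=1}^{k}C_{kj}^i\,\frac{(1-\rho^2)^{n+i-2}}{\rho^{n+k-2}}\qquad\text{for all }\tanh\tfrac r2<\rho<\tanh\tfrac R2 .\]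
   Context: $\mathbb B^n=\{x\in\mathbb R^n:|x|<1\}$, $n\ge2$, is the open unit ball with the Poincaré metric $ds^2=\lambda^2(dx_1^2+\cdots+dx_n^2)$, $\lambda=2(1-|x|^2)^{-1}$. Its geodesic distance $d$ satisfies $\tanh\frac12 d(x,y)=\frac{|x-y|}{\sqrt{1-2x\cdot y+|x|^2|y|^2}}$, and $o$ is the origin; in particular $|x|=\tanh\frac{d(x,o)}2$. When $R=\infty$, $\tanh\frac R2$ means $1$. For $x\in\mathbb B^n$ and $s>0$, $S_s(x)=\{y\in\mathbb B^n:d(x,y)=s\}$ is the geodesic sphere, $\mu_s$ is its Riemannian surface measure, and $B_s(x)=\{y\in\mathbb B^n:d(x,y)\le s\}$ is the closed geodesic ball ($B_0(o)=\{o\}$). The spherical mean is $M_sf(x)=\frac{1}{\mu_s(S_s(x))}\int_{S_s(x)}f\,d\mu_s$. $Z_{r,R}$ is the class of all continuous functions $f$ on $\mathrm{Ann}(r,R)$ such that $M_sf(x)=0$ for all $s>0$ and $x\in\mathbb B^n$ with $S_s(x)\subset\mathrm{Ann}(r,R)$ and $B_r(o)\subseteq B_s(x)$. For $k\ge0$, $H_k$ is the space of homogeneous harmonic polynomials of degree $k$ in $n$ variables, $d_k=\dim H_k$, and $\{Y_{kj}:1\le j\le d_k\}$ is a fixed orthonormal basis (in $L^2(S^{n-1})$ with normalized surface measure $d\omega$) of the space of restrictions to $S^{n-1}$ of elements of $H_k$. The spherical harmonic coefficients of $f$ are $a_{kj}(\rho)=\int_{S^{n-1}}f(\rho\omega)\overline{Y_{kj}(\omega)}\,d\omega$,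 i.e. the coefficients in the expansion $f(\rho\omega)=\sum_{k\ge0}\sum_{j=1}^{d_k}a_{kj}(\rho)Y_{kj}(\omega)$, where $x=\rho\omega$, $\rho=|x|$, $\omega\in S^{n-1}$. *)

theory Defs
  imports "HOL-Analysis.Analysis" "HOL-Library.Function_Algebras"
begin

text \<open>The Poincare ball model: the space is \<open>ball 0 1\<close> with metric \<open>\<lambda>\<^sup>2 (dx\<^sub>1\<^sup>2 + \<dots> + dx\<^sub>n\<^sup>2)\<close>.\<close>

definition conf_factor :: "'a::euclidean_space \<Rightarrow> real" where
  "conf_factor x = 2 / (1 - (norm x)\<^sup>2)"

text \<open>The distance is normalised by
  \<open>tanh (d x y / 2) = |x - y| / sqrt (1 - 2 x \<bullet> y + |x|\<^sup>2 |y|\<^sup>2)\<close>;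
  only the values at points of \<open>ball 0 1\<close> are meaningful.\<close>

definition hyp_dist :: "'a::euclidean_space \<Rightarrow> 'a \<Rightarrow> real" where
  "hyp_dist x y =
     2 * artanh (norm (x - y) / sqrt (1 - 2 * (x \<bullet> y) + (norm x)\<^sup>2 * (norm y)\<^sup>2))"

definition hyp_sphere :: "'a::euclidean_space \<Rightarrow> real \<Rightarrow> 'a set" where
  "hyp_sphere x s = {y \<in> ball 0 1. hyp_dist x y = s}"

definition hyp_cball :: "'a::euclidean_space \<Rightarrow> real \<Rightarrow> 'a set" where
  "hyp_cball x s = {y \<in> ball 0 1. hyp_dist x y \<le> s}"

definition hyp_annulus :: "real \<Rightarrow> ereal \<Rightarrow> 'a::euclidean_space set" where
  "hyp_annulus r R = {x \<in> ball 0 1. r < hyp_dist x 0 \<and> ereal (hyp_dist x 0) < R}"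

definition tanh_half :: "ereal \<Rightarrow> real" where
  "tanh_half R = (if R = \<infinity> then 1 else tanh (real_of_ereal R / 2))"

text \<open>Euclidean surface measure on \<open>sphere c \<rho>\<close>, as a Borel measure on the whole space
  concentrated on the sphere. On the unit sphere it is the cone measure
  \<open>A \<mapsto> n \<cdot> vol {t *\<^sub>R \<omega> | 0 < t < 1, \<omega> \<in> A}\<close>, i.e. the measure of
  integration in polar coordinates; it is carried to \<open>sphere c \<rho>\<close> by the homothety
  \<open>\<omega> \<mapsto> c + \<rho> *\<^sub>R \<omega>\<close> with the factor \<open>\<rho>\<^sup>n\<^sup>-\<^sup>1\<close>.\<close>

definition sphere_measure :: "'a::euclidean_space \<Rightarrow> real \<Rightarrow> 'a measure" where
  "sphere_measure c \<rho> =
     distr (density lborel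
              (\<lambda>x. ennreal (\<rho> ^ (DIM('a) - 1) * real DIM('a)) * indicator (ball 0 1) x))
           borel (\<lambda>x. c + \<rho> *\<^sub>R sgn x)"

text \<open>The normalised surface measure \<open>d\<omega>\<close> on the unit sphere.\<close>

definition unit_sphere_measure :: "'a::euclidean_space measure" where
  "unit_sphere_measure = uniform_measure (sphere_measure 0 1) (sphere 0 1)"

text \<open>Geodesic spheres are Euclidean spheres; their Euclidean centre and radius are as follows
  (see \<open>hyp_sphere_eq_sphere\<close> below).\<close>

definition hyp_sphere_center :: "'a::euclidean_space \<Rightarrow> real \<Rightarrow> 'a" where
  "hyp_sphere_center x s =
     ((1 - (tanh (s / 2))\<^sup>2) / (1 - (tanh (s / 2))\<^sup>2 * (norm x)\<^sup>2)) *\<^sub>R x"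

definition hyp_sphere_radius :: "'a::euclidean_space \<Rightarrow> real \<Rightarrow> real" where
  "hyp_sphere_radius x s =
     tanh (s / 2) * (1 - (norm x)\<^sup>2) / (1 - (tanh (s / 2))\<^sup>2 * (norm x)\<^sup>2)"

text \<open>The metric induced on the hypersurface \<open>hyp_sphere x s\<close> is \<open>\<lambda>\<^sup>2\<close> times the induced
  Euclidean one, so its volume form is \<open>\<lambda>\<^sup>n\<^sup>-\<^sup>1\<close> times Euclidean surface measure.\<close>

definition hyp_sphere_measure :: "'a::euclidean_space \<Rightarrow> real \<Rightarrow> 'a measure" where
  "hyp_sphere_measure x s =
     density (sphere_measure (hyp_sphere_center x s) (hyp_sphere_radius x s))
             (\<lambda>y. ennreal (conf_factor y ^ (DIM('a) - 1)))"

definition sph_mean :: "real \<Rightarrow> ('a::euclidean_space \<Rightarrow> complex) \<Rightarrow> 'a \<Rightarrow> complex" where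
  "sph_mean s f x =
     (LINT y:hyp_sphere x s|hyp_sphere_measure x s. f y)
       / complex_of_real (measure (hyp_sphere_measure x s) (hyp_sphere x s))"

definition Z_class :: "real \<Rightarrow> ereal \<Rightarrow> ('a::euclidean_space \<Rightarrow> complex) set" where
  "Z_class r R = {f. continuous_on (hyp_annulus r R) f \<and>
     (\<forall>s>0. \<forall>x\<in>ball 0 1. hyp_sphere x s \<subseteq> hyp_annulus r R \<and> hyp_cball 0 r \<subseteq> hyp_cball x s
        \<longrightarrow> sph_mean s f x = 0)}"

definition laplacian :: "('a::euclidean_space \<Rightarrow> complex) \<Rightarrow> 'a \<Rightarrow> complex" where
  "laplacian p x =
     (\<Sum>b\<in>Basis. vector_derivative
        (\<lambda>t. vector_derivative (\<lambda>u. p (x + u *\<^sub>R b)) (at t)) (at 0))"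

text \<open>The space \<open>H\<^sub>k\<close>, with complex coefficients.\<close>

definition harmonic_polys :: "nat \<Rightarrow> ('a::euclidean_space \<Rightarrow> complex) set" where
  "harmonic_polys k = {p. polynomial_function p \<and>
     (\<forall>c x. p (c *\<^sub>R x) = complex_of_real c ^ k * p x) \<and> (\<forall>x. laplacian p x = 0)}"

text \<open>Dimension over the complex numbers of a space of complex-valued functions.\<close>

definition cdim :: "('a \<Rightarrow> complex) set \<Rightarrow> nat" where
  "cdim V = vector_space.dim (\<lambda>c p x. c * p x) V"

definition sph_inner :: "('a::euclidean_space \<Rightarrow> complex) \<Rightarrow> ('a \<Rightarrow> complex) \<Rightarrow> complex" where
  "sph_inner g h = (LINT \<omega>:sphere 0 1|unit_sphere_measure. g \<omega> * cnj (h \<omega>))"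

text \<open>\<open>Y 1, \<dots>, Y d\<^sub>k\<close> is an orthonormal basis of the restrictions of \<open>H\<^sub>k\<close> to the unit sphere;
  only the values of \<open>Y j\<close> on the sphere matter.\<close>

definition orthonormal_harmonic_basis ::
    "nat \<Rightarrow> (nat \<Rightarrow> 'a::euclidean_space \<Rightarrow> complex) \<Rightarrow> bool" where
  "orthonormal_harmonic_basis k Y \<longleftrightarrow>
     (let d = cdim (harmonic_polys k :: ('a \<Rightarrow> complex) set) in
      (\<forall>j\<in>{1..d}. \<exists>p\<in>harmonic_polys k. \<forall>\<omega>\<in>sphere 0 1. Y j \<omega> = p \<omega>) \<and>
      (\<forall>i\<in>{1..d}. \<forall>j\<in>{1..d}. sph_inner (Y i) (Y j) = (if i = j then 1 else 0)) \<and>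
      (\<forall>p\<in>harmonic_polys k. \<exists>c. \<forall>\<omega>\<in>sphere 0 1. p \<omega> = (\<Sum>j=1..d. c j * Y j \<omega>)))"

definition sph_coeff ::
    "('a::euclidean_space \<Rightarrow> complex) \<Rightarrow> ('a \<Rightarrow> complex) \<Rightarrow> real \<Rightarrow> complex" where
  "sph_coeff Y f \<rho> = sph_inner (\<lambda>\<omega>. f (\<rho> *\<^sub>R \<omega>)) Y"

lemma vector_space_complex_functions:
  "vector_space (\<lambda>(c::complex) (p::'a \<Rightarrow> complex) x. c * p x)"
  by unfold_locales (auto simp: fun_eq_iff algebra_simps)

lemma hyp_quotient:
  fixes x y :: "'a::euclidean_space"
  assumes "norm x < 1" "norm y < 1"
  defines "D \<equiv> 1 - 2 * (x \<bullet> y) + (norm x)\<^sup>2 * (norm y)\<^sup>2"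
  shows "D - (norm (x - y))\<^sup>2 = (1 - (norm x)\<^sup>2) * (1 - (norm y)\<^sup>2)"
    and "0 < D" and "norm (x - y) / sqrt D < 1"
proof -
  have n: "(norm (x - y))\<^sup>2 = (norm x)\<^sup>2 - 2 * (x \<bullet> y) + (norm y)\<^sup>2"
    by (simp add: power2_norm_eq_inner inner_diff inner_commute)
  show eq: "D - (norm (x - y))\<^sup>2 = (1 - (norm x)\<^sup>2) * (1 - (norm y)\<^sup>2)"
    unfolding n D_def by (simp add: algebra_simps)
  have "(norm x)\<^sup>2 < 1" "(norm y)\<^sup>2 < 1"
    using assms(1,2) by (simp_all add: abs_square_less_1)
  then have p: "0 < (1 - (norm x)\<^sup>2) * (1 - (norm y)\<^sup>2)"
    by simp
  then have lt: "(norm (x - y))\<^sup>2 < D"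
    using eq by linarith
  then show D: "0 < D"
    by (smt (verit) zero_le_power2)
  have "norm (x - y) < sqrt D"
    using lt by (simp add: real_less_rsqrt)
  then show "norm (x - y) / sqrt D < 1"
    using D by simp
qed

lemma tanh_half_hyp_dist:
  fixes x y :: "'a::euclidean_space"
  assumes "norm x < 1" "norm y < 1"
  shows "tanh (hyp_dist x y / 2) =
    norm (x - y) / sqrt (1 - 2 * (x \<bullet> y) + (norm x)\<^sup>2 * (norm y)\<^sup>2)"
proof -
  let ?q = "norm (x - y) / sqrt (1 - 2 * (x \<bullet> y) + (norm x)\<^sup>2 * (norm y)\<^sup>2)"
  have q: "?q < 1" "0 \<le> ?q"
    using hyp_quotient[OF assms] by simp_all
  have t: "tanh (artanh u) = u" if u: "0 \<le> u" "u < 1" for u :: real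
  proof -
    have "exp (- 2 * artanh u) = (1 - u) / (1 + u)"
      using u by (simp add: artanh_def exp_minus)
    then show ?thesis
      using u unfolding tanh_real_altdef by (simp only:) (simp add: field_simps)
  qed
  show ?thesis
    using t[OF q(2,1)] by (simp add: hyp_dist_def)
qed

lemma hyp_sphere_eq_sphere:
  fixes x :: "'a::euclidean_space"
  assumes "norm x < 1" "0 < s"
  shows "hyp_sphere x s = sphere (hyp_sphere_center x s) (hyp_sphere_radius x s)"
proof -
  define t where "t = tanh (s / 2)"
  define a where "a = norm x"
  have t: "0 < t" "t < 1"
    using assms(2) tanh_real_lt_1 by (simp_all add: t_def)
  have a: "0 \<le> a" "a < 1"
    using assms(1) by (simp_all add: a_def)
  define E where "E = 1 - t\<^sup>2 * a\<^sup>2"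
  have ta: "t * a < 1"
    using t a by (smt (verit) mult_left_le)
  have E_eq: "E = (1 - t * a) * (1 + t * a)"
    by (simp add: E_def algebra_simps power2_eq_square)
  have E: "0 < E"
    unfolding E_eq using ta t a by (intro mult_pos_pos) (auto simp: add_pos_nonneg)
  define c where "c = hyp_sphere_center x s"
  define \<rho> where "\<rho> = hyp_sphere_radius x s"
  have c: "c = ((1 - t\<^sup>2) / E) *\<^sub>R x" and \<rho>: "\<rho> = t * (1 - a\<^sup>2) / E"
    by (simp_all add: c_def \<rho>_def hyp_sphere_center_def hyp_sphere_radius_def t_def a_def E_def)
  have a2: "a\<^sup>2 < 1" and t2: "t\<^sup>2 < 1"
    using a t by (simp_all add: abs_square_less_1)
  have \<rho>0: "0 \<le> \<rho>"
    using \<rho> E t a2 by simp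
  have "norm c = (1 - t\<^sup>2) / E * a"
    using E t2 by (simp add: c a_def)
  then have "norm c + \<rho> = ((1 - t\<^sup>2) * a + t * (1 - a\<^sup>2)) / E"
    by (simp add: \<rho> add_divide_distrib)
  also have "\<dots> = ((a + t) * (1 - t * a)) / ((1 + t * a) * (1 - t * a))"
    by (simp add: E_eq algebra_simps power2_eq_square)
  also have "\<dots> = (a + t) / (1 + t * a)"
    using ta by simp
  also have "\<dots> < 1"
  proof -
    have "0 < (1 - a) * (1 - t)"
      using a t by simp
    then have "a + t < 1 + t * a"
      by (simp add: algebra_simps)
    moreover have "0 < 1 + t * a"
      using t a by (simp add: add_pos_nonneg)
    ultimately show ?thesis
      by simp
  qed
  finally have in_ball: "norm c + \<rho> < 1" .
  have key: "hyp_dist x y = s \<longleftrightarrow> dist c y = \<rho>" if y: "norm y < 1" for y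
  proof -
    let ?D = "1 - 2 * (x \<bullet> y) + (norm x)\<^sup>2 * (norm y)\<^sup>2"
    have D: "0 < ?D"
      using hyp_quotient[OF assms(1) y] by simp
    have "hyp_dist x y = s \<longleftrightarrow> tanh (hyp_dist x y / 2) = t"
      by (simp add: t_def)
    also have "\<dots> \<longleftrightarrow> norm (x - y) = t * sqrt ?D"
      using D by (simp add: tanh_half_hyp_dist[OF assms(1) y] field_simps)
    also have "\<dots> \<longleftrightarrow> (norm (x - y))\<^sup>2 = (t * sqrt ?D)\<^sup>2"
      using t D by (subst power2_eq_iff_nonneg) auto
    also have "\<dots> \<longleftrightarrow> (norm (x - y))\<^sup>2 = t\<^sup>2 * ?D"
      using D by (simp add: power_mult_distrib)
    also have "\<dots> \<longleftrightarrow> E * (norm y)\<^sup>2 - 2 * (1 - t\<^sup>2) * (x \<bullet> y) + a\<^sup>2 - t\<^sup>2 = 0"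
      unfolding E_def a_def
      by (auto simp: power2_norm_eq_inner inner_diff inner_commute algebra_simps)
    also have "\<dots> \<longleftrightarrow> (norm (c - y))\<^sup>2 = \<rho>\<^sup>2"
    proof -
      have N: "(norm (c - y))\<^sup>2 = ((1 - t\<^sup>2) / E)\<^sup>2 * a\<^sup>2 - 2 * ((1 - t\<^sup>2) / E) * (x \<bullet> y) + (norm y)\<^sup>2"
      proof -
        have "(norm (m *\<^sub>R x - y))\<^sup>2 = m\<^sup>2 * (norm x)\<^sup>2 - 2 * m * (x \<bullet> y) + (norm y)\<^sup>2" for m
          unfolding power2_norm_eq_inner
          by (simp add: inner_diff inner_commute power2_eq_square)
        then show ?thesis
          unfolding c a_def .
      qed
      have "E\<^sup>2 * ((norm (c - y))\<^sup>2 - \<rho>\<^sup>2) =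
          (1 - t\<^sup>2)\<^sup>2 * a\<^sup>2 - 2 * (1 - t\<^sup>2) * E * (x \<bullet> y) + E\<^sup>2 * (norm y)\<^sup>2 - t\<^sup>2 * (1 - a\<^sup>2)\<^sup>2"
      proof -
        define m where "m = (1 - t\<^sup>2) / E"
        have N: "(norm (c - y))\<^sup>2 = m\<^sup>2 * a\<^sup>2 - 2 * m * (x \<bullet> y) + (norm y)\<^sup>2"
          using N by (simp only: m_def)
        have m: "1 - t\<^sup>2 = m * E" and r: "t * (1 - a\<^sup>2) = \<rho> * E"
          using E by (simp_all add: m_def \<rho>)
        have r2: "t\<^sup>2 * (1 - a\<^sup>2)\<^sup>2 = \<rho>\<^sup>2 * E\<^sup>2"
          using r by (metis power_mult_distrib)
        show ?thesis
          unfolding N m r2 by (simp add: algebra_simps power2_eq_square)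
      qed
      also have "(1 - t\<^sup>2)\<^sup>2 * a\<^sup>2 - t\<^sup>2 * (1 - a\<^sup>2)\<^sup>2 = E * (a\<^sup>2 - t\<^sup>2)"
        unfolding E_def by algebra
      then have "(1 - t\<^sup>2)\<^sup>2 * a\<^sup>2 - 2 * (1 - t\<^sup>2) * E * (x \<bullet> y) + E\<^sup>2 * (norm y)\<^sup>2 - t\<^sup>2 * (1 - a\<^sup>2)\<^sup>2
          = E * (E * (norm y)\<^sup>2 - 2 * (1 - t\<^sup>2) * (x \<bullet> y) + a\<^sup>2 - t\<^sup>2)"
        by algebra
      finally have "E\<^sup>2 * ((norm (c - y))\<^sup>2 - \<rho>\<^sup>2) =
          E * (E * (norm y)\<^sup>2 - 2 * (1 - t\<^sup>2) * (x \<bullet> y) + a\<^sup>2 - t\<^sup>2)" .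
      with E show ?thesis
        by (metis diff_eq_diff_eq diff_self less_irrefl mult_eq_0_iff power_eq_0_iff)
    qed
    also have "\<dots> \<longleftrightarrow> dist c y = \<rho>"
      using \<rho>0 by (simp add: dist_norm power2_eq_iff_nonneg)
    finally show ?thesis .
  qed
  have "norm y < 1" if "dist c y = \<rho>" for y
    using that in_ball by (smt (verit) dist_norm norm_minus_commute norm_triangle_sub)
  then show ?thesis
    using key unfolding hyp_sphere_def c_def[symmetric] \<rho>_def[symmetric]
    by (intro set_eqI) (auto simp only: mem_Collect_eq mem_ball_0 mem_sphere)
qed

end

theory Submission
  imports Defs
begin

text \<open>Geodesic spheres are Euclidean spheres, and their surface measure is Euclidean surface measure
  times \<open>(2 / (1 - |y|\<^sup>2))\<^sup>n\<^sup>-\<^sup>1\<close>. Passing from \<open>f\<close> to \<open>g y = f y / (1 - |y|\<^sup>2)\<^sup>n\<^sup>-\<^sup>1\<close> therefore reduces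
  the theorem to Euclidean spheres that enclose the hole of an annulus.

  Necessity: tested against radial functions, the hypothesis says that
  \<open>\<integral> g y \<psi>(|y - c|\<^sup>2) dy = 0\<close> for all \<open>c\<close> near \<open>0\<close>. Differentiating \<open>k\<close> times in \<open>c\<close> yields
  \<open>\<integral> g y P(y) \<psi>\<^sup>(\<^sup>k\<^sup>)(|y|\<^sup>2) dy = 0\<close> for every homogeneous polynomial \<open>P\<close> of degree \<open>k\<close>; hence,
  for a coefficient \<open>b\<^sub>k\<^sub>j\<close> of \<open>g\<close>, \<open>\<rho>\<^sup>n\<^sup>+\<^sup>k\<^sup>-\<^sup>2 b\<^sub>k\<^sub>j(\<rho>)\<close> is, as a function of \<open>\<rho>\<^sup>2\<close>, annihilated by all \<open>k\<close>-th derivatives and so a polynomial of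
  degree less than \<open>k\<close>.

  Sufficiency: \<open>\<psi>(|y - c|\<^sup>2)\<close> is a function of \<open>|y|\<close> and \<open>c \<bullet> y\<close>, so on each sphere about the origin
  it expands into zonal harmonics with axis \<open>c\<close>. For the terms of the expansion the integral is computed along rays
  through the origin: a ray and its opposite meet the sphere of radius \<open>t\<close> about \<open>c\<close> at
  the two roots of \<open>\<rho>\<^sup>2 - 2 \<rho> c \<bullet> \<omega> + |c|\<^sup>2 - t\<^sup>2\<close>, and the
  combination of powers of the roots that occurs is a polynomial in \<open>c \<bullet> \<omega>\<close> of degree at most
  \<open>k - 2\<close>, hence orthogonal to the zonal harmonic of degree \<open>k\<close>.\<close>

section \<open>Surface measure and polar coordinates\<close>

text \<open>\<open>f\<close> is only continuous, so derivatives in the centre fall on the test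
  function. That a test function is a \<open>k\<close>-th derivative of a function with the same
  support is encoded by vanishing moments of order below \<open>k\<close>; a continuous function
  orthogonal to all of these is a polynomial of degree less than \<open>k\<close>, by an argument of
  du Bois-Reymond type. For \<open>k = 0\<close> this is the zero polynomial, whence the condition
  on the coefficient of degree 0. The exponents in the theorem appear when the polynomial in
  \<open>\<rho>\<^sup>2\<close> is expanded in powers of \<open>1 - \<rho>\<^sup>2\<close>: the
  weight \<open>(1 - \<rho>\<^sup>2) ^ (n - 1)\<close> turns the power \<open>i - 1\<close> into
  \<open>n + i - 2\<close>.

  In the converse direction no convergence of the harmonic expansion of \<open>f\<close> is
  available, nor is it asked for. On a sphere about the origin the test function depends on one
  direction cosine only; polynomial approximation in that cosine, uniform in the radius, controls
  the error of a finite zonal expansion in mean square. Hence only the coefficients of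
  \<open>g\<close> against zonal harmonics matter, and these are finite combinations of the given
  coefficients, because a zonal harmonic of degree \<open>k\<close> belongs to the harmonic
  polynomials of that degree.\<close>

lemma sets_sphere_measure [measurable_cong, simp]: "sets (sphere_measure c \<rho>) = sets borel"
  by (simp add: sphere_measure_def)

lemma space_sphere_measure [simp]: "space (sphere_measure c \<rho>) = UNIV"
  by (simp add: sphere_measure_def)

lemma borel_measurable_sgn' [measurable]: "(sgn :: 'a::euclidean_space \<Rightarrow> 'a) \<in> borel_measurable borel"
  unfolding sgn_div_norm by measurable

lemma emeasure_unit_sphere_measure:
  fixes B :: "'a::euclidean_space set"
  assumes [measurable]: "B \<in> sets borel"
  shows "emeasure (sphere_measure 0 1) B = ennreal (real DIM('a)) * emeasure lborel {x \<in> ball 0 1. sgn x \<in> B}"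
proof -
  have "emeasure (sphere_measure 0 1) B =
      emeasure (density lborel (\<lambda>x. ennreal (real DIM('a)) * indicator (ball 0 1) x)) (sgn -` B)"
    by (simp add: sphere_measure_def emeasure_distr)
  also have "\<dots> = (\<integral>\<^sup>+x. ennreal (real DIM('a)) * indicator (ball 0 1) x * indicator (sgn -` B) x \<partial>lborel)"
    using measurable_sets_borel[OF borel_measurable_sgn' assms] by (subst emeasure_density) (auto intro!: borel_measurable_times_ennreal borel_measurable_indicator)
  also have "\<dots> = (\<integral>\<^sup>+x. ennreal (real DIM('a)) * indicator {x \<in> ball 0 1. sgn x \<in> B} x \<partial>lborel)"
    by (intro nn_integral_cong) (auto simp: indicator_def)
  also have "\<dots> = ennreal (real DIM('a)) * emeasure lborel {x \<in> ball 0 1. sgn x \<in> B}"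
    by (subst nn_integral_cmult_indicator) auto
  finally show ?thesis .
qed

lemma finite_sphere_measure: "finite_measure (sphere_measure (0::'a::euclidean_space) 1)"
proof
  have "emeasure (sphere_measure (0::'a) 1) UNIV \<le> ennreal (real DIM('a)) * emeasure lborel (ball (0::'a) 1)"
    by (subst emeasure_unit_sphere_measure) (auto intro!: mult_left_mono emeasure_mono)
  also have "\<dots> < \<infinity>"
    using emeasure_lborel_ball_finite[of "0::'a" 1] by (simp add: ennreal_mult_less_top)
  finally show "emeasure (sphere_measure (0::'a) 1) (space (sphere_measure 0 1)) \<noteq> \<infinity>"
    by simp
qed

lemma AE_sphere_measure: "AE x in sphere_measure (0::'a::euclidean_space) 1. x \<in> sphere 0 1"
proof (rule AE_I[where N="- sphere 0 1"])
  have "emeasure (sphere_measure (0::'a) 1) (- sphere 0 1) = ennreal (real DIM('a)) * emeasure lborel {x \<in> ball (0::'a) 1. sgn x \<in> - sphere 0 1}"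
    by (rule emeasure_unit_sphere_measure) auto
  also have "{x \<in> ball (0::'a) 1. sgn x \<in> - sphere 0 1} = {0}"
    by (auto simp: norm_sgn split: if_splits)
  finally show "emeasure (sphere_measure (0::'a) 1) (- sphere 0 1) = 0" by simp
qed auto

text \<open>Dilation by \<open>s\<close> carries the cone over \<open>B\<close> in the unit ball
  onto the cone in the ball of radius \<open>s\<close> and multiplies volume by
  \<open>s ^ DIM('a)\<close>.\<close>

lemma emeasure_ball_cone:
  fixes B :: "'a::euclidean_space set"
  assumes B[measurable]: "B \<in> sets borel" and s: "0 \<le> s"
  shows "emeasure lborel {x. norm x < s \<and> sgn x \<in> B} = ennreal (s ^ DIM('a)) * emeasure lborel {x \<in> ball 0 1. sgn x \<in> B}"
proof (cases "s = 0")
  case True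
  then show ?thesis by (simp add: zero_power)
next
  case False
  with s have s: "0 < s" by simp
  have [measurable]: "{x::'a. norm x < s \<and> sgn x \<in> B} \<in> sets borel" by measurable
  have "emeasure (lborel::'a measure) {x. norm x < s \<and> sgn x \<in> B}
    = emeasure (density (distr lborel borel (\<lambda>x. 0 + s *\<^sub>R x)) (\<lambda>_. \<bar>s\<bar>^DIM('a))) {x::'a. norm x < s \<and> sgn x \<in> B}"
    using lborel_affine[of s "0::'a"] s by simp
  also have "\<dots> = ennreal (s^DIM('a)) * emeasure (distr lborel borel (\<lambda>x. s *\<^sub>R x)) {x::'a. norm x < s \<and> sgn x \<in> B}"
    using s by (subst emeasure_density_const) auto
  also have "emeasure (distr lborel borel (\<lambda>x. s *\<^sub>R x)) {x::'a. norm x < s \<and> sgn x \<in> B} = 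
       emeasure lborel ((\<lambda>x. s *\<^sub>R x) -` {x::'a. norm x < s \<and> sgn x \<in> B})"
    by (subst emeasure_distr) auto
  also have "((\<lambda>x. s *\<^sub>R x) -` {x::'a. norm x < s \<and> sgn x \<in> B}) = {x \<in> ball 0 1. sgn x \<in> B}"
    using s by (auto simp: sgn_scaleR)
  finally show ?thesis .
qed

text \<open>The radial factor of Lebesgue measure in polar coordinates, carried by the positive
  half-line.\<close>

definition radial_measure :: "nat \<Rightarrow> real measure" where
  "radial_measure n = density lborel (\<lambda>\<rho>. ennreal (\<rho> ^ (n - 1)) * indicator {0<..} \<rho>)"

lemma sets_radial_measure [measurable_cong, simp]: "sets (radial_measure n) = sets borel"
  and space_radial_measure [simp]: "space (radial_measure n) = UNIV"
  by (simp_all add: radial_measure_def)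

lemma emeasure_radial_measure_lessThan:
  assumes n: "0 < n"
  shows "emeasure (radial_measure n) {..<s} = ennreal (if 0 \<le> s then s ^ n / real n else 0)"
proof (cases "0 \<le> s")
  case False
  have "emeasure (radial_measure n) {..<s} = (\<integral>\<^sup>+x. ennreal (x ^ (n - 1)) * indicator {0<..} x * indicator {..<s} x \<partial>lborel)"
    unfolding radial_measure_def by (subst emeasure_density) auto
  also have "\<dots> = (\<integral>\<^sup>+x. 0 \<partial>(lborel :: real measure))"
    by (rule nn_integral_cong) (use False in \<open>simp add: indicator_def\<close>)
  finally have "emeasure (radial_measure n) {..<s} = 0" by simp
  with False show ?thesis by simp
next
  case True
  have "emeasure (radial_measure n) {..<s} = (\<integral>\<^sup>+x. ennreal (x ^ (n - 1)) * indicator {0<..} x * indicator {..<s} x \<partial>lborel)"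
    unfolding radial_measure_def 
    by (subst emeasure_density) auto
  also have "\<dots> = (\<integral>\<^sup>+x. ennreal (x ^ (n - 1)) * indicator {0..s} x \<partial>lborel)"
  proof (intro nn_integral_cong_AE)
    have "AE x in lborel. x \<noteq> 0" "AE x in lborel. x \<noteq> s" by (rule AE_lborel_singleton)+
    then show "AE x in lborel. ennreal (x ^ (n - 1)) * indicator {0<..} x * indicator {..<s} x = ennreal (x ^ (n - 1)) * indicator {0..s} x"
      by eventually_elim (auto simp: indicator_def)
  qed
  also have "\<dots> = ennreal (s ^ n / real n - 0 ^ n / real n)"
  proof (rule nn_integral_FTC_Icc)
    fix x :: real
    show "((\<lambda>x. x ^ n / real n) has_real_derivative x ^ (n - 1)) (at x)"
      using n by (auto intro!: derivative_eq_intros)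
  qed (use True in auto)
  finally show ?thesis using True n by (simp add: zero_power)
qed

lemma sigma_finite_radial_measure: 
  assumes n: "0 < n"
  shows "sigma_finite_measure (radial_measure n)"
proof
  show "\<exists>A. countable A \<and> A \<subseteq> sets (radial_measure n) \<and> \<Union>A = space (radial_measure n) \<and> (\<forall>a\<in>A. emeasure (radial_measure n) a \<noteq> \<infinity>)"
    by (rule exI[of _ "range (\<lambda>i::nat. {..<real i})"])
       (auto simp: emeasure_radial_measure_lessThan[OF n] reals_Archimedean2)
qed

text \<open>For fixed \<open>B\<close> both sides are measures in \<open>A\<close>. The scaling of
  cones makes them agree on the half-lines below \<open>s\<close>, which generate the Borel sets and
  are stable under intersection; finiteness of the sphere measure makes these values finite.\<close>

lemma emeasure_norm_sgn:
  fixes B :: "'a::euclidean_space set"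
  assumes A: "A \<in> sets borel" and B[measurable]: "B \<in> sets borel"
  shows "emeasure lborel {x. norm x \<in> A \<and> sgn x \<in> B} = 
    emeasure (radial_measure DIM('a)) A * emeasure (sphere_measure 0 1) B"
proof -
  define M where "M = distr (restrict_space lborel {x. sgn x \<in> B}) borel (norm :: 'a \<Rightarrow> real)"
  define N where "N = scale_measure (emeasure (sphere_measure 0 1) B) (radial_measure DIM('a))"
  have [simp]: "{x::'a. sgn x \<in> B} \<in> sets borel" by measurable
  have [measurable]: "norm \<in> borel_measurable (restrict_space lborel {x::'a. sgn x \<in> B})"
    by (rule measurable_restrict_space1) simp
  have M: "emeasure M A = emeasure lborel {x. norm x \<in> A \<and> sgn x \<in> B}" if [measurable]: "A \<in> sets borel" for A
    unfolding M_def 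
    by (subst emeasure_distr, measurable, subst emeasure_restrict_space)
      (auto simp: space_restrict_space intro!: arg_cong[where f="emeasure lborel"])
  have "M = N"
  proof (rule measure_eqI_generator_eq[where \<Omega>=UNIV and E="range lessThan" and A="\<lambda>i. {..<real i}"])
    show "Int_stable (range lessThan :: real set set)"
    proof -
      have "{..<a} \<inter> {..<b} = {..<min a b}" for a b :: real by auto
      then show ?thesis by (auto simp: Int_stable_def)
    qed
    show "sets M = sigma_sets UNIV (range lessThan)" "sets N = sigma_sets UNIV (range lessThan)"
      by (simp_all add: M_def N_def borel_Iio sets_measure_of)
    have eq: "emeasure M {..<s} = emeasure N {..<s}" for s
    proof (cases "0 \<le> s")
      case True
      have "emeasure M {..<s} = ennreal (s ^ DIM('a)) * emeasure lborel {x \<in> ball 0 1. sgn x \<in> B}"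
        using M[of "{..<s}"] emeasure_ball_cone[OF B True] by simp
      moreover have "ennreal (s ^ DIM('a)) = ennreal (real DIM('a)) * ennreal (s ^ DIM('a) / real DIM('a))"
        using True by (subst ennreal_mult[symmetric]) auto
      ultimately show ?thesis
        using True by (simp add: N_def emeasure_radial_measure_lessThan emeasure_unit_sphere_measure mult_ac)
    next
      case False
      then have "{x::'a. norm x \<in> {..<s} \<and> sgn x \<in> B} = {}"
        by (auto intro: order.strict_trans1 dest: order.strict_trans1[OF norm_ge_zero])
      then have "emeasure M {..<s} = 0"
        by (subst M) (simp_all only: emeasure_empty lessThan_borel)
      with False show ?thesis
        by (simp add: N_def emeasure_radial_measure_lessThan)
    qed
    then show "\<And>X. X \<in> range lessThan \<Longrightarrow> emeasure M X = emeasure N X" by auto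
    show "(\<Union>i. {..<real i}) = UNIV" by (auto simp: reals_Archimedean2)
    interpret finite_measure "sphere_measure (0::'a) 1" by (rule finite_sphere_measure)
    show "emeasure M {..<real i} \<noteq> \<infinity>" for i
      unfolding eq N_def 
      by (simp add: emeasure_radial_measure_lessThan ennreal_mult_eq_top_iff)
  qed auto
  with M[OF A] show ?thesis by (simp add: N_def A mult.commute)
qed

text \<open>A product of sigma-finite measures is determined by its rectangles, so the image of
  Lebesgue measure under \<open>(norm, sgn)\<close> is the product measure. Multiplying the two
  components recovers \<open>x\<close>, at the origin too since \<open>sgn 0 = 0\<close>.\<close>

lemma lborel_polar:
  "distr (radial_measure DIM('a) \<Otimes>\<^sub>M sphere_measure (0::'a::euclidean_space) 1) borel (\<lambda>(\<rho>, w). \<rho> *\<^sub>R w) = lborel"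
proof -
  have "radial_measure DIM('a) \<Otimes>\<^sub>M sphere_measure (0::'a) 1 = distr lborel (borel \<Otimes>\<^sub>M borel) (\<lambda>x. (norm x, sgn x))"
  proof (rule pair_measure_eqI)
    show "sigma_finite_measure (radial_measure DIM('a))"
      by (rule sigma_finite_radial_measure) simp
    interpret finite_measure "sphere_measure (0::'a) 1" by (rule finite_sphere_measure)
    show "sigma_finite_measure (sphere_measure (0::'a) 1)" ..
    show "sets (radial_measure DIM('a) \<Otimes>\<^sub>M sphere_measure (0::'a) 1) = sets (distr lborel (borel \<Otimes>\<^sub>M borel) (\<lambda>x::'a. (norm x, sgn x)))"
      by (simp cong: sets_pair_measure_cong)
    fix A B assume "A \<in> sets (radial_measure DIM('a))" "B \<in> sets (sphere_measure (0::'a) 1)"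
    then have [measurable]: "A \<in> sets borel" "B \<in> sets borel" by simp_all
    have "emeasure (distr lborel (borel \<Otimes>\<^sub>M borel) (\<lambda>x. (norm x, sgn x))) (A \<times> B) = emeasure lborel {x. norm x \<in> A \<and> sgn x \<in> B}"
      by (subst emeasure_distr) (auto intro!: arg_cong[where f="emeasure lborel"])
    then show "emeasure (radial_measure DIM('a)) A * emeasure (sphere_measure 0 1) B =
       emeasure (distr lborel (borel \<Otimes>\<^sub>M borel) (\<lambda>x. (norm x, sgn x))) (A \<times> B)"
      by (simp add: emeasure_norm_sgn)
  qed
  then have "distr (radial_measure DIM('a) \<Otimes>\<^sub>M sphere_measure (0::'a) 1) borel (\<lambda>(\<rho>, w). \<rho> *\<^sub>R w) = 
      distr (distr lborel (borel \<Otimes>\<^sub>M borel) (\<lambda>x::'a. (norm x, sgn x))) borel (\<lambda>(\<rho>, w). \<rho> *\<^sub>R w)"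
    by simp
  also have "\<dots> = distr lborel borel (\<lambda>x::'a. norm x *\<^sub>R sgn x)"
    by (subst distr_distr) (auto simp: o_def)
  also have "\<dots> = distr lborel lborel (\<lambda>x::'a. x)"
  proof (rule distr_cong)
    show "norm x *\<^sub>R sgn x = x" for x :: 'a
      by (cases "x = 0") (auto simp: sgn_div_norm)
  qed auto
  also have "\<dots> = lborel" by (simp add: distr_id)
  finally show ?thesis .
qed

text \<open>For \<open>c = 0\<close> any unit vector serves; this spares later arguments along the
  axis of \<open>c\<close> a separate case for a centre at the origin.\<close>

lemma unit_vector_cases:
  fixes c :: "'a::euclidean_space"
  obtains e where "norm e = 1" "c = norm c *\<^sub>R e"
proof (cases "c = 0")
  case True
  obtain e :: 'a where "e \<in> Basis" using nonempty_Basis by blast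
  with that[of e] True show ?thesis by simp
next
  case False
  with that[of "sgn c"] show ?thesis by (simp add: norm_sgn sgn_div_norm)
qed

lemma abs_inner_unit_le_1: "norm e = 1 \<Longrightarrow> norm w = 1 \<Longrightarrow> \<bar>e \<bullet> w\<bar> \<le> 1"
  using Cauchy_Schwarz_ineq2[of e w] by simp

section \<open>Unnormalised integrals of continuous functions over the unit sphere\<close>

definition sint :: "('a::euclidean_space \<Rightarrow> real) \<Rightarrow> real" where
  "sint \<phi> = (LINT w:sphere 0 1|sphere_measure 0 1. \<phi> w)"

lemma set_integrable_sphere:
  fixes \<phi> :: "'a::euclidean_space \<Rightarrow> 'b::{banach, second_countable_topology}"
  assumes "continuous_on (sphere 0 1) \<phi>"
  shows "set_integrable (sphere_measure 0 1) (sphere 0 1) \<phi>"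
proof -
  interpret finite_measure "sphere_measure (0::'a) 1" by (rule finite_sphere_measure)
  have "bounded (\<phi> ` sphere 0 1)"
    by (intro compact_imp_bounded compact_continuous_image assms compact_sphere)
  then obtain B where B: "\<And>w. w \<in> sphere 0 1 \<Longrightarrow> norm (\<phi> w) \<le> B"
    by (fastforce simp: bounded_iff)
  show ?thesis
    unfolding set_integrable_def
  proof (rule integrable_const_bound[where B="\<bar>B\<bar>"])
    show "(\<lambda>x. indicator (sphere 0 1) x *\<^sub>R \<phi> x) \<in> borel_measurable (sphere_measure 0 1)"
      using borel_measurable_continuous_on_indicator[OF _ assms] by simp
    show "AE x in sphere_measure 0 1. norm (indicator (sphere 0 1) x *\<^sub>R \<phi> x) \<le> \<bar>B\<bar>"
      by (intro always_eventually allI) (use B in \<open>force simp: indicator_def\<close>)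
  qed
qed

lemma sint_cong: "(\<And>w. norm w = 1 \<Longrightarrow> \<phi> w = \<psi> w) \<Longrightarrow> sint \<phi> = sint \<psi>"
  unfolding sint_def by (intro set_lebesgue_integral_cong) auto

lemma sint_add:
  assumes "continuous_on (sphere 0 1) \<phi>" "continuous_on (sphere 0 1) \<psi>"
  shows "sint (\<lambda>w. \<phi> w + \<psi> w) = sint \<phi> + sint \<psi>"
  unfolding sint_def using assms by (intro set_integral_add set_integrable_sphere)

lemma sint_diff:
  assumes "continuous_on (sphere 0 1) \<phi>" "continuous_on (sphere 0 1) \<psi>"
  shows "sint (\<lambda>w. \<phi> w - \<psi> w) = sint \<phi> - sint \<psi>"
  unfolding sint_def using assms by (intro set_integral_diff set_integrable_sphere)

lemma sint_cmult: "sint (\<lambda>w. c * \<phi> w) = c * sint \<phi>"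
  unfolding sint_def by (rule set_integral_mult_right)

lemma sint_zero [simp]: "sint (\<lambda>w. 0) = 0"
  by (simp add: sint_def)

lemma sint_sum:
  assumes "\<And>i. i \<in> I \<Longrightarrow> continuous_on (sphere 0 1) (\<phi> i)"
  shows "sint (\<lambda>w. \<Sum>i\<in>I. \<phi> i w) = (\<Sum>i\<in>I. sint (\<phi> i))"
  using assms
proof (induction I rule: infinite_finite_induct)
  case (insert i I)
  then show ?case by (simp add: sint_add continuous_on_sum)
qed simp_all

lemma sint_mono:
  assumes "continuous_on (sphere 0 1) \<phi>" "continuous_on (sphere 0 1) \<psi>"
    "\<And>w. norm w = 1 \<Longrightarrow> \<phi> w \<le> \<psi> w"
  shows "sint \<phi> \<le> sint \<psi>"
  unfolding sint_def using assms by (intro set_integral_mono set_integrable_sphere) auto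

lemma sint_abs_le:
  assumes "continuous_on (sphere 0 1) \<phi>"
  shows "\<bar>sint \<phi>\<bar> \<le> sint (\<lambda>w. \<bar>\<phi> w\<bar>)"
proof -
  have "sint (\<lambda>w. -1 * \<phi> w) \<le> sint (\<lambda>w. \<bar>\<phi> w\<bar>)" "sint \<phi> \<le> sint (\<lambda>w. \<bar>\<phi> w\<bar>)"
    by (intro sint_mono continuous_intros assms; simp)+
  then show ?thesis by (simp only: sint_cmult abs_le_iff) simp
qed

text \<open>Lebesgue measure and the unit ball are invariant under reflection in the origin, and
  \<open>sgn\<close> is odd, so the image measure on the sphere is invariant as well.\<close>

lemma sint_uminus:
  fixes \<phi> :: "'a::euclidean_space \<Rightarrow> real"
  assumes "continuous_on (sphere 0 1) \<phi>"
  shows "sint (\<lambda>w. \<phi> (- w)) = sint \<phi>"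
proof -
  have L: "distr lborel borel uminus = (lborel :: 'a measure)"
    by (subst lborel_affine[of "-1" 0]) (auto simp: density_1 one_ennreal_def[symmetric])
  define \<kappa> where "\<kappa> = density lborel (\<lambda>x::'a. ennreal (real DIM('a)) * indicator (ball 0 1) x)"
  have [measurable_cong]: "sets \<kappa> = sets borel" by (simp add: \<kappa>_def)
  have K: "distr \<kappa> borel uminus = \<kappa>"
  proof -
    have "distr \<kappa> borel uminus = density (distr lborel borel uminus) (\<lambda>x::'a. ennreal (real DIM('a)) * indicator (ball 0 1) x)"
      unfolding \<kappa>_def
      by (subst density_distr) (auto simp: indicator_def[abs_def] intro!: borel_measurable_times_ennreal borel_measurable_indicator)
    then show ?thesis by (simp add: L \<kappa>_def)
  qed
  have S: "sphere_measure 0 1 = distr \<kappa> borel sgn"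
    by (simp add: sphere_measure_def \<kappa>_def)
  have "distr (sphere_measure 0 1) borel uminus = distr \<kappa> borel (\<lambda>x. sgn (- x))"
    unfolding S by (subst distr_distr) (auto simp: o_def sgn_minus)
  also have "\<dots> = distr (distr \<kappa> borel uminus) borel sgn"
    by (subst distr_distr) (auto simp: o_def)
  also have "\<dots> = sphere_measure 0 1" by (simp add: K S)
  finally have D: "distr (sphere_measure 0 1) borel uminus = (sphere_measure 0 1 :: 'a measure)" .
  have "sint \<phi> = integral\<^sup>L (distr (sphere_measure 0 1) borel uminus) (\<lambda>w. indicator (sphere 0 1) w *\<^sub>R \<phi> w)"
    by (simp add: D sint_def set_lebesgue_integral_def)
  also have "\<dots> = integral\<^sup>L (sphere_measure 0 1) (\<lambda>w. indicator (sphere 0 1) (- w) *\<^sub>R \<phi> (- w))"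
    using borel_measurable_continuous_on_indicator[OF _ assms] by (subst integral_distr) auto
  also have "\<dots> = sint (\<lambda>w. \<phi> (- w))"
    by (simp add: sint_def set_lebesgue_integral_def indicator_def)
  finally show ?thesis ..
qed

text \<open>The total mass is the dimension times the volume of the unit ball.\<close>

lemma sint_1_pos: "0 < sint (\<lambda>w::'a::euclidean_space. 1)"
proof -
  interpret finite_measure "sphere_measure (0::'a) 1" by (rule finite_sphere_measure)
  have "sint (\<lambda>w::'a. 1) = measure (sphere_measure 0 1) (sphere (0::'a) 1)"
    by (simp add: sint_def set_lebesgue_integral_def)
  also have "\<dots> = measure (sphere_measure 0 1) (UNIV :: 'a set)"
    using AE_sphere_measure[where 'a='a] by (intro finite_measure_eq_AE) auto
  also have "0 < \<dots>"
  proof -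
    have "emeasure (sphere_measure 0 1) (UNIV :: 'a set) = ennreal (real DIM('a)) * emeasure lborel (ball (0::'a) 1)"
      by (subst emeasure_unit_sphere_measure) (auto simp: ball_def dist_norm)
    also have "emeasure lborel (ball (0::'a) 1) = ennreal (measure lborel (ball (0::'a) 1))"
      using emeasure_lborel_ball_finite[of "0::'a" 1] by (intro emeasure_eq_ennreal_measure) auto
    also have "ennreal (real DIM('a)) * \<dots> = ennreal (real DIM('a) * measure lborel (ball (0::'a) 1))"
      by (simp add: ennreal_mult')
    finally have "measure (sphere_measure 0 1) (UNIV :: 'a set) = real DIM('a) * measure lborel (ball (0::'a) 1)"
      by (simp add: measure_def enn2real_mult)
    then show ?thesis using content_ball_pos[of 1 "0::'a"] by simp
  qed
  finally show ?thesis .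
qed

lemma continuous_on_curry:
  assumes "continuous_on (A \<times> B) (\<lambda>(\<rho>, w). F \<rho> w)" "\<rho> \<in> A"
  shows "continuous_on B (F \<rho>)"
  using continuous_on_compose2[OF assms(1), of B "\<lambda>w. (\<rho>, w)"] assms(2)
  by (force intro!: continuous_intros)

lemma continuous_on_curry':
  assumes "continuous_on (A \<times> B) (\<lambda>(\<rho>, w). F \<rho> w)" "w \<in> B"
  shows "continuous_on A (\<lambda>\<rho>. F \<rho> w)"
  using continuous_on_compose2[OF assms(1), of A "\<lambda>\<rho>. (\<rho>, w)"] assms(2)
  by (force intro!: continuous_intros)

lemma continuous_on_sint:
  fixes F :: "real \<Rightarrow> 'a::euclidean_space \<Rightarrow> real"
  assumes F: "continuous_on ({l..h} \<times> sphere 0 1) (\<lambda>(\<rho>, w). F \<rho> w)"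
  shows "continuous_on {l..h} (\<lambda>\<rho>. sint (F \<rho>))"
proof -
  interpret finite_measure "sphere_measure (0::'a) 1" by (rule finite_sphere_measure)
  have "bounded ((\<lambda>(\<rho>, w). F \<rho> w) ` ({l..h} \<times> sphere 0 1))"
    by (intro compact_imp_bounded compact_continuous_image F compact_Times) auto
  then obtain B where B: "\<And>\<rho> w. \<rho> \<in> {l..h} \<Longrightarrow> w \<in> sphere 0 1 \<Longrightarrow> norm (F \<rho> w) \<le> B"
    by (fastforce simp: bounded_iff)
  show ?thesis
    unfolding continuous_on_sequentially sint_def set_lebesgue_integral_def o_def
  proof safe
    fix x a assume a: "a \<in> {l..h}" and x: "\<forall>n. x n \<in> {l..h}" "x \<longlonglongrightarrow> a"
    show "(\<lambda>n. LINT w|sphere_measure 0 1. indicator (sphere 0 1) w *\<^sub>R F (x n) w)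
        \<longlonglongrightarrow> (LINT w|sphere_measure 0 1. indicator (sphere 0 1) w *\<^sub>R F a w)"
    proof (rule integral_dominated_convergence[where w="\<lambda>_. \<bar>B\<bar>"])
      have *: "(\<lambda>w. indicator (sphere 0 1) w *\<^sub>R F \<rho> w) \<in> borel_measurable (sphere_measure 0 1)" if "\<rho> \<in> {l..h}" for \<rho>
        using borel_measurable_continuous_on_indicator[OF _ continuous_on_curry[OF F that]] by simp
      show "(\<lambda>w. indicator (sphere 0 1) w *\<^sub>R F a w) \<in> borel_measurable (sphere_measure 0 1)"
        "\<And>n. (\<lambda>w. indicator (sphere 0 1) w *\<^sub>R F (x n) w) \<in> borel_measurable (sphere_measure 0 1)"
        by (rule *; use a x in simp)+
      show "AE w in sphere_measure 0 1. norm (indicator (sphere 0 1) w *\<^sub>R F (x n) w) \<le> \<bar>B\<bar>" for n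
        by (intro always_eventually allI) (use B[of "x n"] x in \<open>force simp: indicator_def\<close>)
      have "(\<lambda>n. F (x n) w) \<longlonglongrightarrow> F a w" if "w \<in> sphere 0 1" for w
        using continuous_on_curry'[OF F that] a x unfolding continuous_on_sequentially o_def by auto
      then show "AE w in sphere_measure 0 1. (\<lambda>n. indicator (sphere 0 1) w *\<^sub>R F (x n) w) \<longlonglongrightarrow> indicator (sphere 0 1) w *\<^sub>R F a w"
        by (intro always_eventually allI) (auto simp: indicator_def)
    qed auto
  qed
qed

lemma sint_Fubini:
  fixes F :: "real \<Rightarrow> 'a::euclidean_space \<Rightarrow> real"
  assumes F: "continuous_on ({l..h} \<times> sphere 0 1) (\<lambda>(\<rho>, w). F \<rho> w)"
  shows "integral {l..h} (\<lambda>\<rho>. sint (F \<rho>)) = sint (\<lambda>w. integral {l..h} (\<lambda>\<rho>. F \<rho> w))"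
proof -
  interpret M: finite_measure "sphere_measure (0::'a) 1" by (rule finite_sphere_measure)
  interpret pair_sigma_finite "lborel :: real measure" "sphere_measure (0::'a) 1" ..
  let ?K = "{l..h} \<times> sphere (0::'a) 1"
  let ?G = "\<lambda>(\<rho>, w). indicator ?K (\<rho>, w) *\<^sub>R F \<rho> w"
  have "bounded ((\<lambda>(\<rho>, w). F \<rho> w) ` ?K)"
    by (intro compact_imp_bounded compact_continuous_image F compact_Times) auto
  then obtain B where B: "\<And>\<rho> w. \<rho> \<in> {l..h} \<Longrightarrow> w \<in> sphere 0 1 \<Longrightarrow> norm (F \<rho> w) \<le> B"
    by (fastforce simp: bounded_iff)
  have sets: "sets (lborel \<Otimes>\<^sub>M sphere_measure (0::'a) 1) = sets (borel :: (real \<times> 'a) measure)"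
    by (simp add: borel_prod[symmetric] cong: sets_pair_measure_cong)
  have meas: "?G \<in> borel_measurable (lborel \<Otimes>\<^sub>M sphere_measure 0 1)"
    using borel_measurable_continuous_on_indicator[OF _ F]
    unfolding measurable_cong_sets[OF sets refl]
    by (simp add: case_prod_beta' closed_Times)
  have int: "integrable (lborel \<Otimes>\<^sub>M sphere_measure 0 1) ?G"
  proof (rule integrableI_bounded_set[where A="?K" and B="\<bar>B\<bar>"])
    show "emeasure (lborel \<Otimes>\<^sub>M sphere_measure (0::'a) 1) ?K < \<infinity>"
      by (subst M.emeasure_pair_measure_Times)
         (auto simp: ennreal_mult_eq_top_iff M.emeasure_finite emeasure_lborel_Icc_eq simp flip: top.not_eq_extremum)
    show "AE x in lborel \<Otimes>\<^sub>M sphere_measure 0 1. x \<in> ?K \<longrightarrow> norm (?G x) \<le> \<bar>B\<bar>"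
      by (intro always_eventually allI impI) (auto intro!: order.trans[OF B[unfolded real_norm_def]])
    show "?K \<in> sets (lborel \<Otimes>\<^sub>M sphere_measure (0::'a) 1)"
      unfolding sets by (intro borel_closed closed_Times) auto
    show "AE x in lborel \<Otimes>\<^sub>M sphere_measure 0 1. x \<notin> ?K \<longrightarrow> ?G x = 0"
      by (intro always_eventually allI impI) (simp add: case_prod_beta')
  qed (rule meas)
  have "(LINT w|sphere_measure 0 1. LINT \<rho>|lborel. ?G (\<rho>, w)) = (LINT \<rho>|lborel. LINT w|sphere_measure 0 1. ?G (\<rho>, w))"
    using Fubini_integral[of "\<lambda>\<rho> w. ?G (\<rho>, w)"] int by simp
  also have "(LINT w|sphere_measure 0 1. LINT \<rho>|lborel. ?G (\<rho>, w)) = sint (\<lambda>w. integral {l..h} (\<lambda>\<rho>. F \<rho> w))"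
    unfolding sint_def set_lebesgue_integral_def
  proof (rule Bochner_Integration.integral_cong[OF refl])
    fix w :: 'a
    show "(LINT \<rho>|lborel. ?G (\<rho>, w)) = indicator (sphere 0 1) w *\<^sub>R integral {l..h} (\<lambda>\<rho>. F \<rho> w)"
    proof (cases "w \<in> sphere 0 1")
      case True
      have "set_integrable lborel {l..h} (\<lambda>\<rho>. F \<rho> w)"
        using continuous_on_curry'[OF F True] by (rule borel_integrable_atLeastAtMost')
      from set_borel_integral_eq_integral(2)[OF this] True show ?thesis
        by (simp add: set_lebesgue_integral_def indicator_times)
    next
      case False
      then show ?thesis by (simp add: indicator_times)
    qed
  qed
  also have "(LINT \<rho>|lborel. LINT w|sphere_measure 0 1. ?G (\<rho>, w)) = (LINT \<rho>:{l..h}|lborel. sint (F \<rho>))"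
    unfolding set_lebesgue_integral_def
    by (intro Bochner_Integration.integral_cong[OF refl])
       (auto simp: sint_def set_lebesgue_integral_def indicator_times mult.assoc)
  also have "\<dots> = integral {l..h} (\<lambda>\<rho>. sint (F \<rho>))"
    by (intro set_borel_integral_eq_integral borel_integrable_atLeastAtMost' continuous_on_sint F)
  finally show ?thesis ..
qed

section \<open>Polar coordinates on spherical shells\<close>

definition shell :: "real \<Rightarrow> real \<Rightarrow> 'a::euclidean_space set" where
  "shell l h = {y. l \<le> norm y \<and> norm y \<le> h}"

lemma compact_shell: "compact (shell l h)"
proof -
  have "closed (shell l h :: 'a set)" unfolding shell_def
    by (intro closed_Collect_conj closed_Collect_le continuous_intros)
  moreover have "bounded (shell l h :: 'a set)"
    by (rule bounded_subset[OF bounded_cball[of 0 h]]) (auto simp: shell_def)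
  ultimately show ?thesis by (simp add: compact_eq_bounded_closed)
qed

lemma set_integrable_compact:
  fixes f :: "'a::euclidean_space \<Rightarrow> real"
  assumes "compact K" "continuous_on K f"
  shows "set_integrable lborel K f"
  using borel_integrable_compact[OF assms] by (simp add: set_integrable_def mult.commute if_distrib indicator_def cong: if_cong)

text \<open>The sphere measure is concentrated on unit vectors, where the indicator of the shell at
  \<open>\<rho> *\<^sub>R w\<close> depends on \<open>\<rho>\<close> alone and can be taken out of
  the spherical integral.\<close>

lemma polar_shell:
  fixes G :: "'a::euclidean_space \<Rightarrow> real"
  assumes l: "0 < l" and G: "continuous_on (shell l h) G"
  shows "continuous_on ({l..h} \<times> sphere 0 1) (\<lambda>(\<rho>, w). G (\<rho> *\<^sub>R w))"
    and "(LINT y:shell l h|lborel. G y) = integral {l..h} (\<lambda>\<rho>. \<rho> ^ (DIM('a) - 1) * sint (\<lambda>w. G (\<rho> *\<^sub>R w)))"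
proof -
  show c: "continuous_on ({l..h} \<times> sphere 0 1) (\<lambda>(\<rho>, w). G (\<rho> *\<^sub>R w))"
    unfolding case_prod_beta'
    by (rule continuous_on_compose2[OF G]) (use l in \<open>auto simp: shell_def intro!: continuous_intros\<close>)
  interpret M: finite_measure "sphere_measure (0::'a) 1" by (rule finite_sphere_measure)
  interpret R: sigma_finite_measure "radial_measure DIM('a)" by (rule sigma_finite_radial_measure) simp
  interpret pair_sigma_finite "radial_measure DIM('a)" "sphere_measure (0::'a) 1" ..
  let ?N = "radial_measure DIM('a) \<Otimes>\<^sub>M sphere_measure (0::'a) 1"
  let ?G = "\<lambda>y. indicator (shell l h) y *\<^sub>R G y"
  have mG[measurable]: "?G \<in> borel_measurable borel"
    by (intro borel_measurable_continuous_on_indicator G borel_compact compact_shell)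
  have [measurable]: "(\<lambda>(\<rho>, w). \<rho> *\<^sub>R w) \<in> ?N \<rightarrow>\<^sub>M (borel :: 'a measure)" by measurable
  have "integrable lborel ?G"
    using set_integrable_compact[OF compact_shell G] by (simp add: set_integrable_def)
  then have int: "integrable ?N (\<lambda>(\<rho>, w). ?G (\<rho> *\<^sub>R w))"
    by (subst (asm) lborel_polar[symmetric], subst (asm) integrable_distr_eq) (auto simp: case_prod_beta')
  have "(LINT y:shell l h|lborel. G y) = integral\<^sup>L (distr ?N borel (\<lambda>(\<rho>, w). \<rho> *\<^sub>R w)) ?G"
    by (simp add: set_lebesgue_integral_def lborel_polar)
  also have "\<dots> = (LINT x|?N. (\<lambda>(\<rho>, w). ?G (\<rho> *\<^sub>R w)) x)"
    by (subst integral_distr[OF _ mG]) (auto simp: case_prod_beta')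
  also have "\<dots> = (LINT \<rho>|radial_measure DIM('a). LINT w|sphere_measure 0 1. ?G (\<rho> *\<^sub>R w))"
    using integral_fst'[OF int] by simp
  also have "\<dots> = (LINT \<rho>|lborel. (\<rho> ^ (DIM('a) - 1) * indicator {0<..} \<rho>) *\<^sub>R (LINT w|sphere_measure 0 1. ?G (\<rho> *\<^sub>R w)))"
  proof -
    have "radial_measure DIM('a) = density lborel (\<lambda>\<rho>. ennreal (\<rho> ^ (DIM('a) - 1) * indicator {0<..} \<rho>))"
      unfolding radial_measure_def by (intro density_cong) (auto simp: indicator_def)
    moreover have "(\<lambda>\<rho>. LINT w|sphere_measure 0 1. ?G (\<rho> *\<^sub>R w)) \<in> borel_measurable borel"
      using M.borel_measurable_lebesgue_integral[of "\<lambda>\<rho> w. ?G (\<rho> *\<^sub>R w)" borel] by measurable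
    ultimately show ?thesis
      by (simp add: integral_density indicator_def)
  qed
  also have "\<dots> = (LINT \<rho>:{l..h}|lborel. \<rho> ^ (DIM('a) - 1) * sint (\<lambda>w. G (\<rho> *\<^sub>R w)))"
    unfolding set_lebesgue_integral_def
  proof (rule Bochner_Integration.integral_cong[OF refl])
    fix \<rho> :: real
    have "(LINT w|sphere_measure 0 1. ?G (\<rho> *\<^sub>R w)) = indicator {l..h} \<rho> * sint (\<lambda>w. G (\<rho> *\<^sub>R w))" if "\<rho> > 0"
    proof -
      have "(LINT w|sphere_measure 0 1. ?G (\<rho> *\<^sub>R w)) = (LINT w|sphere_measure 0 1. indicator {l..h} \<rho> * (indicator (sphere 0 1) w *\<^sub>R G (\<rho> *\<^sub>R w)))"
      proof (rule integral_cong_AE)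
        have "(\<lambda>w::'a. \<rho> *\<^sub>R w) \<in> borel \<rightarrow>\<^sub>M borel" by measurable
        from measurable_compose[OF this \<open>?G \<in> borel_measurable borel\<close>]
        show "(\<lambda>w. ?G (\<rho> *\<^sub>R w)) \<in> borel_measurable (sphere_measure 0 1)" by simp
        have "(\<lambda>w. indicator (sphere 0 1) w *\<^sub>R (indicator {l..h} \<rho> * G (\<rho> *\<^sub>R w))) \<in> borel_measurable borel"
        proof (cases "\<rho> \<in> {l..h}")
          case True
          show ?thesis
            by (intro borel_measurable_continuous_on_indicator continuous_intros continuous_on_curry[OF c True]) auto
        qed simp
        then show "(\<lambda>w. indicator {l..h} \<rho> * (indicator (sphere 0 1) w *\<^sub>R G (\<rho> *\<^sub>R w))) \<in> borel_measurable (sphere_measure 0 1)"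
          by (simp add: mult_ac)
        show "AE w in sphere_measure 0 1. ?G (\<rho> *\<^sub>R w) = indicator {l..h} \<rho> * (indicator (sphere 0 1) w *\<^sub>R G (\<rho> *\<^sub>R w))"
          using AE_sphere_measure[where 'a='a] by eventually_elim (use that in \<open>auto simp: indicator_def shell_def\<close>)
      qed
      then show ?thesis by (simp add: sint_def set_lebesgue_integral_def)
    qed
    then show "(\<rho> ^ (DIM('a) - 1) * indicator {0<..} \<rho>) *\<^sub>R (LINT w|sphere_measure 0 1. ?G (\<rho> *\<^sub>R w)) =
         indicator {l..h} \<rho> *\<^sub>R (\<rho> ^ (DIM('a) - 1) * sint (\<lambda>w. G (\<rho> *\<^sub>R w)))"
      using l by (auto simp: indicator_def)
  qed
  also have "\<dots> = integral {l..h} (\<lambda>\<rho>. \<rho> ^ (DIM('a) - 1) * sint (\<lambda>w. G (\<rho> *\<^sub>R w)))"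
    by (intro set_borel_integral_eq_integral borel_integrable_atLeastAtMost' continuous_intros continuous_on_sint c)
  finally show "(LINT y:shell l h|lborel. G y) = integral {l..h} (\<lambda>\<rho>. \<rho> ^ (DIM('a) - 1) * sint (\<lambda>w. G (\<rho> *\<^sub>R w)))" .
qed

section \<open>Test functions with vanishing moments\<close>

text \<open>The moment conditions say that \<open>\<psi>\<close> is the \<open>k\<close>-th
  derivative of a function supported in the same interval, without mentioning iterated
  derivatives.\<close>

definition test_fun :: "nat \<Rightarrow> real \<Rightarrow> real \<Rightarrow> (real \<Rightarrow> real) \<Rightarrow> bool" where
  "test_fun k \<alpha> \<beta> \<psi> \<longleftrightarrow> continuous_on UNIV \<psi> \<and> (\<forall>u. u \<notin> {\<alpha><..<\<beta>} \<longrightarrow> \<psi> u = 0) \<and>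
     (\<forall>j<k. integral {\<alpha>..\<beta>} (\<lambda>u. u ^ j * \<psi> u) = 0)"

lemma test_fun_antimono: "test_fun k \<alpha> \<beta> \<psi> \<Longrightarrow> j \<le> k \<Longrightarrow> test_fun j \<alpha> \<beta> \<psi>"
  by (auto simp: test_fun_def)

lemma test_fun_cont: "test_fun k \<alpha> \<beta> \<psi> \<Longrightarrow> continuous_on A \<psi>"
  by (auto simp: test_fun_def intro: continuous_on_subset)

lemma test_fun_outside: "test_fun k \<alpha> \<beta> \<psi> \<Longrightarrow> u \<le> \<alpha> \<or> \<beta> \<le> u \<Longrightarrow> \<psi> u = 0"
  by (auto simp: test_fun_def)

text \<open>The moment of order 0 makes the antiderivative vanish again to the right of
  \<open>\<beta>\<close>. Integration by parts then turns the moment of order \<open>j + 1\<close>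
  of \<open>\<psi>\<close> into the moment of order \<open>j\<close> of the antiderivative.\<close>

lemma test_fun_antiderivative:
  assumes T: "test_fun (Suc k) \<alpha> \<beta> \<psi>" and ab: "\<alpha> < \<beta>"
  obtains \<Psi> where "test_fun k \<alpha> \<beta> \<Psi>" "\<And>u. (\<Psi> has_real_derivative \<psi> u) (at u)"
proof -
  note cont = test_fun_cont[OF T] and out = test_fun_outside[OF T]
  \<comment> \<open>Starting left of \<open>\<alpha>\<close> makes \<open>\<alpha>\<close> an
    interior point, so that the fundamental theorem gives a two-sided derivative there.\<close>
  define \<Psi> where "\<Psi> u = integral {\<alpha> - 1..u} \<psi>" for u
  have int: "\<psi> integrable_on {x..y}" for x y
    by (intro integrable_continuous_interval cont)
  have low: "\<Psi> u = 0" if "u \<le> \<alpha>" for u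
  proof -
    have "\<Psi> u = integral {\<alpha> - 1..u} (\<lambda>_. 0)"
      unfolding \<Psi>_def using that by (intro integral_cong) (auto intro: out)
    then show ?thesis by simp
  qed
  have split: "\<Psi> v = \<Psi> u + integral {u..v} \<psi>" if "\<alpha> \<le> u" "u \<le> v" for u v
    unfolding \<Psi>_def using that by (intro Henstock_Kurzweil_Integration.integral_combine[symmetric] int) auto
  have high: "\<Psi> u = 0" if "\<beta> \<le> u" for u
  proof -
    have "integral {\<alpha>..\<beta>} (\<lambda>u. u ^ 0 * \<psi> u) = 0" using T unfolding test_fun_def by blast
    then have "\<Psi> \<beta> = 0" using split[of \<alpha> \<beta>] low[of \<alpha>] ab by simp
    moreover have "integral {\<beta>..u} \<psi> = integral {\<beta>..u} (\<lambda>_. 0)"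
      by (intro integral_cong) (auto intro: out)
    ultimately show ?thesis using split[of \<beta> u] that ab by simp
  qed
  have der: "(\<Psi> has_real_derivative \<psi> u) (at u)" for u
  proof (cases "u < \<alpha>")
    case True
    have "((\<lambda>_. 0) has_real_derivative 0) (at u)" by simp
    then have "(\<Psi> has_real_derivative 0) (at u)"
      by (rule has_field_derivative_transform_within_open[where S="{..<\<alpha>}"]) (use True low in auto)
    then show ?thesis using out[of u] True by simp
  next
    case False
    have "((\<lambda>u. integral {\<alpha> - 1..u} \<psi>) has_real_derivative \<psi> u) (at u within {\<alpha> - 1..u + 1})"
      by (intro integral_has_real_derivative cont) (use False in auto)
    moreover have "at u within {\<alpha> - 1..u + 1} = at u"
      using False by (intro at_within_interior) auto
    ultimately show ?thesis by (simp add: \<Psi>_def[abs_def])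
  qed
  have contP: "continuous_on A \<Psi>" for A
    by (rule DERIV_continuous_on, rule has_field_derivative_at_within, rule der)
  have "integral {\<alpha>..\<beta>} (\<lambda>u. u ^ j * \<Psi> u) = 0" if j: "j < k" for j
  proof -
    have "((\<lambda>u. real (Suc j) * (u ^ j * \<Psi> u) + u ^ Suc j * \<psi> u) has_integral \<beta> ^ Suc j * \<Psi> \<beta> - \<alpha> ^ Suc j * \<Psi> \<alpha>) {\<alpha>..\<beta>}"
    proof (rule fundamental_theorem_of_calculus)
      fix u
      show "((\<lambda>u. u ^ Suc j * \<Psi> u) has_vector_derivative real (Suc j) * (u ^ j * \<Psi> u) + u ^ Suc j * \<psi> u) (at u within {\<alpha>..\<beta>})"
        unfolding has_real_derivative_iff_has_vector_derivative[symmetric]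
        by (rule has_field_derivative_at_within, rule DERIV_cong[OF DERIV_mult[OF DERIV_pow der]])
           (simp add: algebra_simps)
    qed (use ab in simp)
    then have "integral {\<alpha>..\<beta>} (\<lambda>u. real (Suc j) * (u ^ j * \<Psi> u) + u ^ Suc j * \<psi> u) = 0"
      using low[of \<alpha>] high[of \<beta>] by (simp add: integral_unique)
    moreover have "integral {\<alpha>..\<beta>} (\<lambda>u. real (Suc j) * (u ^ j * \<Psi> u) + u ^ Suc j * \<psi> u) =
       real (Suc j) * integral {\<alpha>..\<beta>} (\<lambda>u. u ^ j * \<Psi> u) + integral {\<alpha>..\<beta>} (\<lambda>u. u ^ Suc j * \<psi> u)"
      by (subst Henstock_Kurzweil_Integration.integral_add)
         (intro integrable_continuous_interval continuous_intros contP cont | simp)+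
    moreover have "integral {\<alpha>..\<beta>} (\<lambda>u. u ^ Suc j * \<psi> u) = 0"
      using T j unfolding test_fun_def by (meson Suc_mono)
    ultimately show ?thesis by simp
  qed
  then have "test_fun k \<alpha> \<beta> \<Psi>"
    unfolding test_fun_def using contP low high by (auto simp: not_less)
  with der that show ?thesis by blast
qed

text \<open>Vanishing of all coefficients from \<open>k\<close> on expresses degree less than
  \<open>k\<close> in a form that is also right for \<open>k = 0\<close>, where it forces the zero
  polynomial.\<close>

lemma poly_altdef_lessThan:
  fixes p :: "'a::comm_ring_1 poly"
  assumes "\<And>i. k \<le> i \<Longrightarrow> coeff p i = 0"
  shows "poly p x = (\<Sum>m<k. coeff p m * x ^ m)"
proof -
  have "poly p x = (\<Sum>m\<le>degree p. coeff p m * x ^ m)" by (rule poly_altdef)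
  also have "\<dots> = (\<Sum>m<k. coeff p m * x ^ m)"
  proof (rule sum.mono_neutral_cong)
    show "coeff p i * x ^ i = 0" if "i \<in> {..degree p} - {..<k}" for i using that assms by auto
    show "coeff p i * x ^ i = 0" if "i \<in> {..<k} - {..degree p}" for i using that by (auto simp: coeff_eq_0)
  qed auto
  finally show ?thesis .
qed

lemma poly_eq_on_interval:
  fixes p q :: "real poly"
  assumes "\<alpha> < \<beta>" "\<And>u. \<alpha> < u \<Longrightarrow> u < \<beta> \<Longrightarrow> poly p u = poly q u"
  shows "p = q"
proof (rule ccontr)
  assume "p \<noteq> q"
  then have "finite {u. poly (p - q) u = 0}" by (intro poly_roots_finite) simp
  moreover have "{\<alpha><..<\<beta>} \<subseteq> {u. poly (p - q) u = 0}" using assms(2) by auto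
  ultimately show False using assms(1) infinite_Ioo[of \<alpha> \<beta>] finite_subset by blast
qed

text \<open>Induction on \<open>k\<close>. Any test function of order \<open>k\<close> becomes one
  of order \<open>k + 1\<close> after subtracting a multiple of a fixed one with nonzero
  \<open>k\<close>-th moment. Consequently \<open>w\<close> minus a suitable multiple of
  \<open>u ^ k\<close> is orthogonal to all test functions of order \<open>k\<close>.\<close>

lemma orthogonal_test_fun_imp_poly:
  assumes "\<alpha> < \<beta>" "continuous_on {\<alpha>..\<beta>} w"
    and "\<And>\<psi>. test_fun k \<alpha> \<beta> \<psi> \<Longrightarrow> integral {\<alpha>..\<beta>} (\<lambda>u. w u * \<psi> u) = 0"
  shows "\<exists>p. (\<forall>i\<ge>k. coeff p i = 0) \<and> (\<forall>u. \<alpha> < u \<and> u < \<beta> \<longrightarrow> w u = poly p u)"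
  using assms(2,3)
proof (induction k arbitrary: w)
  case 0
  \<comment> \<open>The test function is \<open>w\<close> itself times a weight positive exactly
    inside the interval; the argument of \<open>w\<close> is clamped so that the product is
    continuous on the whole line.\<close>
  define \<psi> where "\<psi> u = max 0 ((u - \<alpha>) * (\<beta> - u)) * w (max \<alpha> (min \<beta> u))" for u
  have "test_fun 0 \<alpha> \<beta> \<psi>"
    unfolding test_fun_def
  proof (intro conjI allI impI)
    show "continuous_on UNIV \<psi>"
      unfolding \<psi>_def using assms(1)
      by (intro continuous_intros continuous_on_compose2[OF 0(1)]) auto
    show "\<psi> u = 0" if "u \<notin> {\<alpha><..<\<beta>}" for u
    proof -
      have "(u - \<alpha>) * (\<beta> - u) \<le> 0"
        using that assms(1) by (auto simp: mult_le_0_iff)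
      then show ?thesis by (simp add: \<psi>_def)
    qed
  qed simp
  from 0(2)[OF this] have "integral {\<alpha>..\<beta>} (\<lambda>u. w u * \<psi> u) = 0" .
  also have "integral {\<alpha>..\<beta>} (\<lambda>u. w u * \<psi> u) = integral {\<alpha>..\<beta>} (\<lambda>u. (u - \<alpha>) * (\<beta> - u) * (w u)\<^sup>2)"
    by (intro integral_cong) (auto simp: \<psi>_def power2_eq_square max_absorb2 max_def min_def)
  finally have "\<forall>u\<in>{\<alpha>..\<beta>}. (u - \<alpha>) * (\<beta> - u) * (w u)\<^sup>2 = 0"
    using assms(1) by (subst (asm) integral_eq_0_iff) (auto intro!: continuous_intros 0)
  then have "w u = 0" if "\<alpha> < u" "u < \<beta>" for u using that by fastforce
  then show ?case by (intro exI[of _ 0]) auto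
next
  case (Suc k)
  let ?I = "\<lambda>w \<psi>. integral {\<alpha>..\<beta>} (\<lambda>u. w u * \<psi> u)"
  \<comment> \<open>Otherwise the induction hypothesis, applied to the function \<open>u ^ k\<close>
    in place of \<open>w\<close>, would make this monomial a polynomial of degree less than
    \<open>k\<close>.\<close>
  have "\<exists>\<phi>. test_fun k \<alpha> \<beta> \<phi> \<and> ?I (\<lambda>u. u ^ k) \<phi> \<noteq> 0"
  proof (rule ccontr)
    assume "\<not> ?thesis"
    with Suc.IH[of "\<lambda>u. u ^ k"] obtain p where p: "\<forall>i\<ge>k. coeff p i = 0" "\<forall>u. \<alpha> < u \<and> u < \<beta> \<longrightarrow> u ^ k = poly p u"
      by (force intro: continuous_intros)
    have "monom 1 k = p"
      by (rule poly_eq_on_interval[OF assms(1)]) (use p(2) in \<open>simp add: poly_monom\<close>)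
    then have "coeff p k = 1" by (metis coeff_monom)
    with p(1) show False by simp
  qed
  then obtain \<phi> where \<phi>: "test_fun k \<alpha> \<beta> \<phi>" and I0: "?I (\<lambda>u. u ^ k) \<phi> \<noteq> 0" by blast
  define c where "c = ?I w \<phi> / ?I (\<lambda>u. u ^ k) \<phi>"
  have int: "(\<lambda>u. v u * \<psi> u) integrable_on {\<alpha>..\<beta>}" if "test_fun k \<alpha> \<beta> \<psi>" "continuous_on {\<alpha>..\<beta>} v" for v \<psi>
    by (intro integrable_continuous_interval continuous_intros that test_fun_cont[OF that(1)])
  have "?I (\<lambda>u. w u - c * u ^ k) \<psi> = 0" if \<psi>: "test_fun k \<alpha> \<beta> \<psi>" for \<psi>
  proof -
    \<comment> \<open>Chosen so that \<open>\<psi> - d * \<phi>\<close> has vanishing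
      \<open>k\<close>-th moment.\<close>
    define d where "d = ?I (\<lambda>u. u ^ k) \<psi> / ?I (\<lambda>u. u ^ k) \<phi>"
    have lin: "?I v (\<lambda>u. \<psi> u - d * \<phi> u) = ?I v \<psi> - d * ?I v \<phi>" if "continuous_on {\<alpha>..\<beta>} v" for v
    proof -
      have "?I v (\<lambda>u. \<psi> u - d * \<phi> u) = integral {\<alpha>..\<beta>} (\<lambda>u. v u * \<psi> u - d * (v u * \<phi> u))"
        by (simp add: algebra_simps)
      also have "\<dots> = ?I v \<psi> - d * ?I v \<phi>"
        using int[OF \<psi> that] int[OF \<phi> that]
        by (subst Henstock_Kurzweil_Integration.integral_diff) (auto intro: integrable_on_mult_right)
      finally show ?thesis .
    qed
    have "test_fun (Suc k) \<alpha> \<beta> (\<lambda>u. \<psi> u - d * \<phi> u)"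
      unfolding test_fun_def
    proof (intro conjI allI impI)
      show "continuous_on UNIV (\<lambda>u. \<psi> u - d * \<phi> u)"
        by (intro continuous_intros test_fun_cont[OF \<psi>] test_fun_cont[OF \<phi>])
      show "\<psi> u - d * \<phi> u = 0" if "u \<notin> {\<alpha><..<\<beta>}" for u
        using \<psi> \<phi> that by (simp add: test_fun_def)
      fix j assume "j < Suc k"
      then consider "j < k" | "j = k" by linarith
      then show "?I (\<lambda>u. u ^ j) (\<lambda>u. \<psi> u - d * \<phi> u) = 0"
      proof cases
        case 1
        then show ?thesis using \<psi> \<phi> by (subst lin) (auto simp: test_fun_def intro: continuous_intros)
      next
        case 2
        then show ?thesis using I0 by (subst lin) (auto simp: d_def intro: continuous_intros)
      qed
    qed
    from Suc.prems(2)[OF this] lin[OF Suc.prems(1)] have "?I w \<psi> = d * ?I w \<phi>" by simp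
    moreover have "?I (\<lambda>u. w u - c * u ^ k) \<psi> = integral {\<alpha>..\<beta>} (\<lambda>u. w u * \<psi> u - c * (u ^ k * \<psi> u))"
      by (simp add: algebra_simps)
    moreover have "\<dots> = ?I w \<psi> - c * ?I (\<lambda>u. u ^ k) \<psi>"
      by (subst Henstock_Kurzweil_Integration.integral_diff)
         (auto intro!: int \<psi> Suc.prems(1) continuous_intros integrable_on_mult_right)
    ultimately show ?thesis using I0 by (simp add: c_def d_def field_simps)
  qed
  from Suc.IH[OF _ this] obtain p where p: "\<forall>i\<ge>k. coeff p i = 0" "\<forall>u. \<alpha> < u \<and> u < \<beta> \<longrightarrow> w u - c * u ^ k = poly p u"
    using Suc.prems(1) by (force intro: continuous_intros)
  show ?case
  proof (intro exI[of _ "p + monom c k"] conjI allI impI)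
    show "coeff (p + monom c k) i = 0" if "Suc k \<le> i" for i using p(1) that by simp
    show "w u = poly (p + monom c k) u" if "\<alpha> < u \<and> u < \<beta>" for u
      using p(2) that by (simp add: poly_monom algebra_simps)
  qed
qed

lemma orthogonal_test_fun_imp_poly_open:
  assumes LH: "L < H" and w: "continuous_on {L<..<H} w"
    and orth: "\<And>\<alpha> \<beta> \<psi>. L < \<alpha> \<Longrightarrow> \<alpha> < \<beta> \<Longrightarrow> \<beta> < H \<Longrightarrow> test_fun k \<alpha> \<beta> \<psi> \<Longrightarrow> integral {\<alpha>..\<beta>} (\<lambda>u. w u * \<psi> u) = 0"
  shows "\<exists>p. (\<forall>i\<ge>k. coeff p i = 0) \<and> (\<forall>u. L < u \<and> u < H \<longrightarrow> w u = poly p u)"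
proof -
  have ex: "\<exists>p. (\<forall>i\<ge>k. coeff p i = 0) \<and> (\<forall>u. \<alpha> < u \<and> u < \<beta> \<longrightarrow> w u = poly p u)"
    if "L < \<alpha>" "\<alpha> < \<beta>" "\<beta> < H" for \<alpha> \<beta>
    using that by (intro orthogonal_test_fun_imp_poly orth continuous_on_subset[OF w]) auto
  \<comment> \<open>The middle third is a reference interval: every \<open>u\<close> lies with it in
    a common compactly contained subinterval, and the polynomial found there agrees with
    \<open>p\<close> on the middle third, hence everywhere.\<close>
  define a b where "a = (2 * L + H) / 3" and "b = (L + 2 * H) / 3"
  have ab: "L < a" "a < b" "b < H" using LH by (auto simp: a_def b_def)
  from ex[OF this] obtain p where p: "\<forall>i\<ge>k. coeff p i = 0" "\<forall>u. a < u \<and> u < b \<longrightarrow> w u = poly p u" by blast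
  have "w u = poly p u" if u: "L < u" "u < H" for u
  proof -
    have "L < min ((L + u) / 2) a" "min ((L + u) / 2) a < max ((u + H) / 2) b" "max ((u + H) / 2) b < H"
      using ab u by auto
    from ex[OF this] obtain q where q: "\<forall>v. min ((L + u) / 2) a < v \<and> v < max ((u + H) / 2) b \<longrightarrow> w v = poly q v" by blast
    have "p = q"
    proof (rule poly_eq_on_interval[OF ab(2)])
      fix v assume "a < v" "v < b"
      then have "min ((L + u) / 2) a < v \<and> v < max ((u + H) / 2) b" by auto
      with q \<open>a < v\<close> \<open>v < b\<close> p(2) show "poly p v = poly q v" by metis
    qed
    with q[rule_format, of u] u show ?thesis by (auto simp: min_less_iff_disj less_max_iff_disj)
  qed
  with p show ?thesis by blast
qed

section \<open>Differentiation under the integral sign\<close>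

lemma integrable_mult_bounded:
  fixes h f :: "'a::euclidean_space \<Rightarrow> real"
  assumes h: "integrable lborel h" and f: "f \<in> borel_measurable borel"
    and B: "\<And>y. h y \<noteq> 0 \<Longrightarrow> \<bar>f y\<bar> \<le> B"
  shows "integrable lborel (\<lambda>y. f y * h y)"
proof (rule Bochner_Integration.integrable_bound)
  show "integrable lborel (\<lambda>y. B * h y)" using h by simp
  show "(\<lambda>y. f y * h y) \<in> borel_measurable lborel" using f borel_measurable_integrable[OF h] by simp
  show "AE y in lborel. norm (f y * h y) \<le> norm (B * h y)"
  proof (intro always_eventually allI)
    fix y show "norm (f y * h y) \<le> norm (B * h y)"
      using B[of y] by (cases "h y = 0") (auto simp: abs_mult intro!: mult_right_mono)
  qed
qed

text \<open>Dominated convergence for difference quotients along a positive null sequence: their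
  integrals against \<open>h\<close> are 0, and the Lipschitz bound dominates them by a multiple of
  \<open>h\<close>. Constancy is therefore assumed for \<open>s \<ge> 0\<close> only.\<close>

lemma integral_derivative_eq_0:
  fixes h :: "'a::euclidean_space \<Rightarrow> real" and \<phi> :: "real \<Rightarrow> 'a \<Rightarrow> real"
  assumes h: "integrable lborel h" and m: "\<And>s. \<phi> s \<in> borel_measurable borel" "\<phi>' \<in> borel_measurable borel"
    and B0: "\<And>y. h y \<noteq> 0 \<Longrightarrow> \<bar>\<phi> 0 y\<bar> \<le> B"
    and lip: "\<And>s y. h y \<noteq> 0 \<Longrightarrow> 0 < s \<Longrightarrow> s < 1 \<Longrightarrow> \<bar>\<phi> s y - \<phi> 0 y\<bar> \<le> B * s"
    and der: "\<And>y. h y \<noteq> 0 \<Longrightarrow> ((\<lambda>s. \<phi> s y) has_real_derivative \<phi>' y) (at 0)"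
    and \<delta>: "0 < \<delta>" and const: "\<And>s. 0 \<le> s \<Longrightarrow> s < \<delta> \<Longrightarrow> (LINT y|lborel. \<phi> s y * h y) = I"
  shows "(LINT y|lborel. \<phi>' y * h y) = 0"
proof -
  \<comment> \<open>The offset 2 keeps \<open>s n\<close> strictly below both
    \<open>\<delta>\<close> and 1 already for \<open>n = 0\<close>.\<close>
  define s where "s n = min \<delta> 1 / real (n + 2)" for n
  have s: "0 < s n" "s n < \<delta>" "s n < 1" for n
  proof -
    show "0 < s n" using \<delta> by (simp add: s_def)
    have "s n < min \<delta> 1" using \<delta> by (simp add: s_def field_simps) (smt (verit) mult_nonneg_nonneg of_nat_0_le_iff)
    then show "s n < \<delta>" "s n < 1" by auto
  qed
  have slim: "s \<longlonglongrightarrow> 0"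
    unfolding s_def by (rule LIMSEQ_ignore_initial_segment[OF lim_const_over_n])
  define q where "q n y = (\<phi> (s n) y - \<phi> 0 y) / s n * h y" for n y
  have int: "integrable lborel (\<lambda>y. \<phi> t y * h y)" if "0 \<le> t" "t < 1" for t
  proof (rule integrable_mult_bounded[OF h m(1)])
    fix y assume y: "h y \<noteq> 0"
    have "\<bar>\<phi> t y - \<phi> 0 y\<bar> \<le> B * t" using lip[OF y, of t] that by (cases "t = 0") auto
    then show "\<bar>\<phi> t y\<bar> \<le> B + B * t" using B0[OF y] by linarith
  qed
  have q0: "(LINT y|lborel. q n y) = 0" for n
  proof -
    have "(LINT y|lborel. q n y) = (LINT y|lborel. (\<phi> (s n) y * h y - \<phi> 0 y * h y) / s n)"
      by (simp add: q_def algebra_simps diff_divide_distrib)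
    also have "\<dots> = ((LINT y|lborel. \<phi> (s n) y * h y) - (LINT y|lborel. \<phi> 0 y * h y)) / s n"
      using s[of n] int[of "s n"] int[of 0] by simp
    also have "\<dots> = 0" using const[of "s n"] const[of 0] s[of n] \<delta> by simp
    finally show ?thesis .
  qed
  have "(\<lambda>n. LINT y|lborel. q n y) \<longlonglongrightarrow> (LINT y|lborel. \<phi>' y * h y)"
  proof (rule integral_dominated_convergence[where w="\<lambda>y. \<bar>B * h y\<bar>"])
    show "(\<lambda>y. \<phi>' y * h y) \<in> borel_measurable lborel" "\<And>n. q n \<in> borel_measurable lborel"
      unfolding q_def using m borel_measurable_integrable[OF h] by simp_all
    show "integrable lborel (\<lambda>y. \<bar>B * h y\<bar>)" using h by simp
    show "AE y in lborel. (\<lambda>n. q n y) \<longlonglongrightarrow> \<phi>' y * h y"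
    proof (intro always_eventually allI)
      fix y show "(\<lambda>n. q n y) \<longlonglongrightarrow> \<phi>' y * h y"
      proof (cases "h y = 0")
        case False
        have "((\<lambda>t. (\<phi> t y - \<phi> 0 y) / t) \<longlongrightarrow> \<phi>' y) (at 0)"
          using der[OF False] by (simp add: has_field_derivative_iff)
        moreover have "filterlim s (at 0) sequentially"
          unfolding filterlim_at using slim s(1) by (auto intro!: always_eventually simp: less_imp_neq[symmetric] dest: less_imp_neq)
        ultimately have "(\<lambda>n. (\<phi> (s n) y - \<phi> 0 y) / s n) \<longlonglongrightarrow> \<phi>' y"
          by (rule filterlim_compose)
        then show ?thesis unfolding q_def by (intro tendsto_intros)
      qed (simp add: q_def)
    qed
    show "AE y in lborel. norm (q n y) \<le> \<bar>B * h y\<bar>" for n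
    proof (intro always_eventually allI)
      fix y show "norm (q n y) \<le> \<bar>B * h y\<bar>"
      proof (cases "h y = 0")
        case False
        have "\<bar>(\<phi> (s n) y - \<phi> 0 y) / s n\<bar> \<le> B" using lip[OF False s(1,3)[of n]] s(1)[of n] by (simp add: field_simps)
        also have "B \<le> \<bar>B\<bar>" by simp
        finally show ?thesis
          unfolding q_def real_norm_def abs_mult by (intro mult_right_mono) auto
      qed (simp add: q_def)
    qed
  qed
  with q0 show ?thesis by (simp add: LIMSEQ_const_iff)
qed

section \<open>From vanishing sphere integrals to radial coefficients\<close>

text \<open>Homogeneous polynomials are generated by linear factors because one differentiation in
  the centre produces one such factor; orthogonality then propagates by rule induction.\<close>

inductive hom_poly :: "nat \<Rightarrow> ('a::euclidean_space \<Rightarrow> real) \<Rightarrow> bool" where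
  const: "hom_poly 0 (\<lambda>x. c)"
| mult: "hom_poly k P \<Longrightarrow> hom_poly (Suc k) (\<lambda>x. (x \<bullet> v) * P x)"
| add: "hom_poly k P \<Longrightarrow> hom_poly k Q \<Longrightarrow> hom_poly k (\<lambda>x. P x + Q x)"

lemma hom_poly_continuous: "hom_poly k P \<Longrightarrow> continuous_on A P"
  by (induction rule: hom_poly.induct) (auto intro!: continuous_intros)

lemma hom_poly_scaleR: "hom_poly k P \<Longrightarrow> P (s *\<^sub>R x) = s ^ k * P x"
  by (induction rule: hom_poly.induct) (auto simp: algebra_simps)

lemma test_fun_bounded:
  assumes "test_fun k \<alpha> \<beta> \<psi>"
  obtains B where "0 < B" "\<And>u. \<bar>\<psi> u\<bar> \<le> B"
proof -
  have "bounded (\<psi> ` {\<alpha>..\<beta>})"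
    by (intro compact_imp_bounded compact_continuous_image test_fun_cont[OF assms]) simp
  then obtain B where "\<And>u. u \<in> {\<alpha>..\<beta>} \<Longrightarrow> \<bar>\<psi> u\<bar> \<le> B"
    by (fastforce simp: bounded_iff)
  then have "\<bar>\<psi> u\<bar> \<le> max B 1" for u
    using test_fun_outside[OF assms, of u] by (cases "u \<in> {\<alpha>..\<beta>}") fastforce+
  with that[of "max B 1"] show ?thesis by simp
qed

lemma test_fun_shift_measurable:
  assumes "test_fun k \<alpha> \<beta> \<psi>"
  shows "(\<lambda>y::'a::euclidean_space. \<psi> ((norm (y - c))\<^sup>2)) \<in> borel_measurable borel"
  by (intro borel_measurable_continuous_onI continuous_on_compose2[OF test_fun_cont[OF assms, of UNIV]] continuous_intros) auto

text \<open>Differentiating in the centre \<open>c\<close> trades one moment condition on the test function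
  for one linear factor \<open>y \<bullet> v\<close>.\<close>

lemma orthogonal_radial_mult_inner:
  fixes h :: "'a::euclidean_space \<Rightarrow> real"
  assumes h: "integrable lborel h" and M: "\<And>y. h y \<noteq> 0 \<Longrightarrow> norm y \<le> M"
    and ab: "\<alpha> < \<beta>"
    and orth: "\<And>c \<psi>. norm c < \<delta> \<Longrightarrow> test_fun k \<alpha> \<beta> \<psi> \<Longrightarrow> (LINT y|lborel. \<psi> ((norm (y - c))\<^sup>2) * h y) = 0"
    and c: "norm c < \<delta>" and \<psi>: "test_fun (Suc k) \<alpha> \<beta> \<psi>"
  shows "(LINT y|lborel. \<psi> ((norm (y - c))\<^sup>2) * ((y \<bullet> v) * h y)) = 0"
proof -
  obtain \<Psi> where \<Psi>: "test_fun k \<alpha> \<beta> \<Psi>" and der: "\<And>u. (\<Psi> has_real_derivative \<psi> u) (at u)"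
    using test_fun_antiderivative[OF \<psi> ab] by blast
  obtain B where B: "0 < B" "\<And>u. \<bar>\<psi> u\<bar> \<le> B" using test_fun_bounded[OF \<psi>] by blast
  obtain B' where B': "0 < B'" "\<And>u. \<bar>\<Psi> u\<bar> \<le> B'" using test_fun_bounded[OF \<Psi>] by blast
  \<comment> \<open>Bounds the difference quotient of the squared distance in \<open>s\<close> where
    \<open>h\<close> is nonzero: Cauchy-Schwarz for the linear term, \<open>s < 1\<close> for the
    quadratic one.\<close>
  define C where "C = 2 * (\<bar>M\<bar> + norm c) * norm v + (norm v)\<^sup>2"
  have C: "0 \<le> C" by (simp add: C_def)
  define \<phi> where "\<phi> s y = \<Psi> ((norm (y - (c + s *\<^sub>R v)))\<^sup>2)" for s y
  define \<phi>' where "\<phi>' y = -2 * (\<psi> ((norm (y - c))\<^sup>2) * ((y - c) \<bullet> v))" for y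
  have lipPsi: "\<bar>\<Psi> x - \<Psi> z\<bar> \<le> B * \<bar>x - z\<bar>" for x z
  proof -
    have "norm (\<Psi> x - \<Psi> z) \<le> B * norm (x - z)"
      by (rule field_differentiable_bound[where S=UNIV]) (use der B in \<open>auto simp: has_field_derivative_at_within\<close>)
    then show ?thesis by simp
  qed
  have expand: "(norm (y - (c + s *\<^sub>R v)))\<^sup>2 = (norm (y - c))\<^sup>2 - 2 * s * ((y - c) \<bullet> v) + s\<^sup>2 * (norm v)\<^sup>2" for y s
    unfolding power2_norm_eq_inner by (simp add: inner_diff inner_add inner_commute power2_eq_square algebra_simps)
  have "(LINT y|lborel. \<phi>' y * h y) = 0"
  proof (rule integral_derivative_eq_0[OF h])
    show "\<phi> s \<in> borel_measurable borel" for s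
      unfolding \<phi>_def by (rule test_fun_shift_measurable[OF \<Psi>])
    show "\<phi>' \<in> borel_measurable borel"
      unfolding \<phi>'_def using test_fun_shift_measurable[OF \<psi>, of c] by measurable
    show "\<bar>\<phi> 0 y\<bar> \<le> B' + B * C" for y
      using B'(2)[of "(norm (y - c))\<^sup>2"] B C by (simp add: \<phi>_def) (smt (verit) mult_nonneg_nonneg)
    show "\<bar>\<phi> s y - \<phi> 0 y\<bar> \<le> (B' + B * C) * s" if "h y \<noteq> 0" "0 < s" "s < 1" for s y
    proof -
      have "\<bar>\<phi> s y - \<phi> 0 y\<bar> \<le> B * \<bar>(norm (y - (c + s *\<^sub>R v)))\<^sup>2 - (norm (y - c))\<^sup>2\<bar>"
        using lipPsi unfolding \<phi>_def by simp
      also have "\<bar>(norm (y - (c + s *\<^sub>R v)))\<^sup>2 - (norm (y - c))\<^sup>2\<bar> = \<bar>s * (s * (norm v)\<^sup>2 - 2 * ((y - c) \<bullet> v))\<bar>"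
        unfolding expand by (simp add: algebra_simps power2_eq_square)
      also have "\<dots> = s * \<bar>s * (norm v)\<^sup>2 - 2 * ((y - c) \<bullet> v)\<bar>" using that by (simp add: abs_mult)
      also have "\<dots> \<le> s * C"
      proof (rule mult_left_mono)
        have "\<bar>(y - c) \<bullet> v\<bar> \<le> norm (y - c) * norm v" by (rule Cauchy_Schwarz_ineq2)
        also have "norm (y - c) \<le> \<bar>M\<bar> + norm c" using M[OF that(1)] norm_triangle_ineq4[of y c] by linarith
        finally have "\<bar>(y - c) \<bullet> v\<bar> \<le> (\<bar>M\<bar> + norm c) * norm v" by (simp add: mult_right_mono)
        moreover have "0 \<le> s * (norm v)\<^sup>2" "s * (norm v)\<^sup>2 \<le> (norm v)\<^sup>2" using that by (auto simp: mult_left_le_one_le)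
        ultimately show "\<bar>s * (norm v)\<^sup>2 - 2 * ((y - c) \<bullet> v)\<bar> \<le> C" unfolding C_def by linarith
      qed (use that in simp)
      finally have "\<bar>\<phi> s y - \<phi> 0 y\<bar> \<le> B * (s * C)" using B by (simp add: mult_left_mono)
      also have "\<dots> \<le> (B' + B * C) * s" using that B' by (simp add: algebra_simps)
      finally show ?thesis .
    qed
    show "((\<lambda>s. \<phi> s y) has_real_derivative \<phi>' y) (at 0)" for y
    proof -
      have "((\<lambda>s. (norm (y - c))\<^sup>2 - 2 * s * ((y - c) \<bullet> v) + s\<^sup>2 * (norm v)\<^sup>2) has_real_derivative - 2 * ((y - c) \<bullet> v)) (at 0)"
        by (auto intro!: derivative_eq_intros)
      then have "((\<lambda>s. \<Psi> ((norm (y - c))\<^sup>2 - 2 * s * ((y - c) \<bullet> v) + s\<^sup>2 * (norm v)\<^sup>2)) has_real_derivative 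
           \<psi> ((norm (y - c))\<^sup>2 - 2 * 0 * ((y - c) \<bullet> v) + 0\<^sup>2 * (norm v)\<^sup>2) * (- 2 * ((y - c) \<bullet> v))) (at 0)"
        by (rule DERIV_chain2[OF der])
      then show ?thesis unfolding \<phi>_def expand \<phi>'_def by (simp add: mult.left_commute)
    qed
    \<comment> \<open>For smaller \<open>s\<close> the moved centre stays in the ball of radius
      \<open>\<delta>\<close>; the summand 1 covers \<open>v = 0\<close>.\<close>
    show "0 < (\<delta> - norm c) / (norm v + 1)" using c by (simp add: add_nonneg_pos)
    show "(LINT y|lborel. \<phi> s y * h y) = 0" if "0 \<le> s" "s < (\<delta> - norm c) / (norm v + 1)" for s
      unfolding \<phi>_def
    proof (rule orth[OF _ \<Psi>])
      have "s * (norm v + 1) < \<delta> - norm c" using that(2) by (subst (asm) pos_less_divide_eq) (auto simp: add_nonneg_pos)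
      then have "norm (s *\<^sub>R v) < \<delta> - norm c" using that(1) by (simp add: algebra_simps)
      then show "norm (c + s *\<^sub>R v) < \<delta>" using norm_triangle_ineq[of c "s *\<^sub>R v"] by linarith
    qed
  qed
  \<comment> \<open>The derivative carries \<open>(y - c) \<bullet> v\<close> instead of
    \<open>y \<bullet> v\<close>. The surplus multiple of \<open>c \<bullet> v\<close> integrates to
    0, since \<open>\<psi>\<close> is in particular a test function of order
    \<open>k\<close>.\<close>
  moreover have "(LINT y|lborel. \<phi>' y * h y) = (LINT y|lborel. -2 * (\<psi> ((norm (y - c))\<^sup>2) * ((y \<bullet> v) * h y)) + (2 * (c \<bullet> v)) * (\<psi> ((norm (y - c))\<^sup>2) * h y))"
    by (simp add: \<phi>'_def inner_diff_left algebra_simps)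
  moreover have "\<dots> = -2 * (LINT y|lborel. \<psi> ((norm (y - c))\<^sup>2) * ((y \<bullet> v) * h y)) + (2 * (c \<bullet> v)) * (LINT y|lborel. \<psi> ((norm (y - c))\<^sup>2) * h y)"
  proof -
    have mm: "(\<lambda>y. \<psi> ((norm (y - c))\<^sup>2) * (y \<bullet> v)) \<in> borel_measurable borel"
      using test_fun_shift_measurable[OF \<psi>, of c] by measurable
    have "integrable lborel (\<lambda>y. \<psi> ((norm (y - c))\<^sup>2) * h y)"
      by (rule integrable_mult_bounded[OF h test_fun_shift_measurable[OF \<psi>] B(2)])
    moreover have "integrable lborel (\<lambda>y. (\<psi> ((norm (y - c))\<^sup>2) * (y \<bullet> v)) * h y)"
    proof (rule integrable_mult_bounded[OF h mm])
      fix y assume "h y \<noteq> 0"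
      then have "\<bar>y \<bullet> v\<bar> \<le> M * norm v"
        using Cauchy_Schwarz_ineq2[of y v] M[of y] by (meson mult_right_mono norm_ge_zero order_trans)
      then show "\<bar>\<psi> ((norm (y - c))\<^sup>2) * (y \<bullet> v)\<bar> \<le> B * (M * norm v)"
        unfolding abs_mult using B by (intro mult_mono) auto
    qed
    ultimately show ?thesis
      by (simp add: mult.assoc)
  qed
  moreover have "(LINT y|lborel. \<psi> ((norm (y - c))\<^sup>2) * h y) = 0"
    using orth[OF c test_fun_antimono[OF \<psi>]] by simp
  ultimately show ?thesis by simp
qed

text \<open>Each linear factor of \<open>P\<close> costs one moment condition. The centre stays
  arbitrary in the induction, because differentiating at \<open>c\<close> uses the claim at all
  nearby centres, with \<open>P y * h y\<close> in the role of \<open>h\<close>.\<close>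

lemma orthogonal_radial_hom_poly:
  fixes h :: "'a::euclidean_space \<Rightarrow> real"
  assumes "hom_poly k P"
    and h: "integrable lborel h" and M: "\<And>y. h y \<noteq> 0 \<Longrightarrow> norm y \<le> M"
    and ab: "\<alpha> < \<beta>"
    and orth: "\<And>c \<psi>. norm c < \<delta> \<Longrightarrow> test_fun 0 \<alpha> \<beta> \<psi> \<Longrightarrow> (LINT y|lborel. \<psi> ((norm (y - c))\<^sup>2) * h y) = 0"
    and c: "norm c < \<delta>" and \<psi>: "test_fun k \<alpha> \<beta> \<psi>"
  shows "(LINT y|lborel. \<psi> ((norm (y - c))\<^sup>2) * (P y * h y)) = 0"
proof -
  have intP: "integrable lborel (\<lambda>y. P y * h y)" if P: "hom_poly k P" for k P
  proof -
    have "bounded (P ` cball 0 M)"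
      by (intro compact_imp_bounded compact_continuous_image hom_poly_continuous[OF P]) simp
    then obtain B where "\<And>y. norm y \<le> M \<Longrightarrow> \<bar>P y\<bar> \<le> B" by (fastforce simp: bounded_iff)
    then show ?thesis
      using M by (intro integrable_mult_bounded[OF h, where B=B] borel_measurable_continuous_onI hom_poly_continuous[OF P]) auto
  qed
  from assms(1) c \<psi> show ?thesis
  proof (induction arbitrary: c \<psi> rule: hom_poly.induct)
    case (const a)
    have "(LINT y|lborel. \<psi> ((norm (y - c))\<^sup>2) * (a * h y)) = (LINT y|lborel. a * (\<psi> ((norm (y - c))\<^sup>2) * h y))"
      by (simp add: mult_ac)
    also have "\<dots> = a * (LINT y|lborel. \<psi> ((norm (y - c))\<^sup>2) * h y)" by simp
    also have "\<dots> = 0" using orth const by simp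
    finally show ?case .
  next
    case (mult k P v)
    have "(LINT y|lborel. \<psi> ((norm (y - c))\<^sup>2) * ((y \<bullet> v) * (P y * h y))) = 0"
      by (rule orthogonal_radial_mult_inner[OF intP[OF mult.hyps] _ ab mult.IH mult.prems]) (use M in auto)
    then show ?case by (simp add: mult.assoc)
  next
    case (add k P Q)
    obtain B where B: "\<And>u. \<bar>\<psi> u\<bar> \<le> B" using test_fun_bounded[OF add.prems(2)] by metis
    have "integrable lborel (\<lambda>y. \<psi> ((norm (y - c))\<^sup>2) * (R y * h y))" if "hom_poly k R" for R
      by (rule integrable_mult_bounded[OF intP[OF that] test_fun_shift_measurable[OF add.prems(2)] B])
    then have "(LINT y|lborel. \<psi> ((norm (y - c))\<^sup>2) * (P y * h y) + \<psi> ((norm (y - c))\<^sup>2) * (Q y * h y)) = 0"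
      using add by simp
    then show ?case by (simp add: algebra_simps)
  qed
qed

lemma lborel_integral_shift:
  fixes f :: "'a::euclidean_space \<Rightarrow> real"
  assumes "f \<in> borel_measurable borel"
  shows "(LINT y|lborel. f (c + y)) = (LINT y|lborel. f y)"
proof -
  have "(LINT y|distr lborel borel ((+) c). f y) = (LINT y|lborel. f (c + y))"
    using assms by (subst integral_distr) auto
  then show ?thesis by (simp add: lborel_distr_plus)
qed

lemma integral_square_substitution:
  fixes F :: "real \<Rightarrow> real"
  assumes "0 \<le> l" "l \<le> h" "continuous_on {l\<^sup>2..h\<^sup>2} F"
  shows "integral {l..h} (\<lambda>\<rho>. \<rho> * F (\<rho>\<^sup>2)) = integral {l\<^sup>2..h\<^sup>2} F / 2"
proof -
  have "((\<lambda>\<rho>. (2 * \<rho>) *\<^sub>R F (\<rho>\<^sup>2)) has_integral integral {l\<^sup>2..h\<^sup>2} F) {l..h}"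
  proof (rule has_integral_substitution[where g="\<lambda>\<rho>. \<rho>\<^sup>2"])
    show "(\<lambda>\<rho>. \<rho>\<^sup>2) ` {l..h} \<subseteq> {l\<^sup>2..h\<^sup>2}" using assms by (auto intro: power_mono)
    show "((\<lambda>\<rho>. \<rho>\<^sup>2) has_real_derivative 2 * x) (at x within {l..h})" for x
      by (auto intro!: derivative_eq_intros)
  qed (use assms in \<open>auto intro: power_mono\<close>)
  from integral_unique[OF this] show ?thesis
    by (simp add: mult.assoc)
qed

lemma continuous_on_Ioo_if_Icc:
  fixes w :: "real \<Rightarrow> 'a::topological_space"
  assumes "\<And>\<alpha> \<beta>. L < \<alpha> \<Longrightarrow> \<beta> < H \<Longrightarrow> continuous_on {\<alpha>..\<beta>} w"
  shows "continuous_on {L<..<H} w"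
  unfolding continuous_on_eq_continuous_at[OF open_greaterThanLessThan]
proof
  fix u assume "u \<in> {L<..<H}"
  then have "continuous_on {(L + u) / 2..(u + H) / 2} w" "u \<in> interior {(L + u) / 2..(u + H) / 2}"
    by (auto intro!: assms)
  then show "isCont w u" by (rule continuous_on_interior)
qed

section \<open>Spheres that enclose the hole of an annulus\<close>

definition annulus :: "real \<Rightarrow> real \<Rightarrow> 'a::euclidean_space set" where
  "annulus a b = {y. a < norm y \<and> norm y < b}"

text \<open>The integrals of \<open>g\<close> over all spheres in the annulus that enclose its hole vanish.\<close>

definition zero_sphere_means :: "real \<Rightarrow> real \<Rightarrow> ('a::euclidean_space \<Rightarrow> real) \<Rightarrow> bool" where
  "zero_sphere_means a b g \<longleftrightarrow>
     (\<forall>c t. a + norm c < t \<and> t < b - norm c \<longrightarrow> sint (\<lambda>w. g (c + t *\<^sub>R w)) = 0)"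

lemma shell_translate_subset_annulus:
  assumes "a + norm c < l" "h < b - norm c"
  shows "(+) c ` shell l h \<subseteq> annulus a b"
proof safe
  fix y :: 'a assume "y \<in> shell l h"
  with assms show "c + y \<in> annulus a b"
    using norm_triangle_ineq[of c y] norm_diff_ineq[of y c] by (auto simp: annulus_def shell_def add.commute)
qed

lemma integral_radial_shell:
  fixes g :: "'a::euclidean_space \<Rightarrow> real"
  assumes g: "continuous_on (shell l h) g" and l: "0 < l" and \<psi>: "continuous_on {l\<^sup>2..h\<^sup>2} \<psi>"
  shows "(LINT y:shell l h|lborel. \<psi> ((norm y)\<^sup>2) * g y) = integral {l..h} (\<lambda>\<rho>. \<rho> ^ (DIM('a) - 1) * (\<psi> (\<rho>\<^sup>2) * sint (\<lambda>w. g (\<rho> *\<^sub>R w))))"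
proof -
  have "continuous_on (shell l h) (\<lambda>y::'a. \<psi> ((norm y)\<^sup>2) * g y)"
    by (intro continuous_intros continuous_on_compose2[OF \<psi>] g) (use l in \<open>auto simp: shell_def intro!: power_mono\<close>)
  then have "(LINT y:shell l h|lborel. \<psi> ((norm y)\<^sup>2) * g y) = integral {l..h} (\<lambda>\<rho>. \<rho> ^ (DIM('a) - 1) * sint (\<lambda>w::'a. \<psi> ((norm (\<rho> *\<^sub>R w))\<^sup>2) * g (\<rho> *\<^sub>R w)))"
    using polar_shell(2)[OF l] by blast
  also have "\<dots> = integral {l..h} (\<lambda>\<rho>. \<rho> ^ (DIM('a) - 1) * (\<psi> (\<rho>\<^sup>2) * sint (\<lambda>w. g (\<rho> *\<^sub>R w))))"
    by (intro integral_cong arg_cong2[where f="(*)"] refl) (simp add: sint_cmult[symmetric] cong: sint_cong)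
  finally show ?thesis .
qed

text \<open>In the variable \<open>u = \<rho>\<^sup>2\<close> the coefficient, suitably weighted, is
  orthogonal to all test functions of order \<open>k\<close>. The polar density and the homogeneity
  of \<open>P\<close> contribute \<open>\<rho> ^ (n - 1 + k)\<close>; one factor
  \<open>\<rho>\<close> is absorbed by the substitution, which leaves the exponent
  \<open>n + k - 2\<close>.\<close>

lemma zero_sphere_means_imp_coeff_poly:
  fixes g :: "'a::euclidean_space \<Rightarrow> real"
  assumes DIM: "2 \<le> DIM('a)" and a: "0 \<le> a" and ab: "a < b"
    and g: "continuous_on (annulus a b) g" and Z: "zero_sphere_means a b g" and P: "hom_poly k P"
  shows "\<exists>p. (\<forall>i\<ge>k. coeff p i = 0) \<and>
    (\<forall>\<rho>. a < \<rho> \<and> \<rho> < b \<longrightarrow> \<rho> ^ (DIM('a) + k - 2) * sint (\<lambda>w. g (\<rho> *\<^sub>R w) * P w) = poly p (\<rho>\<^sup>2))"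
proof -
  define w where "w u = sqrt u ^ (DIM('a) + k - 2) * sint (\<lambda>x. g (sqrt u *\<^sub>R x) * P x)" for u
  have gP: "continuous_on ({l..h} \<times> sphere 0 1) (\<lambda>(\<rho>, x). g (\<rho> *\<^sub>R x) * P x)" if "a < l" "h < b" for l h
    unfolding case_prod_beta'
    by (intro continuous_intros continuous_on_compose2[OF g] continuous_on_compose2[OF hom_poly_continuous[OF P, of UNIV]])
       (use that a in \<open>auto simp: annulus_def\<close>)
  have contR: "continuous_on {l..h} (\<lambda>\<rho>. sint (\<lambda>x. g (\<rho> *\<^sub>R x) * P x))" if "a < l" "h < b" for l h
    using continuous_on_sint[OF gP[OF that]] .
  have sq: "a < sqrt u \<longleftrightarrow> a\<^sup>2 < u" "sqrt u < b \<longleftrightarrow> u < b\<^sup>2" if "0 \<le> u" for u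
    using real_sqrt_less_iff[of "a\<^sup>2" u] real_sqrt_less_iff[of u "b\<^sup>2"] a ab by simp_all
  have cw: "continuous_on {\<alpha>..\<beta>} w" if "a\<^sup>2 < \<alpha>" "\<beta> < b\<^sup>2" for \<alpha> \<beta>
  proof (cases "\<alpha> \<le> \<beta>")
    case True
    have "0 \<le> \<alpha>" using that(1) by (meson less_imp_le order_trans zero_le_power2)
    with True that have "a < sqrt \<alpha>" "sqrt \<beta> < b" by (auto simp: sq)
    note cR = contR[OF this]
    show ?thesis
      unfolding w_def
      by (intro continuous_on_mult continuous_on_power continuous_on_real_sqrt continuous_on_id continuous_on_compose2[OF cR])
         auto
  qed simp
  have "\<exists>p. (\<forall>i\<ge>k. coeff p i = 0) \<and> (\<forall>u. a\<^sup>2 < u \<and> u < b\<^sup>2 \<longrightarrow> w u = poly p u)"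
  proof (rule orthogonal_test_fun_imp_poly_open)
    show "a\<^sup>2 < b\<^sup>2" using a ab by (intro power_strict_mono) auto
    show "continuous_on {a\<^sup>2<..<b\<^sup>2} w" by (rule continuous_on_Ioo_if_Icc[OF cw])
    fix \<alpha> \<beta> \<psi> assume \<alpha>\<beta>: "a\<^sup>2 < \<alpha>" "\<alpha> < \<beta>" "\<beta> < b\<^sup>2" and \<psi>: "test_fun k \<alpha> \<beta> \<psi>"
    have \<alpha>0: "0 < \<alpha>" using \<alpha>\<beta>(1) by (meson order.strict_trans1 zero_le_power2)
    define l h where "l = sqrt \<alpha>" and "h = sqrt \<beta>"
    have lh: "a < l" "l < h" "h < b" "0 < l" "l\<^sup>2 = \<alpha>" "h\<^sup>2 = \<beta>"
      using \<alpha>0 \<alpha>\<beta> a by (auto simp: l_def h_def sq)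
    \<comment> \<open>Half the distance from the shell to the boundary of the annulus: the shell
      moved by less than \<open>\<delta>\<close> stays in the compact set \<open>K\<close>, which is
      still inside the annulus.\<close>
    define \<delta> where "\<delta> = min ((l - a) / 2) ((b - h) / 2)"
    have \<delta>: "0 < \<delta>" "a < l - \<delta>" "h + \<delta> < b" using lh by (auto simp: \<delta>_def min_def field_simps)
    define K where "K = (shell (l - \<delta>) (h + \<delta>) :: 'a set)"
    have KA: "K \<subseteq> annulus a b" using \<delta> by (auto simp: K_def shell_def annulus_def)
    have K: "compact K" by (simp add: K_def compact_shell)
    \<comment> \<open>Cutting \<open>g\<close> off outside \<open>K\<close> gives an integrable
      function on the whole space that agrees with \<open>g\<close> wherever a moved test function
      is nonzero.\<close>
    define hh where "hh y = indicator K y * g y" for y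
    have hh: "integrable lborel hh"
      using set_integrable_compact[OF K continuous_on_subset[OF g KA]] by (simp add: set_integrable_def hh_def[abs_def])
    have mh: "hh \<in> borel_measurable borel" using borel_measurable_integrable[OF hh] by simp
    have shift: "(LINT y|lborel. \<psi> ((norm (y - c))\<^sup>2) * (Q y * hh y)) = (LINT y:shell l h|lborel. \<psi> ((norm y)\<^sup>2) * (Q (c + y) * g (c + y)))"
      if c: "norm c < \<delta>" and \<psi>: "test_fun j \<alpha> \<beta> \<psi>" and Q: "continuous_on UNIV Q" for c j \<psi> Q
    proof -
      have "Q \<in> borel_measurable borel" using Q by (rule borel_measurable_continuous_onI)
      then have "(\<lambda>y. \<psi> ((norm (y - c))\<^sup>2) * (Q y * hh y)) \<in> borel_measurable borel"
        using test_fun_shift_measurable[OF \<psi>, of c] mh by measurable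
      from lborel_integral_shift[OF this, of c]
      have "(LINT y|lborel. \<psi> ((norm (y - c))\<^sup>2) * (Q y * hh y)) = (LINT y|lborel. \<psi> ((norm y)\<^sup>2) * (Q (c + y) * hh (c + y)))"
        by simp
      also have "\<dots> = (LINT y:shell l h|lborel. \<psi> ((norm y)\<^sup>2) * (Q (c + y) * g (c + y)))"
        unfolding set_lebesgue_integral_def
      proof (rule Bochner_Integration.integral_cong[OF refl])
        fix y :: 'a
        show "\<psi> ((norm y)\<^sup>2) * (Q (c + y) * hh (c + y)) = indicator (shell l h) y *\<^sub>R (\<psi> ((norm y)\<^sup>2) * (Q (c + y) * g (c + y)))"
        proof (cases "y \<in> shell l h")
          case True
          then have "c + y \<in> K"
            using c norm_triangle_ineq[of c y] norm_diff_ineq[of y c] by (auto simp: K_def shell_def add.commute)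
          with True show ?thesis by (simp add: hh_def)
        next
          case False
          have "\<psi> ((norm y)\<^sup>2) = 0"
          proof (rule test_fun_outside[OF \<psi>])
            have "norm y \<le> l \<or> h \<le> norm y" using False by (auto simp: shell_def)
            then show "(norm y)\<^sup>2 \<le> \<alpha> \<or> \<beta> \<le> (norm y)\<^sup>2" using lh by (metis less_imp_le norm_ge_zero order_trans power_mono)
          qed
          with False show ?thesis by simp
        qed
      qed
      finally show ?thesis .
    qed
    have regroup: "A * (B * C) = x * (W * B)" if "C = D * E" "A * D = x * F" "W = F * E" for A B C D E F W x :: real
    proof -
      have "A * (B * C) = (A * D) * (E * B)" unfolding that(1) by (simp add: mult_ac)
      then show ?thesis unfolding that(2,3) by (simp add: mult_ac)
    qed
    have "(LINT y|lborel. \<psi> ((norm (y - 0))\<^sup>2) * (P y * hh y)) = 0"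
    proof (rule orthogonal_radial_hom_poly[OF P hh _ \<alpha>\<beta>(2) _ _ \<psi>])
      show "norm y \<le> h + \<delta>" if "hh y \<noteq> 0" for y
        using that by (auto simp: hh_def K_def shell_def indicator_def split: if_splits)
      show "norm (0::'a) < \<delta>" using \<delta> by simp
      fix c :: 'a and \<psi> assume c: "norm c < \<delta>" and \<psi>: "test_fun 0 \<alpha> \<beta> \<psi>"
      have sub: "(+) c ` shell l h \<subseteq> annulus a b"
        by (rule shell_translate_subset_annulus) (use c \<delta> in auto)
      have "(LINT y|lborel. \<psi> ((norm (y - c))\<^sup>2) * hh y) = (LINT y:shell l h|lborel. \<psi> ((norm y)\<^sup>2) * g (c + y))"
        using shift[OF c \<psi>, of "\<lambda>_. 1"] by simp
      also have "\<dots> = integral {l..h} (\<lambda>\<rho>. \<rho> ^ (DIM('a) - 1) * (\<psi> (\<rho>\<^sup>2) * sint (\<lambda>w. g (c + \<rho> *\<^sub>R w))))"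
        by (rule integral_radial_shell) 
           (use lh sub in \<open>auto intro!: test_fun_cont[OF \<psi>] continuous_on_compose2[OF g] continuous_intros\<close>)
      also have "\<dots> = integral {l..h} (\<lambda>\<rho>. 0)"
      proof (rule integral_cong)
        fix \<rho> assume "\<rho> \<in> {l..h}"
        then have "a + norm c < \<rho>" "\<rho> < b - norm c" using c \<delta> by auto
        then have "sint (\<lambda>w. g (c + \<rho> *\<^sub>R w)) = 0" using Z by (simp add: zero_sphere_means_def)
        then show "\<rho> ^ (DIM('a) - 1) * (\<psi> (\<rho>\<^sup>2) * sint (\<lambda>w. g (c + \<rho> *\<^sub>R w))) = 0" by simp
      qed
      finally show "(LINT y|lborel. \<psi> ((norm (y - c))\<^sup>2) * hh y) = 0" by simp
    qed
    also have "(LINT y|lborel. \<psi> ((norm (y - 0))\<^sup>2) * (P y * hh y)) = (LINT y:shell l h|lborel. \<psi> ((norm y)\<^sup>2) * (P y * g y))"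
      using shift[OF _ \<psi> hom_poly_continuous[OF P], of 0] \<delta> by simp
    also have "\<dots> = integral {l..h} (\<lambda>\<rho>. \<rho> ^ (DIM('a) - 1) * (\<psi> (\<rho>\<^sup>2) * sint (\<lambda>w. P (\<rho> *\<^sub>R w) * g (\<rho> *\<^sub>R w))))"
      by (rule integral_radial_shell)
         (use lh in \<open>auto intro!: test_fun_cont[OF \<psi>] continuous_on_subset[OF g] hom_poly_continuous[OF P] continuous_intros simp: shell_def annulus_def\<close>)
    also have "\<dots> = integral {l..h} (\<lambda>\<rho>. \<rho> * (w (\<rho>\<^sup>2) * \<psi> (\<rho>\<^sup>2)))"
    proof (rule integral_cong)
      fix \<rho> assume "\<rho> \<in> {l..h}"
      then have \<rho>: "0 < \<rho>" using lh by simp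
      have e: "DIM('a) + k - 1 = Suc (DIM('a) + k - 2)" "DIM('a) + k - 1 = (DIM('a) - 1) + k" using DIM by auto
      have "sint (\<lambda>w. P (\<rho> *\<^sub>R w) * g (\<rho> *\<^sub>R w)) = \<rho> ^ k * sint (\<lambda>x. g (\<rho> *\<^sub>R x) * P x)"
        unfolding sint_cmult[symmetric] by (rule sint_cong) (simp add: hom_poly_scaleR[OF P])
      moreover have "\<rho> ^ (DIM('a) - 1) * \<rho> ^ k = \<rho> * \<rho> ^ (DIM('a) + k - 2)"
        by (metis e power_Suc power_add)
      moreover have "w (\<rho>\<^sup>2) = \<rho> ^ (DIM('a) + k - 2) * sint (\<lambda>x. g (\<rho> *\<^sub>R x) * P x)"
        using \<rho> by (simp add: w_def)
      ultimately show "\<rho> ^ (DIM('a) - 1) * (\<psi> (\<rho>\<^sup>2) * sint (\<lambda>w. P (\<rho> *\<^sub>R w) * g (\<rho> *\<^sub>R w))) = \<rho> * (w (\<rho>\<^sup>2) * \<psi> (\<rho>\<^sup>2))"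
        by (rule regroup)
    qed
    also have "\<dots> = integral {l\<^sup>2..h\<^sup>2} (\<lambda>u. w u * \<psi> u) / 2"
      by (rule integral_square_substitution) (use lh \<alpha>\<beta> in \<open>auto intro!: continuous_intros cw test_fun_cont[OF \<psi>]\<close>)
    finally show "integral {\<alpha>..\<beta>} (\<lambda>u. w u * \<psi> u) = 0" using lh by simp
  qed
  then obtain p where p: "\<forall>i\<ge>k. coeff p i = 0" "\<forall>u. a\<^sup>2 < u \<and> u < b\<^sup>2 \<longrightarrow> w u = poly p u" by blast
  have "\<rho> ^ (DIM('a) + k - 2) * sint (\<lambda>w. g (\<rho> *\<^sub>R w) * P w) = poly p (\<rho>\<^sup>2)" if "a < \<rho>" "\<rho> < b" for \<rho>
    using p(2)[rule_format, of "\<rho>\<^sup>2"] that a power_strict_mono[of a \<rho> 2] power_strict_mono[of \<rho> b 2]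
    by (auto simp: w_def)
  with p(1) show ?thesis by blast
qed

section \<open>Zonal harmonics\<close>

text \<open>The integral of \<open>G\<close> is invariant under translation along \<open>v\<close>,
  so its derivative in the translation parameter vanishes. This serves as the divergence theorem for
  compactly supported fields.\<close>

lemma integral_directional_derivative_eq_0:
  fixes G G' :: "'a::euclidean_space \<Rightarrow> real"
  assumes G: "continuous_on UNIV G" and G': "continuous_on UNIV G'"
    and der: "\<And>y s. ((\<lambda>s. G (y + s *\<^sub>R v)) has_real_derivative G' (y + s *\<^sub>R v)) (at s)"
    and supp: "\<And>y. M < norm y \<Longrightarrow> G y = 0" "\<And>y. M < norm y \<Longrightarrow> G' y = 0" and M: "0 \<le> M" and v: "norm v \<le> 1"
  shows "(LINT y|lborel. G' y) = 0"
proof -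
  \<comment> \<open>Radius \<open>M + 1\<close> leaves room for the supports of all translates by
    \<open>s *\<^sub>R v\<close> with \<open>0 \<le> s < 1\<close>.\<close>
  define h where "h = (indicator (cball 0 (M + 1)) :: 'a \<Rightarrow> real)"
  have out: "norm (y + s *\<^sub>R v) > M" if "h y = 0" "0 \<le> s" "s < 1" for y s
  proof -
    have "norm y > M + 1" using that by (simp add: h_def indicator_def split: if_splits)
    moreover have "norm (s *\<^sub>R v) \<le> 1" using that v by (simp add: mult_le_one)
    ultimately show ?thesis using norm_diff_ineq[of y "s *\<^sub>R v"] by linarith
  qed
  have "bounded (G ` cball 0 M)" "bounded (G' ` cball 0 M)"
    by (intro compact_imp_bounded compact_continuous_image continuous_on_subset[OF G] continuous_on_subset[OF G']; simp)+
  then obtain B1 B2 where "\<And>y. norm y \<le> M \<Longrightarrow> \<bar>G y\<bar> \<le> B1" "\<And>y. norm y \<le> M \<Longrightarrow> \<bar>G' y\<bar> \<le> B2"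
    by (fastforce simp: bounded_iff)
  then have B: "\<bar>G y\<bar> \<le> \<bar>B1\<bar> + \<bar>B2\<bar>" "\<bar>G' y\<bar> \<le> \<bar>B1\<bar> + \<bar>B2\<bar>" for y
    using supp[of y] by (cases "norm y \<le> M"; force)+
  have "(LINT y|lborel. G' y * h y) = 0"
  proof (rule integral_derivative_eq_0[where \<phi>="\<lambda>s y. G (y + s *\<^sub>R v)" and \<delta>=1])
    show "integrable lborel h"
      unfolding h_def using emeasure_lborel_cball_finite[of "0::'a" "M + 1"] by (simp add: integrable_indicator_iff)
    show "(\<lambda>y. G (y + s *\<^sub>R v)) \<in> borel_measurable borel" for s
      by (intro borel_measurable_continuous_onI continuous_on_compose2[OF G] continuous_intros) auto
    show "G' \<in> borel_measurable borel" by (rule borel_measurable_continuous_onI[OF G'])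
    show "\<bar>G (y + 0 *\<^sub>R v)\<bar> \<le> \<bar>B1\<bar> + \<bar>B2\<bar>" for y using B by simp
    show "((\<lambda>s. G (y + s *\<^sub>R v)) has_real_derivative G' y) (at 0)" for y using der[of y 0] by simp
    show "\<bar>G (y + s *\<^sub>R v) - G (y + 0 *\<^sub>R v)\<bar> \<le> (\<bar>B1\<bar> + \<bar>B2\<bar>) * s" if "0 < s" for s y
    proof -
      have "norm (G (y + s *\<^sub>R v) - G (y + 0 *\<^sub>R v)) \<le> (\<bar>B1\<bar> + \<bar>B2\<bar>) * norm (s - 0)"
        by (rule field_differentiable_bound[where S=UNIV]) (use der B in \<open>auto simp: has_field_derivative_at_within\<close>)
      then show ?thesis using that by simp
    qed
    show "(LINT y|lborel. G (y + s *\<^sub>R v) * h y) = (LINT y|lborel. G y)" if "0 \<le> s" "s < 1" for s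
    proof -
      have "(LINT y|lborel. G (y + s *\<^sub>R v) * h y) = (LINT y|lborel. G (s *\<^sub>R v + y))"
        by (rule Bochner_Integration.integral_cong[OF refl])
           (use supp(1)[OF out[OF _ that]] in \<open>auto simp: h_def indicator_def add.commute split: if_splits\<close>)
      also have "\<dots> = (LINT y|lborel. G y)"
        by (rule lborel_integral_shift) (rule borel_measurable_continuous_onI[OF G])
      finally show ?thesis .
    qed
  qed auto
  moreover have "G' y * h y = G' y" for y
    using supp(2)[OF out[of y 0]] by (cases "h y = 0") (auto simp: h_def indicator_def)
  ultimately show ?thesis by simp
qed

text \<open>The derivative in direction \<open>b\<close> of \<open>(b \<bullet> y) ^ (j + 1)\<close>
  times a bump in \<open>y \<bullet> y\<close> integrates to 0. In polar coordinates both terms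
  carry the same radial integral, after one integration by parts; it is nonzero and cancels.\<close>

lemma sint_moment_rec:
  fixes b :: "'a::euclidean_space"
  assumes b: "norm b = 1"
  shows "(real DIM('a) + real j) * sint (\<lambda>w. (b \<bullet> w) ^ (j + 2)) = (real j + 1) * sint (\<lambda>w. (b \<bullet> w) ^ j)"
proof -
  \<comment> \<open>Positive exactly for \<open>1 < v < 4\<close>, that is on the shell between
    radii 1 and 2 when \<open>v\<close> is the squared norm. Its square is continuously
    differentiable across the end points.\<close>
  define q where "q v = max 0 ((v - 1) * (4 - v))" for v :: real
  define \<theta> where "\<theta> v = (q v)\<^sup>2" for v
  define \<theta>' where "\<theta>' v = 2 * q v * (5 - 2 * v)" for v
  have cq: "continuous_on A q" for A unfolding q_def by (intro continuous_intros)
  have c\<theta>: "continuous_on A \<theta>" "continuous_on A \<theta>'" for A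
    unfolding \<theta>_def \<theta>'_def by (intro continuous_intros cq)+
  have q0: "q v = 0" if "v \<le> 1 \<or> 4 \<le> v" for v
  proof -
    have "(v - 1) * (4 - v) \<le> 0" using that by (auto simp: mult_le_0_iff)
    then show ?thesis by (simp add: q_def)
  qed
  have d\<theta>: "(\<theta> has_real_derivative \<theta>' v) (at v)" for v
  proof -
    let ?p = "\<lambda>v::real. (v - 1) * (4 - v)"
    have dp: "(?p has_real_derivative 5 - 2 * v) (at v)" by (auto intro!: derivative_eq_intros)
    consider "?p v > 0" | "?p v < 0" | "?p v = 0" by linarith
    then show ?thesis
    proof cases
      case 1
      have "((\<lambda>v. (?p v)\<^sup>2) has_real_derivative \<theta>' v) (at v)"
        using 1 by (auto intro!: derivative_eq_intros simp: \<theta>'_def q_def)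
      then show ?thesis
        by (rule has_field_derivative_transform_within_open[where S="{v. ?p v > 0}"])
           (use 1 in \<open>auto simp: \<theta>_def q_def max_def intro!: open_Collect_less continuous_intros\<close>)
    next
      case 2
      have "((\<lambda>v. 0) has_real_derivative 0) (at v)" by simp
      then have "(\<theta> has_real_derivative 0) (at v)"
        by (rule has_field_derivative_transform_within_open[where S="{v. ?p v < 0}"])
           (use 2 in \<open>auto simp: \<theta>_def q_def max_def intro!: open_Collect_less continuous_intros\<close>)
      with 2 show ?thesis by (simp add: \<theta>'_def q_def)
    next
      case 3
      \<comment> \<open>At a zero of the quadratic, \<open>\<theta>\<close> is bounded by its
        square, so the quotient is at most the quadratic itself, which tends to 0, times its own
        convergent difference quotient.\<close>
      have "((\<lambda>t. (\<theta> t - \<theta> v) / (t - v)) \<longlongrightarrow> 0) (at v)"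
      proof (rule Lim_null_comparison)
        have z: "\<bar>?p v\<bar> * \<bar>5 - 2 * v\<bar> = 0" using 3 by simp
        have "((\<lambda>t. \<bar>?p t\<bar> * \<bar>(?p t - ?p v) / (t - v)\<bar>) \<longlongrightarrow> \<bar>?p v\<bar> * \<bar>5 - 2 * v\<bar>) (at v)"
          by (intro tendsto_intros dp[unfolded has_field_derivative_iff])
        then show "((\<lambda>t. \<bar>?p t\<bar> * \<bar>(?p t - ?p v) / (t - v)\<bar>) \<longlongrightarrow> 0) (at v)"
          unfolding z .
        have le: "\<bar>\<theta> t\<bar> \<le> \<bar>?p t\<bar> * \<bar>?p t\<bar>" for t
          by (auto simp: \<theta>_def q_def max_def power2_eq_square)
        have "norm ((\<theta> t - \<theta> v) / (t - v)) \<le> \<bar>?p t\<bar> * \<bar>(?p t - ?p v) / (t - v)\<bar>" for t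
        proof -
          have "\<theta> v = 0" unfolding \<theta>_def q_def 3 by simp
          with le[of t] show ?thesis
            unfolding 3 by (simp add: abs_mult divide_right_mono)
        qed
        then show "\<forall>\<^sub>F t in at v. norm ((\<theta> t - \<theta> v) / (t - v)) \<le> \<bar>?p t\<bar> * \<bar>(?p t - ?p v) / (t - v)\<bar>"
          by (intro always_eventually allI)
      qed
      moreover have "\<theta>' v = 0" unfolding \<theta>'_def q_def 3 by simp
      ultimately show ?thesis by (simp add: has_field_derivative_iff)
    qed
  qed
  let ?n = "DIM('a)"
  let ?\<mu> = "\<lambda>j. sint (\<lambda>w. (b \<bullet> w) ^ j)"
  define G where "G y = (b \<bullet> y) ^ (j + 1) * \<theta> (y \<bullet> y)" for y
  define G' where "G' y = (real j + 1) * (\<theta> (y \<bullet> y) * (b \<bullet> y) ^ j) + 2 * (\<theta>' (y \<bullet> y) * (b \<bullet> y) ^ (j + 2))" for y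
  have out: "\<theta> (y \<bullet> y) = 0" "\<theta>' (y \<bullet> y) = 0" if "norm y \<le> 1 \<or> 2 \<le> norm y" for y :: 'a
  proof -
    have "y \<bullet> y \<le> 1 \<or> 4 \<le> y \<bullet> y"
      using that power_mono[of "norm y" 1 2] power_mono[of 2 "norm y" 2]
      by (auto simp: power2_norm_eq_inner)
    then show "\<theta> (y \<bullet> y) = 0" "\<theta>' (y \<bullet> y) = 0" by (auto simp: \<theta>_def \<theta>'_def q0)
  qed
  have "(LINT y|lborel. G' y) = 0"
  proof (rule integral_directional_derivative_eq_0[where G=G and v=b and M=2])
    show "continuous_on UNIV G" "continuous_on UNIV G'"
      unfolding G_def G'_def
      by (intro continuous_intros continuous_on_compose2[OF c\<theta>(1)[of UNIV]] continuous_on_compose2[OF c\<theta>(2)[of UNIV]]; simp)+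
    show "G y = 0" "G' y = 0" if "2 < norm y" for y using that by (auto simp: G_def G'_def out)
    fix y s
    have bb: "b \<bullet> b = 1" using b by (simp add: norm_eq_1)
    have "((\<lambda>s. (b \<bullet> (y + s *\<^sub>R b)) ^ (j + 1)) has_real_derivative (real j + 1) * (b \<bullet> (y + s *\<^sub>R b)) ^ j) (at s)"
    proof -
      have "((\<lambda>s. b \<bullet> y + s) has_real_derivative 1) (at s)" by (auto intro!: derivative_eq_intros)
      from DERIV_power[OF this, of "j + 1"] show ?thesis
        unfolding inner_add_right inner_scaleR_right bb by (simp add: algebra_simps)
    qed
    moreover have "((\<lambda>s. (y + s *\<^sub>R b) \<bullet> (y + s *\<^sub>R b)) has_real_derivative 2 * (b \<bullet> (y + s *\<^sub>R b))) (at s)"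
      unfolding inner_add_right inner_add_left inner_scaleR_right inner_scaleR_left bb
      by (auto intro!: derivative_eq_intros simp: inner_commute)
    note DERIV_chain2[OF d\<theta> this]
    ultimately have "((\<lambda>s. (b \<bullet> (y + s *\<^sub>R b)) ^ (j + 1) * \<theta> ((y + s *\<^sub>R b) \<bullet> (y + s *\<^sub>R b))) has_real_derivative
        (real j + 1) * (b \<bullet> (y + s *\<^sub>R b)) ^ j * \<theta> ((y + s *\<^sub>R b) \<bullet> (y + s *\<^sub>R b)) + 
        \<theta>' ((y + s *\<^sub>R b) \<bullet> (y + s *\<^sub>R b)) * (2 * (b \<bullet> (y + s *\<^sub>R b))) * (b \<bullet> (y + s *\<^sub>R b)) ^ (j + 1)) (at s)"
      by (rule DERIV_mult)
    then show "((\<lambda>s. G (y + s *\<^sub>R b)) has_real_derivative G' (y + s *\<^sub>R b)) (at s)"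
      unfolding G_def G'_def by (simp add: algebra_simps power2_eq_square)
  qed (use b in auto)
  also have "(LINT y|lborel. G' y) = (LINT y:shell 1 2|lborel. G' y)"
    unfolding set_lebesgue_integral_def
  proof (rule Bochner_Integration.integral_cong[OF refl])
    fix y :: 'a
    show "G' y = indicator (shell 1 2) y *\<^sub>R G' y"
      by (cases "y \<in> shell 1 2") (auto simp: shell_def G'_def out)
  qed
  also have "\<dots> = integral {1..2} (\<lambda>\<rho>. \<rho> ^ (?n - 1) * sint (\<lambda>w. G' (\<rho> *\<^sub>R w)))"
    unfolding G'_def
    by (rule polar_shell) (auto intro!: continuous_intros continuous_on_compose2[OF c\<theta>(1)[of UNIV]] continuous_on_compose2[OF c\<theta>(2)[of UNIV]])
  also have "\<dots> = integral {1..2} (\<lambda>\<rho>. (real j + 1) * ?\<mu> j * (\<rho> ^ (?n + j - 1) * \<theta> (\<rho>\<^sup>2)) + ?\<mu> (j + 2) * (2 * \<rho> ^ (?n + j + 1) * \<theta>' (\<rho>\<^sup>2)))"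
  proof (rule integral_cong)
    fix \<rho> :: real
    have n: "0 < ?n" by simp
    have "sint (\<lambda>w. G' (\<rho> *\<^sub>R w)) = sint (\<lambda>w. ((real j + 1) * \<rho> ^ j * \<theta> (\<rho>\<^sup>2)) * (b \<bullet> w) ^ j + (2 * \<rho> ^ (j + 2) * \<theta>' (\<rho>\<^sup>2)) * (b \<bullet> w) ^ (j + 2))"
      by (rule sint_cong) (simp add: G'_def power2_norm_eq_inner[symmetric] power_mult_distrib norm_eq_1 power2_eq_square algebra_simps)
    also have "\<dots> = ((real j + 1) * \<rho> ^ j * \<theta> (\<rho>\<^sup>2)) * ?\<mu> j + (2 * \<rho> ^ (j + 2) * \<theta>' (\<rho>\<^sup>2)) * ?\<mu> (j + 2)"
      by (subst sint_add) (intro continuous_intros | simp only: sint_cmult)+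
    finally have S: "sint (\<lambda>w. G' (\<rho> *\<^sub>R w)) = ((real j + 1) * \<rho> ^ j * \<theta> (\<rho>\<^sup>2)) * ?\<mu> j + (2 * \<rho> ^ (j + 2) * \<theta>' (\<rho>\<^sup>2)) * ?\<mu> (j + 2)" .
    have "?n + j - 1 = (?n - 1) + j" "?n + j + 1 = (?n - 1) + (j + 2)" using n by auto
    then have "\<rho> ^ (?n + j - 1) = \<rho> ^ (?n - 1) * \<rho> ^ j" "\<rho> ^ (?n + j + 1) = \<rho> ^ (?n - 1) * \<rho> ^ (j + 2)"
      by (simp_all only: power_add)
    then show "\<rho> ^ (?n - 1) * sint (\<lambda>w. G' (\<rho> *\<^sub>R w)) = 
       (real j + 1) * ?\<mu> j * (\<rho> ^ (?n + j - 1) * \<theta> (\<rho>\<^sup>2)) + ?\<mu> (j + 2) * (2 * \<rho> ^ (?n + j + 1) * \<theta>' (\<rho>\<^sup>2))"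
      unfolding S by (simp only: distrib_left distrib_right mult_ac)
  qed
  also have "\<dots> = (real j + 1) * ?\<mu> j * integral {1..2} (\<lambda>\<rho>. \<rho> ^ (?n + j - 1) * \<theta> (\<rho>\<^sup>2)) + ?\<mu> (j + 2) * integral {1..2} (\<lambda>\<rho>. 2 * \<rho> ^ (?n + j + 1) * \<theta>' (\<rho>\<^sup>2))"
    by (subst Henstock_Kurzweil_Integration.integral_add)
       (auto intro!: integrable_continuous_interval continuous_intros continuous_on_compose2[OF c\<theta>(1)[of UNIV]] continuous_on_compose2[OF c\<theta>(2)[of UNIV]])
  \<comment> \<open>Integration by parts for
    \<open>\<rho> ^ (n + j) * \<theta> (\<rho>\<^sup>2)\<close>, whose boundary values at 1 and 2
    are 0.\<close>
  also have "integral {1..2} (\<lambda>\<rho>. 2 * \<rho> ^ (?n + j + 1) * \<theta>' (\<rho>\<^sup>2)) = - (real ?n + real j) * integral {1..2} (\<lambda>\<rho>. \<rho> ^ (?n + j - 1) * \<theta> (\<rho>\<^sup>2))"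
  proof -
    have "((\<lambda>\<rho>. (real ?n + real j) * (\<rho> ^ (?n + j - 1) * \<theta> (\<rho>\<^sup>2)) + 2 * \<rho> ^ (?n + j + 1) * \<theta>' (\<rho>\<^sup>2)) has_integral 2 ^ (?n + j) * \<theta> (2\<^sup>2) - 1 ^ (?n + j) * \<theta> (1\<^sup>2)) {1..2::real}"
    proof (rule fundamental_theorem_of_calculus)
      fix \<rho> :: real
      have "((\<lambda>\<rho>. \<theta> (\<rho>\<^sup>2)) has_real_derivative \<theta>' (\<rho>\<^sup>2) * (2 * \<rho>)) (at \<rho>)"
        by (rule DERIV_chain2[OF d\<theta>]) (auto intro!: derivative_eq_intros)
      from DERIV_mult[OF DERIV_pow[of "?n + j"] this]
      have "((\<lambda>\<rho>. \<rho> ^ (?n + j) * \<theta> (\<rho>\<^sup>2)) has_real_derivative (real ?n + real j) * (\<rho> ^ (?n + j - 1) * \<theta> (\<rho>\<^sup>2)) + 2 * \<rho> ^ (?n + j + 1) * \<theta>' (\<rho>\<^sup>2)) (at \<rho>)"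
        by (simp add: algebra_simps)
      then show "((\<lambda>\<rho>. \<rho> ^ (?n + j) * \<theta> (\<rho>\<^sup>2)) has_vector_derivative (real ?n + real j) * (\<rho> ^ (?n + j - 1) * \<theta> (\<rho>\<^sup>2)) + 2 * \<rho> ^ (?n + j + 1) * \<theta>' (\<rho>\<^sup>2)) (at \<rho> within {1..2})"
        unfolding has_real_derivative_iff_has_vector_derivative[symmetric] by (rule has_field_derivative_at_within)
    qed simp
    from integral_unique[OF this]
    have "integral {1..2} (\<lambda>\<rho>. (real ?n + real j) * (\<rho> ^ (?n + j - 1) * \<theta> (\<rho>\<^sup>2)) + 2 * \<rho> ^ (?n + j + 1) * \<theta>' (\<rho>\<^sup>2)) = 0"
      by (simp add: \<theta>_def q0)
    moreover have "integral {1..2} (\<lambda>\<rho>. (real ?n + real j) * (\<rho> ^ (?n + j - 1) * \<theta> (\<rho>\<^sup>2)) + 2 * \<rho> ^ (?n + j + 1) * \<theta>' (\<rho>\<^sup>2)) =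
       (real ?n + real j) * integral {1..2} (\<lambda>\<rho>. \<rho> ^ (?n + j - 1) * \<theta> (\<rho>\<^sup>2)) + integral {1..2} (\<lambda>\<rho>. 2 * \<rho> ^ (?n + j + 1) * \<theta>' (\<rho>\<^sup>2))"
      by (subst Henstock_Kurzweil_Integration.integral_add)
         (auto intro!: integrable_continuous_interval continuous_intros continuous_on_compose2[OF c\<theta>(1)[of UNIV]] continuous_on_compose2[OF c\<theta>(2)[of UNIV]])
    ultimately show ?thesis unfolding mult_minus_left by linarith
  qed
  finally have "((real j + 1) * ?\<mu> j - (real ?n + real j) * ?\<mu> (j + 2)) * integral {1..2} (\<lambda>\<rho>. \<rho> ^ (?n + j - 1) * \<theta> (\<rho>\<^sup>2)) = 0"
    by (simp add: algebra_simps)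
  moreover have "integral {1..2} (\<lambda>\<rho>. \<rho> ^ (?n + j - 1) * \<theta> (\<rho>\<^sup>2)) \<noteq> 0"
  proof
    assume "integral {1..2} (\<lambda>\<rho>. \<rho> ^ (?n + j - 1) * \<theta> (\<rho>\<^sup>2)) = 0"
    then have "\<forall>\<rho>\<in>{1..2}. \<rho> ^ (?n + j - 1) * \<theta> (\<rho>\<^sup>2) = 0"
      by (subst (asm) integral_eq_0_iff) (auto intro!: continuous_intros continuous_on_compose2[OF cq[of UNIV]] simp: \<theta>_def)
    from bspec[OF this, of "3/2"] show False by (simp add: \<theta>_def q_def power2_eq_square)
  qed
  ultimately show ?thesis by simp
qed

section \<open>The zonal functional and the Gegenbauer operator\<close>

definition zint :: "'a::euclidean_space \<Rightarrow> real poly \<Rightarrow> real" where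
  "zint b p = sint (\<lambda>w. poly p (b \<bullet> w))"

lemma zint_cont: "continuous_on A (\<lambda>w. poly p (b \<bullet> w))"
  by (intro continuous_intros)

lemma zint_0 [simp]: "zint b 0 = 0"
  by (simp add: zint_def)

lemma zint_add: "zint b (p + q) = zint b p + zint b q"
  unfolding zint_def poly_add by (intro sint_add zint_cont)

lemma zint_smult: "zint b (smult c p) = c * zint b p"
  unfolding zint_def poly_smult by (rule sint_cmult)

lemma zint_diff: "zint b (p - q) = zint b p - zint b q"
  unfolding zint_def poly_diff by (intro sint_diff zint_cont)

lemma zint_sum: "zint b (\<Sum>i\<in>I. p i) = (\<Sum>i\<in>I. zint b (p i))"
  by (induction I rule: infinite_finite_induct) (auto simp: zint_add)

lemma poly_monom_induct [case_names zero monom add]: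
  assumes "P 0" "\<And>c i. P (monom c i)" "\<And>p q. P p \<Longrightarrow> P q \<Longrightarrow> P (p + q)"
  shows "P (p :: real poly)"
proof -
  have "P (\<Sum>i\<in>I. monom (coeff p i) i)" if "finite I" for I :: "nat set"
    using that by (induction I) (auto intro: assms)
  from this[of "{..degree p}"] show ?thesis by (simp add: poly_as_sum_of_monoms)
qed

lemma zint_monom_shift: "zint b ([:0, 1:] * monom c i) = c * sint (\<lambda>w. (b \<bullet> w) ^ (i + 1))"
  by (simp add: zint_def poly_monom sint_cmult[symmetric] mult_ac)

text \<open>In dimension \<open>n \<ge> 2\<close>, \<open>zint b\<close> is up to a constant
  integration over [-1, 1] against the weight \<open>(1 - x\<^sup>2)\<close> to the power
  \<open>(n - 3) / 2\<close>, and this is integration by parts for it. On monomials it amounts to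
  the moment recursion.\<close>

lemma zint_pderiv:
  assumes b: "norm (b::'a::euclidean_space) = 1"
  shows "zint b ([:1, 0, -1:] * pderiv r) = (real DIM('a) - 1) * zint b ([:0, 1:] * r)"
proof (induction r rule: poly_monom_induct)
  case (monom c i)
  show ?case
  proof (cases i)
    case 0
    \<comment> \<open>For constant \<open>r\<close> the left-hand side is 0, and the right-hand side
      is a first moment, which vanishes by antipodal symmetry.\<close>
    have "sint (\<lambda>w. b \<bullet> w) = 0"
      using sint_uminus[of "\<lambda>w. b \<bullet> w"] sint_cmult[of "-1" "\<lambda>w. b \<bullet> w"] by (simp add: continuous_intros)
    then show ?thesis using 0 zint_monom_shift[of b c 0] by (simp add: pderiv_monom)
  next
    case (Suc j)
    have "zint b ([:1, 0, -1:] * pderiv (monom c i)) = sint (\<lambda>w. (real (Suc j) * c) * (b \<bullet> w) ^ j - (real (Suc j) * c) * (b \<bullet> w) ^ (j + 2))"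
      unfolding zint_def Suc pderiv_monom by (rule sint_cong) (simp add: poly_monom algebra_simps)
    also have "\<dots> = (real (Suc j) * c) * (sint (\<lambda>w. (b \<bullet> w) ^ j) - sint (\<lambda>w. (b \<bullet> w) ^ (j + 2)))"
      by (subst sint_diff) (intro continuous_intros | simp only: sint_cmult right_diff_distrib)+
    also have "\<dots> = c * ((real DIM('a) - 1) * sint (\<lambda>w. (b \<bullet> w) ^ (j + 2)))"
    proof -
      have "(1 + J) * c * (A - B) = c * ((N - 1) * B)" if "(N + J) * B = (J + 1) * A" for A B N J :: real
        using that by algebra
      from this[OF sint_moment_rec[OF b, of j]] show ?thesis unfolding of_nat_Suc .
    qed
    also have "\<dots> = (real DIM('a) - 1) * zint b ([:0, 1:] * monom c i)"
      unfolding zint_monom_shift Suc by simp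
    finally show ?thesis .
  qed
next
  case (add p q)
  then show ?case by (simp only: pderiv_add distrib_left zint_add)
qed simp

text \<open>The Laplace-Beltrami operator of the unit sphere acting on functions of one direction
  cosine.\<close>

definition geg_op :: "nat \<Rightarrow> real poly \<Rightarrow> real poly" where
  "geg_op n p = [:1, 0, -1:] * pderiv (pderiv p) - smult (real n - 1) ([:0, 1:] * pderiv p)"

text \<open>Integrating the derivative of \<open>pderiv p * q\<close> by parts cancels the
  first-order terms. What remains is symmetric in \<open>p\<close> and \<open>q\<close>, which makes
  the operator symmetric.\<close>

lemma zint_geg_op_aux:
  assumes b: "norm (b::'a::euclidean_space) = 1"
  shows "zint b (geg_op DIM('a) p * q) = - zint b ([:1, 0, -1:] * pderiv p * pderiv q)"
proof -
  have "geg_op DIM('a) p * q = [:1, 0, -1:] * pderiv (pderiv p * q) - [:1, 0, -1:] * pderiv p * pderiv q - smult (real DIM('a) - 1) ([:0, 1:] * (pderiv p * q))"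
  proof -
    have "(X * P2 - smult c (x * P1)) * q = X * (P1 * Q1 + q * P2) - X * P1 * Q1 - smult c (x * (P1 * q))" for X P2 c x P1 Q1 :: "_"
      by (simp add: algebra_simps)
    then show ?thesis unfolding geg_op_def pderiv_mult .
  qed
  then show ?thesis
    unfolding zint_diff zint_smult zint_pderiv[OF b] by (simp only: zint_diff zint_smult zint_pderiv[OF b])
qed

lemma zint_geg_op:
  assumes b: "norm (b::'a::euclidean_space) = 1"
  shows "zint b (geg_op DIM('a) p * q) = zint b (p * geg_op DIM('a) q)"
  using zint_geg_op_aux[OF b, of p q] zint_geg_op_aux[OF b, of q p] by (simp only: mult_ac)

section \<open>Gegenbauer polynomials\<close>

primrec geg_coeff :: "nat \<Rightarrow> nat \<Rightarrow> nat \<Rightarrow> real" where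
  "geg_coeff n k 0 = 1"
| "geg_coeff n k (Suc i) = - (geg_coeff n k i * (real k - 2 * real i) * (real k - 2 * real i - 1) /
     (2 * (real i + 1) * (real n + 2 * real k - 2 * real i - 4)))"

text \<open>For \<open>n \<ge> 2\<close>, the Gegenbauer polynomial of parameter
  \<open>(n - 2) / 2\<close> scaled to be monic (Chebyshev for \<open>n = 2\<close>). Being monic
  makes triangular expansions immediate.\<close>

definition geg :: "nat \<Rightarrow> nat \<Rightarrow> real poly" where
  "geg n k = (\<Sum>i\<le>k div 2. monom (geg_coeff n k i) (k - 2 * i))"

lemma geg_coeff_rec:
  assumes "2 \<le> n" "i < k div 2"
  shows "geg_coeff n k (Suc i) * (2 * real (Suc i) * (real n + 2 * real k - 2 * real (Suc i) - 2)) +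
    geg_coeff n k i * real (k - 2 * i) * real (k - 2 * i - 1) = 0"
proof -
  have "2 * i + 2 \<le> k" using assms(2) by linarith
  then have r: "2 * real i + 2 \<le> real k" by linarith
  define D where "D = 2 * (real i + 1) * (real n + 2 * real k - 2 * real i - 4)"
  have "D \<noteq> 0" using r assms(1) by (simp add: D_def)
  moreover have "2 * real (Suc i) * (real n + 2 * real k - 2 * real (Suc i) - 2) = D"
    by (simp add: D_def algebra_simps)
  moreover have "real (k - 2 * i) = real k - 2 * real i" "real (k - 2 * i - 1) = real k - 2 * real i - 1"
    using \<open>2 * i + 2 \<le> k\<close> by (simp_all add: of_nat_diff)
  moreover have "geg_coeff n k (Suc i) = - (geg_coeff n k i * (real k - 2 * real i) * (real k - 2 * real i - 1) / D)"
    by (simp add: D_def)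
  ultimately show ?thesis by (simp del: geg_coeff.simps)
qed

text \<open>The common cancellation pattern of the eigenvalue equation for \<open>geg\<close> and of
  the harmonicity of its homogeneous extension.\<close>

lemma sum_telescope_zero:
  fixes A B :: "nat \<Rightarrow> 'a::comm_monoid_add"
  assumes "\<And>i. i < K \<Longrightarrow> A i + B (Suc i) = 0" "B 0 = 0" "A K = 0"
  shows "(\<Sum>i\<le>K. A i + B i) = 0"
proof -
  have "(\<Sum>i\<le>K. A i + B i) = (\<Sum>i<K. A i) + (\<Sum>i\<le>K. B i)"
    by (simp add: sum.distrib assms(3) flip: lessThan_Suc_atMost)
  also have "(\<Sum>i\<le>K. B i) = (\<Sum>i<K. B (Suc i))"
    by (simp only: sum.lessThan_Suc_shift assms(2) add_0 flip: lessThan_Suc_atMost)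
  also have "(\<Sum>i<K. A i) + \<dots> = 0"
    by (simp only: sum.distrib[symmetric]) (simp add: assms(1))
  finally show ?thesis .
qed

lemma coeff_geg:
  shows "coeff (geg n k) k = 1" "k < i \<Longrightarrow> coeff (geg n k) i = 0"
proof -
  have "coeff (geg n k) k = (\<Sum>i\<le>k div 2. if i = 0 then 1 else 0)"
    unfolding geg_def coeff_sum coeff_monom by (intro sum.cong refl) auto
  then show "coeff (geg n k) k = 1" by simp
  show "coeff (geg n k) i = 0" if "k < i"
    unfolding geg_def coeff_sum coeff_monom using that by (intro sum.neutral) auto
qed

lemma geg_op_add: "geg_op n (p + q) = geg_op n p + geg_op n q"
  by (simp only: geg_op_def pderiv_add distrib_left smult_add_right add_diff_add)

lemma geg_op_sum: "geg_op n (\<Sum>i\<in>I. p i) = (\<Sum>i\<in>I. geg_op n (p i))"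
proof (induction I rule: infinite_finite_induct)
  case (insert i I)
  then show ?case by (simp add: geg_op_add)
qed (auto simp: geg_op_def)

lemma geg_op_monom:
  "geg_op n (monom c m) = monom (c * real m * real (m - 1)) (m - 2) - monom (c * real m * (real m + real n - 2)) m"
proof -
  have X: "[:1, 0, -1:] = monom 1 0 - monom (1::real) 2" "[:0, 1:] = monom (1::real) 1"
    by (simp_all add: monom_altdef numeral_2_eq_2)
  consider "m = 0" | "m = 1" | l where "m = Suc (Suc l)"
    by (metis One_nat_def old.nat.exhaust)
  then show ?thesis
  proof cases
    case 3
    have "geg_op n (monom c m) = monom (c * real m * real (m - 1)) (m - 2) - (monom (c * real m * real (m - 1)) m + monom ((real n - 1) * (c * real m)) m)"
      unfolding 3 geg_op_def X pderiv_monom by (simp add: left_diff_distrib mult_monom smult_monom mult_ac)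
    also have "monom (c * real m * real (m - 1)) m + monom ((real n - 1) * (c * real m)) m = monom (c * real m * (real m + real n - 2)) m"
      unfolding add_monom 3 by (simp add: algebra_simps)
    finally show ?thesis .
  qed (simp_all add: geg_op_def X pderiv_monom mult_monom smult_monom mult.commute)
qed

lemma geg_op_geg:
  assumes n: "2 \<le> n"
  shows "geg_op n (geg n k) = smult (- (real k * (real k + real n - 2))) (geg n k)"
proof -
  define A where "A i = monom (geg_coeff n k i * real (k - 2 * i) * real (k - 2 * i - 1)) (k - 2 * i - 2)" for i
  define B where "B i = monom (geg_coeff n k i * (2 * real i * (real n + 2 * real k - 2 * real i - 2))) (k - 2 * i)" for i
  have "geg_op n (geg n k) - smult (- (real k * (real k + real n - 2))) (geg n k) = (\<Sum>i\<le>k div 2. A i + B i)"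
  proof -
    have "geg_op n (monom (geg_coeff n k i) (k - 2 * i)) - smult (- (real k * (real k + real n - 2))) (monom (geg_coeff n k i) (k - 2 * i)) = A i + B i"
      if "i \<le> k div 2" for i
    proof -
      have "real (k - 2 * i) = real k - 2 * real i" using that by (simp add: of_nat_diff)
      \<comment> \<open>The gap between the eigenvalues in degrees \<open>k\<close> and
        \<open>k - 2 * i\<close> factors as \<open>2 * i * (n + 2 * k - 2 * i - 2)\<close>; with
        \<open>i + 1\<close> for \<open>i\<close> this is the denominator in
        \<open>geg_coeff\<close>.\<close>
      then have "geg_coeff n k i * (2 * real i * (real n + 2 * real k - 2 * real i - 2)) = 
         real k * (real k + real n - 2) * geg_coeff n k i - geg_coeff n k i * real (k - 2 * i) * (real (k - 2 * i) + real n - 2)"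
        by (simp add: algebra_simps)
      then show ?thesis
        unfolding geg_op_monom A_def B_def smult_monom
        by (simp only: diff_monom[symmetric]) (simp add: minus_monom[symmetric] del: minus_monom)
    qed
    moreover have sm: "smult d (\<Sum>i\<in>I. p i) = (\<Sum>i\<in>I. smult d (p i))" for d and p :: "nat \<Rightarrow> real poly" and I
      by (induction I rule: infinite_finite_induct) (auto simp: smult_add_right)
    ultimately show ?thesis
      unfolding geg_def geg_op_sum sm sum_subtractf[symmetric] by (intro sum.cong) auto
  qed
  also have "\<dots> = 0"
  proof (rule sum_telescope_zero)
    show "B 0 = 0" by (simp add: B_def)
    have "k - 2 * (k div 2) = k mod 2" by (simp add: minus_mult_div_eq_mod)
    then show "A (k div 2) = 0" by (simp add: A_def)
    show "A i + B (Suc i) = 0" if "i < k div 2" for i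
      using geg_coeff_rec[OF n that] unfolding A_def B_def
      by (simp add: add_monom add.commute del: geg_coeff.simps)
  qed
  finally show ?thesis by simp
qed

text \<open>By symmetry the operator may act on either factor. On \<open>geg\<close> it gives the
  eigenvalue of degree \<open>k\<close>, on the monomial that of degree \<open>j\<close> plus a term
  two degrees lower, which vanishes by induction. The two eigenvalues differ.\<close>

lemma zint_monom_geg:
  assumes b: "norm (b::'a::euclidean_space) = 1" and n: "2 \<le> DIM('a)" and "j < k"
  shows "zint b (monom 1 j * geg DIM('a) k) = 0"
  using \<open>j < k\<close>
proof (induction j rule: less_induct)
  case (less j)
  let ?n = "DIM('a)" and ?z = "geg DIM('a) k"
  have 1: "zint b (geg_op ?n (monom 1 j) * ?z) = - (real k * (real k + real ?n - 2)) * zint b (monom 1 j * ?z)"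
    unfolding zint_geg_op[OF b] geg_op_geg[OF n] mult_smult_right zint_smult ..
  have 2: "zint b (geg_op ?n (monom 1 j) * ?z) = zint b (monom (real j * real (j - 1)) (j - 2) * ?z) - (real j * (real j + real ?n - 2)) * zint b (monom 1 j * ?z)"
  proof -
    have "monom (real j * (real j + real ?n - 2)) j = smult (real j * (real j + real ?n - 2)) (monom 1 j)" by (simp add: smult_monom)
    then show ?thesis unfolding geg_op_monom by (simp add: left_diff_distrib zint_diff zint_smult)
  qed
  have 3: "zint b (monom (real j * real (j - 1)) (j - 2) * ?z) = 0"
  proof (cases "j < 2")
    case True
    then have "real j * real (j - 1) = 0" by (cases j) auto
    then show ?thesis by (simp only: monom_eq_0 mult_zero_left zint_0)
  next
    case False
    then have "zint b (monom 1 (j - 2) * ?z) = 0" using less by simp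
    moreover have "monom (real j * real (j - 1)) (j - 2) = smult (real j * real (j - 1)) (monom 1 (j - 2))" by (simp add: smult_monom)
    ultimately show ?thesis by (simp add: zint_smult)
  qed
  have "(real k * (real k + real ?n - 2) - real j * (real j + real ?n - 2)) * zint b (monom 1 j * ?z) = 0"
    using 1 2 3 by (simp add: algebra_simps)
  moreover have "real j * (real j + real ?n - 2) < real k * (real k + real ?n - 2)"
    using less.prems n by (intro mult_strict_mono') auto
  ultimately show ?case by simp
qed

lemma zint_geg_orthogonal:
  assumes b: "norm (b::'a::euclidean_space) = 1" and n: "2 \<le> DIM('a)" and q: "\<And>i. k \<le> i \<Longrightarrow> coeff q i = 0"
  shows "zint b (q * geg DIM('a) k) = 0"
proof -
  have "q * geg DIM('a) k = (\<Sum>i\<le>degree q. smult (coeff q i) (monom 1 i * geg DIM('a) k))"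
    by (subst poly_as_sum_of_monoms[of q, symmetric]) (simp add: sum_distrib_right smult_monom flip: mult_smult_left)
  also have "zint b \<dots> = (\<Sum>i\<le>degree q. 0)"
    unfolding zint_sum zint_smult
  proof (rule sum.cong[OF refl])
    fix i show "coeff q i * zint b (monom 1 i * geg DIM('a) k) = 0"
      using q[of i] zint_monom_geg[OF b n, of i k] by (cases "i < k") auto
  qed
  finally show ?thesis by simp
qed

text \<open>Since \<open>geg n k\<close> is monic of degree \<open>k\<close>, the leading term can
  be split off repeatedly.\<close>

lemma poly_eq_sum_geg:
  assumes "\<And>i. N < i \<Longrightarrow> coeff q i = 0"
  shows "\<exists>c. q = (\<Sum>k\<le>N. smult (c k) (geg n k))"
  using assms
proof (induction N arbitrary: q)
  case 0
  have g: "geg n 0 = [:1:]" by (simp add: geg_def monom_0)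
  have q: "q = smult (coeff q 0) [:1:]"
  proof (rule poly_eqI)
    show "coeff q i = coeff (smult (coeff q 0) [:1:]) i" for i
      using 0[of i] by (cases i) auto
  qed
  have "q = (\<Sum>k\<le>0. smult (coeff q 0) (geg n k))"
  proof -
    have "(\<Sum>k\<le>0. smult (coeff q 0) (geg n k)) = smult (coeff q 0) (geg n 0)" by simp
    with g q show ?thesis by metis
  qed
  then show ?case by (rule exI[of _ "\<lambda>_. coeff q 0"])
next
  case (Suc N)
  have "\<exists>c. q - smult (coeff q (Suc N)) (geg n (Suc N)) = (\<Sum>k\<le>N. smult (c k) (geg n k))"
  proof (rule Suc.IH)
    fix i assume "N < i"
    then consider "i = Suc N" | "Suc N < i" by linarith
    then show "coeff (q - smult (coeff q (Suc N)) (geg n (Suc N))) i = 0"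
      by cases (simp_all add: coeff_geg Suc.prems)
  qed
  then obtain c where c: "q - smult (coeff q (Suc N)) (geg n (Suc N)) = (\<Sum>k\<le>N. smult (c k) (geg n k))" by blast
  have "(\<Sum>k\<le>N. smult (c k) (geg n k)) = (\<Sum>k\<le>N. smult ((c(Suc N := coeff q (Suc N))) k) (geg n k))"
    by (rule sum.cong) auto
  then have "q = (\<Sum>k\<le>Suc N. smult ((c(Suc N := coeff q (Suc N))) k) (geg n k))"
    using c by (simp add: diff_eq_eq del: fun_upd_apply) (simp add: fun_upd_apply)
  then show ?case by (rule exI[of _ "c(Suc N := coeff q (Suc N))"])
qed

lemma poly_geg_minus: "poly (geg n k) (- x) = (-1) ^ k * poly (geg n k) x"
proof -
  have "(- x) ^ (k - 2 * i) = (-1) ^ k * x ^ (k - 2 * i)" if "i \<le> k div 2" for i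
  proof -
    have "k = (k - 2 * i) + 2 * i" using that by auto
    then have "even k \<longleftrightarrow> even (k - 2 * i)" by presburger
    then show ?thesis by (cases "even k") simp_all
  qed
  then show ?thesis
    by (simp add: geg_def poly_sum poly_monom sum_distrib_left mult_ac)
qed

section \<open>Integrals along rays\<close>

text \<open>The Lucas sequence: the quotient of \<open>x ^ e - y ^ e\<close> by
  \<open>x - y\<close>, written in the product \<open>p\<close> and the sum \<open>s\<close> of
  \<open>x\<close> and \<open>y\<close>.\<close>

fun lucas_u :: "nat \<Rightarrow> real \<Rightarrow> real \<Rightarrow> real" where
  "lucas_u 0 p s = 0"
| "lucas_u (Suc 0) p s = 1"
| "lucas_u (Suc (Suc e)) p s = s * lucas_u (Suc e) p s - p * lucas_u e p s"

lemma power_diff_lucas: "x ^ e - y ^ e = (x - y) * lucas_u e (x * y) (x + y)"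
proof (induction e "x * y" "x + y" rule: lucas_u.induct)
  case (3 e)
  have "x ^ Suc (Suc e) - y ^ Suc (Suc e) = (x + y) * (x ^ Suc e - y ^ Suc e) - x * y * (x ^ e - y ^ e)"
    by (simp add: algebra_simps)
  also have "\<dots> = (x - y) * lucas_u (Suc (Suc e)) (x * y) (x + y)"
    unfolding 3 by (simp add: algebra_simps)
  finally show ?case .
qed simp_all

text \<open>Each step of the recursion raises the degree in \<open>s\<close> by at most one; of the
  dependence on \<open>p\<close> only continuity is recorded. The free bound \<open>N\<close> allows
  both predecessors to be expanded to the lengths that the recursion asks for.\<close>

lemma lucas_u_poly:
  "e \<le> N \<Longrightarrow> \<exists>u. (\<forall>j. continuous_on UNIV (u j)) \<and> (\<forall>p s. lucas_u e p s = (\<Sum>j<N. u j p * s ^ j))"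
proof (induction e arbitrary: N rule: less_induct)
  case (less e)
  consider "e = 0" | "e = 1" | e' where "e = Suc (Suc e')"
    by (metis One_nat_def old.nat.exhaust)
  then show ?case
  proof cases
    case 1
    then show ?thesis by (intro exI[of _ "\<lambda>j p. 0"]) auto
  next
    case 2
    have "(\<Sum>j<N. (if j = 0 then 1 else 0) * s ^ j) = (\<Sum>j<N. if j = 0 then 1 else (0::real))" for s :: real
      by (rule sum.cong) auto
    with 2 less.prems show ?thesis by (intro exI[of _ "\<lambda>j p. if j = 0 then 1 else 0"]) auto
  next
    case 3
    then obtain M where M: "N = Suc M" "Suc e' \<le> M" using less.prems by (cases N) auto
    from less.IH[of "Suc e'" M] 3 M obtain u1 where u1: "\<And>j. continuous_on UNIV (u1 j)" "\<And>p s. lucas_u (Suc e') p s = (\<Sum>j<M. u1 j p * s ^ j)"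
      by auto
    from less.IH[of e' N] 3 M obtain u0 where u0: "\<And>j. continuous_on UNIV (u0 j)" "\<And>p s. lucas_u e' p s = (\<Sum>j<N. u0 j p * s ^ j)"
      by auto
    define u where "u j p = (case j of 0 \<Rightarrow> 0 | Suc i \<Rightarrow> u1 i p) - p * u0 j p" for j p
    show ?thesis
    proof (intro exI[of _ u] conjI allI)
      show "continuous_on UNIV (u j)" for j
        unfolding u_def by (cases j) (auto intro!: continuous_intros u0 u1)
      fix p s
      have "(\<Sum>j<N. u j p * s ^ j) = (\<Sum>j<N. (case j of 0 \<Rightarrow> 0 | Suc i \<Rightarrow> u1 i p) * s ^ j) - p * (\<Sum>j<N. u0 j p * s ^ j)"
        by (simp add: u_def left_diff_distrib sum_subtractf sum_distrib_left mult.assoc)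
      also have "(\<Sum>j<N. (case j of 0 \<Rightarrow> 0 | Suc i \<Rightarrow> u1 i p) * s ^ j) = s * (\<Sum>j<M. u1 j p * s ^ j)"
        unfolding M(1) by (subst sum.lessThan_Suc_shift) (simp add: sum_distrib_left mult_ac)
      finally show "lucas_u e p s = (\<Sum>j<N. u j p * s ^ j)"
        by (simp add: 3 u1(2)[symmetric] u0(2)[symmetric])
    qed
  qed
qed

text \<open>For \<open>m < k\<close> the exponent \<open>2 * m + 1 - k\<close> has absolute value at
  most \<open>k - 1\<close>, so dividing by \<open>x - y\<close> leaves degree at most
  \<open>k - 2\<close> in \<open>x + y\<close>. A negative exponent is reduced to a positive one by
  bringing the reciprocals over a common power of \<open>x * y\<close>.\<close>

lemma power_quotient_diff_poly:
  assumes m: "m < k"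
  shows "\<exists>u. (\<forall>j. continuous_on {..<0} (u j)) \<and>
    (\<forall>x y::real. x * y < 0 \<longrightarrow> x ^ (2 * m + 1) / x ^ k - y ^ (2 * m + 1) / y ^ k = (x - y) * (\<Sum>j<k - 1. u j (x * y) * (x + y) ^ j))"
proof (cases "k \<le> 2 * m + 1")
  case True
  define e where "e = 2 * m + 1 - k"
  have "e \<le> k - 1" using m by (auto simp: e_def)
  from lucas_u_poly[OF this] obtain u where u: "\<And>j. continuous_on UNIV (u j)" "\<And>p s. lucas_u e p s = (\<Sum>j<k - 1. u j p * s ^ j)"
    by blast
  have q: "x ^ (2 * m + 1) / x ^ k = x ^ e" if "x \<noteq> 0" for x :: real
    using True that unfolding e_def by (rule power_diff[symmetric, rotated])
  show ?thesis
  proof (intro exI[of _ u] conjI allI impI)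
    show "continuous_on {..<0} (u j)" for j using u(1) continuous_on_subset by blast
    fix x y :: real assume "x * y < 0"
    then have "x \<noteq> 0" "y \<noteq> 0" by auto
    then show "x ^ (2 * m + 1) / x ^ k - y ^ (2 * m + 1) / y ^ k = (x - y) * (\<Sum>j<k - 1. u j (x * y) * (x + y) ^ j)"
      by (simp only: q[OF \<open>x \<noteq> 0\<close>] q[OF \<open>y \<noteq> 0\<close>] power_diff_lucas u(2)[symmetric])
  qed
next
  case False
  define e where "e = k - (2 * m + 1)"
  have "e \<le> k - 1" using m by (auto simp: e_def)
  from lucas_u_poly[OF this] obtain u where u: "\<And>j. continuous_on UNIV (u j)" "\<And>p s. lucas_u e p s = (\<Sum>j<k - 1. u j p * s ^ j)"
    by blast
  have q: "x ^ (2 * m + 1) / x ^ k = 1 / x ^ e" if "x \<noteq> 0" for x :: real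
  proof -
    have "k = 2 * m + 1 + e" using False by (simp add: e_def)
    then have "x ^ k = x ^ (2 * m + 1) * x ^ e" by (metis power_add)
    then show ?thesis using that by simp
  qed
  show ?thesis
  proof (intro exI[of _ "\<lambda>j p. - (u j p / p ^ e)"] conjI allI impI)
    show "continuous_on {..<0} (\<lambda>p. - (u j p / p ^ e))" for j
      by (intro continuous_intros continuous_on_subset[OF u(1)]) auto
    fix x y :: real assume "x * y < 0"
    then have xy: "x \<noteq> 0" "y \<noteq> 0" by auto
    have "1 / x ^ e - 1 / y ^ e = - (x ^ e - y ^ e) / (x * y) ^ e"
      using xy by (simp add: field_simps power_mult_distrib)
    also have "\<dots> = (x - y) * (\<Sum>j<k - 1. - (u j (x * y) / (x * y) ^ e) * (x + y) ^ j)"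
      unfolding power_diff_lucas u(2) by (simp add: sum_negf sum_divide_distrib sum_distrib_left)
    finally show "x ^ (2 * m + 1) / x ^ k - y ^ (2 * m + 1) / y ^ k = (x - y) * (\<Sum>j<k - 1. - (u j (x * y) / (x * y) ^ e) * (x + y) ^ j)"
      by (simp only: q[OF xy(1)] q[OF xy(2)])
  qed
qed

text \<open>For \<open>u = \<kappa> * x\<close> the square root is half the distance between the
  roots of the quadratic along a line through the origin. As \<open>\<kappa>\<^sup>2 < v\<close>
  places the origin inside the sphere, it exceeds the absolute value of their mean \<open>u\<close>:
  the roots have opposite signs.\<close>

lemma ray_discriminant:
  fixes u v \<kappa> :: real
  assumes "\<kappa>\<^sup>2 < v"
  shows "0 < sqrt (u\<^sup>2 + v - \<kappa>\<^sup>2)" "(sqrt (u\<^sup>2 + v - \<kappa>\<^sup>2))\<^sup>2 = u\<^sup>2 + v - \<kappa>\<^sup>2"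
    "\<bar>u\<bar> < sqrt (u\<^sup>2 + v - \<kappa>\<^sup>2)"
proof -
  have *: "u\<^sup>2 < u\<^sup>2 + v - \<kappa>\<^sup>2" using assms by simp
  have "0 < u\<^sup>2 + v - \<kappa>\<^sup>2" by (rule order.strict_trans1[OF zero_le_power2 *])
  then show "0 < sqrt (u\<^sup>2 + v - \<kappa>\<^sup>2)" "(sqrt (u\<^sup>2 + v - \<kappa>\<^sup>2))\<^sup>2 = u\<^sup>2 + v - \<kappa>\<^sup>2"
    by (simp_all only: real_sqrt_gt_0_iff real_sqrt_pow2 less_imp_le)
  show "\<bar>u\<bar> < sqrt (u\<^sup>2 + v - \<kappa>\<^sup>2)" using * by (metis real_sqrt_abs real_sqrt_less_iff)
qed

text \<open>On the ray with direction cosine \<open>x\<close> relative to the centre, at distance \<open>\<kappa>\<close> from the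
  origin, \<open>v = \<rho>\<^sup>2 - 2 \<rho> \<kappa> x + \<kappa>\<^sup>2\<close> is the squared distance from the centre.\<close>

lemma integral_ray_substitution:
  fixes \<Psi> q :: "real \<Rightarrow> real"
  assumes \<kappa>: "0 \<le> \<kappa>" "\<kappa>\<^sup>2 < \<alpha>" "\<alpha> < \<beta>" and \<Psi>: "test_fun 0 \<alpha> \<beta> \<Psi>" and x: "\<bar>x\<bar> \<le> 1"
    and l: "0 < l" "l + \<kappa> \<le> sqrt \<alpha>" and h: "sqrt \<beta> + \<kappa> \<le> h" and q: "continuous_on {0<..} q"
  shows "integral {l..h} (\<lambda>\<rho>. q \<rho> * \<Psi> (\<rho>\<^sup>2 - 2 * \<rho> * \<kappa> * x + \<kappa>\<^sup>2)) =
    integral {\<alpha>..\<beta>} (\<lambda>v. \<Psi> v * (q (\<kappa> * x + sqrt ((\<kappa> * x)\<^sup>2 + v - \<kappa>\<^sup>2)) / (2 * sqrt ((\<kappa> * x)\<^sup>2 + v - \<kappa>\<^sup>2))))"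
proof -
  define g where "g \<rho> = \<rho>\<^sup>2 - 2 * \<rho> * \<kappa> * x + \<kappa>\<^sup>2" for \<rho>
  \<comment> \<open>\<open>P v\<close> is the positive root, where the ray leaves the sphere of
    squared radius \<open>v\<close>, and \<open>2 * D v\<close> is the derivative of
    \<open>g\<close> there, hence the Jacobian in \<open>W\<close>.\<close>
  define D where "D v = sqrt ((\<kappa> * x)\<^sup>2 + v - \<kappa>\<^sup>2)" for v
  define P where "P v = \<kappa> * x + D v" for v
  define W where "W v = q (P v) / (2 * D v)" for v
  have D: "0 < D v" "(D v)\<^sup>2 = (\<kappa> * x)\<^sup>2 + v - \<kappa>\<^sup>2" "\<bar>\<kappa> * x\<bar> < D v" if "\<alpha> \<le> v" for v
    unfolding D_def by (rule ray_discriminant[OF order.strict_trans2[OF \<kappa>(2) that]])+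
  have P: "0 < P v" if "\<alpha> \<le> v" for v using D(3)[OF that] by (auto simp: P_def)
  have fac: "g \<rho> - v = (\<rho> - P v) * (\<rho> + (D v - \<kappa> * x))" if "\<alpha> \<le> v" for \<rho> v
  proof -
    have "(\<rho> - P v) * (\<rho> + (D v - \<kappa> * x)) = (\<rho> - \<kappa> * x)\<^sup>2 - (D v)\<^sup>2"
      by (simp add: P_def power2_eq_square algebra_simps)
    also have "\<dots> = g \<rho> - v" unfolding D(2)[OF that] g_def by (simp add: power2_eq_square algebra_simps)
    finally show ?thesis ..
  qed
  have sgn: "g \<rho> \<le> v \<longleftrightarrow> \<rho> \<le> P v" if "\<alpha> \<le> v" "0 \<le> \<rho>" for \<rho> v
  proof -
    have "0 < \<rho> + (D v - \<kappa> * x)" using D(3)[OF that(1)] that(2) by linarith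
    then show ?thesis using fac[OF that(1), of \<rho>] by (smt (verit) mult_nonneg_nonneg mult_pos_pos mult_nonpos_nonneg mult_neg_pos)
  qed
  have gP: "g (P v) = v" if "\<alpha> \<le> v" for v using fac[OF that, of "P v"] by simp
  have PP: "P \<alpha> \<le> P \<beta>" using sgn[of \<beta> "P \<alpha>"] gP[of \<alpha>] P[of \<alpha>] \<kappa> by simp
  have kx: "\<bar>\<kappa> * x\<bar> \<le> \<kappa>" using \<kappa> x by (simp add: abs_mult mult_left_le)
  then have kx': "- (\<kappa> * x) \<le> \<kappa>" "\<kappa> * x \<le> \<kappa>" by linarith+
  \<comment> \<open>The point at distance \<open>l\<close> from the origin has distance at most
    \<open>l + \<kappa>\<close> from the centre, so it has not yet left the sphere of radius
    \<open>sqrt \<alpha>\<close>.\<close>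
  have lP: "l \<le> P \<alpha>"
  proof -
    have "g l \<le> (l + \<kappa>)\<^sup>2"
      using mult_left_mono[OF kx'(1), of "2 * l"] l unfolding g_def by (simp add: power2_eq_square algebra_simps)
    also have "\<dots> \<le> (sqrt \<alpha>)\<^sup>2" using l \<kappa> by (intro power_mono) auto
    also have "\<dots> = \<alpha>" using \<kappa> zero_le_power2[of \<kappa>] by (intro real_sqrt_pow2) linarith
    finally show ?thesis using sgn[of \<alpha> l] l by simp
  qed
  have Ph: "P \<beta> \<le> h"
  proof (rule ccontr)
    assume "\<not> ?thesis"
    then have hP: "h < P \<beta>" by simp
    have h0: "0 \<le> h" using h \<kappa> by (smt (verit) real_sqrt_ge_zero zero_le_power2)
    have "0 < \<alpha>" by (rule order.strict_trans1[OF zero_le_power2 \<kappa>(2)])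
    then have "0 \<le> \<beta>" using \<kappa>(3) by simp
    then have "\<beta> = (sqrt \<beta>)\<^sup>2" by simp
    also have "\<dots> \<le> (h - \<kappa>)\<^sup>2" using h \<open>0 \<le> \<beta>\<close> by (intro power_mono) auto
    also have "\<dots> \<le> g h"
      using mult_left_mono[OF kx'(2), of "2 * h"] h0 unfolding g_def by (simp add: power2_eq_square algebra_simps)
    finally have "g h - \<beta> \<ge> 0" by simp
    moreover have "g h - \<beta> < 0"
      unfolding fac[OF less_imp_le[OF \<kappa>(3)]] using hP D(3)[of \<beta>] \<kappa> h0 by (intro mult_neg_pos) auto
    ultimately show False by simp
  qed
  have cD: "continuous_on {\<alpha>..\<beta>} D" unfolding D_def by (intro continuous_intros)
  have cW: "continuous_on {\<alpha>..\<beta>} W"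
    unfolding W_def P_def
    by (intro continuous_intros cD continuous_on_compose2[OF q]) (use P D in \<open>fastforce simp: P_def\<close>)+
  have "integral {l..h} (\<lambda>\<rho>. q \<rho> * \<Psi> (g \<rho>)) = integral {P \<alpha>..P \<beta>} (\<lambda>\<rho>. q \<rho> * \<Psi> (g \<rho>))"
  proof -
    let ?f = "\<lambda>\<rho>. q \<rho> * \<Psi> (g \<rho>)"
    have f: "?f integrable_on {s..t}" if "0 < s" for s t
      by (intro integrable_continuous_interval continuous_intros continuous_on_subset[OF q]
          continuous_on_compose2[OF test_fun_cont[OF \<Psi>, of UNIV]]) (use that in \<open>auto simp: g_def intro!: continuous_intros\<close>)
    have "integral {l..P \<alpha>} ?f = integral {l..P \<alpha>} (\<lambda>_. 0)"
      by (rule integral_cong) (use sgn[of \<alpha>] l test_fun_outside[OF \<Psi>] in auto)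
    moreover have "integral {P \<beta>..h} ?f = integral {P \<beta>..h} (\<lambda>_. 0)"
    proof (rule integral_cong)
      fix \<rho> assume "\<rho> \<in> {P \<beta>..h}"
      then have "0 \<le> g \<rho> - \<beta>"
        using fac[of \<beta> \<rho>] D(3)[of \<beta>] P[of \<beta>] \<kappa> by (auto intro!: mult_nonneg_nonneg)
      then show "q \<rho> * \<Psi> (g \<rho>) = 0" using test_fun_outside[OF \<Psi>, of "g \<rho>"] by simp
    qed
    moreover have "integral {l..h} ?f = integral {l..P \<alpha>} ?f + (integral {P \<alpha>..P \<beta>} ?f + integral {P \<beta>..h} ?f)"
    proof -
      have "integral {l..h} ?f = integral {l..P \<alpha>} ?f + integral {P \<alpha>..h} ?f"
        using lP PP Ph by (intro Henstock_Kurzweil_Integration.integral_combine[symmetric] f l) auto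
      also have "integral {P \<alpha>..h} ?f = integral {P \<alpha>..P \<beta>} ?f + integral {P \<beta>..h} ?f"
        using PP Ph P[of \<alpha>] by (intro Henstock_Kurzweil_Integration.integral_combine[symmetric] f) auto
      finally show ?thesis .
    qed
    ultimately show ?thesis by simp
  qed
  also have "\<dots> = integral {P \<alpha>..P \<beta>} (\<lambda>\<rho>. (2 * \<rho> - 2 * \<kappa> * x) *\<^sub>R (\<Psi> (g \<rho>) * W (g \<rho>)))"
  proof (rule integral_cong)
    fix \<rho> assume \<rho>: "\<rho> \<in> {P \<alpha>..P \<beta>}"
    have "D (g \<rho>) = sqrt ((\<rho> - \<kappa> * x)\<^sup>2)" unfolding D_def g_def by (simp add: power2_eq_square algebra_simps)
    also have "\<dots> = \<rho> - \<kappa> * x" using \<rho> D(1)[of \<alpha>] by (simp add: P_def)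
    finally have Dg: "D (g \<rho>) = \<rho> - \<kappa> * x" .
    define d where "d = \<rho> - \<kappa> * x"
    have "0 < d" using \<rho> D(1)[of \<alpha>] by (simp add: P_def d_def)
    moreover have "W (g \<rho>) = q \<rho> / (2 * d)" by (simp add: W_def P_def Dg d_def)
    moreover have "2 * \<rho> - 2 * \<kappa> * x = 2 * d" by (simp add: d_def)
    ultimately show "q \<rho> * \<Psi> (g \<rho>) = (2 * \<rho> - 2 * \<kappa> * x) *\<^sub>R (\<Psi> (g \<rho>) * W (g \<rho>))"
      by simp
  qed
  also have "\<dots> = integral {g (P \<alpha>)..g (P \<beta>)} (\<lambda>v. \<Psi> v * W v)"
  proof (rule integral_unique, rule has_integral_substitution[where g=g])
    show "P \<alpha> \<le> P \<beta>" by (rule PP)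
    show "g (P \<alpha>) \<le> g (P \<beta>)" using \<kappa> by (simp add: gP)
    show "g ` {P \<alpha>..P \<beta>} \<subseteq> {\<alpha>..\<beta>}"
    proof safe
      fix \<rho> assume \<rho>: "\<rho> \<in> {P \<alpha>..P \<beta>}"
      have "0 < P \<alpha>" using P by simp
      then have "g \<rho> \<le> \<beta>" using sgn[of \<beta> \<rho>] \<rho> \<kappa> by simp
      moreover have "0 \<le> g \<rho> - \<alpha>"
        using fac[of \<alpha> \<rho>] \<rho> D(3)[of \<alpha>] \<open>0 < P \<alpha>\<close> by (simp add: mult_nonneg_nonneg)
      ultimately show "g \<rho> \<in> {\<alpha>..\<beta>}" by simp
    qed
    show "continuous_on {\<alpha>..\<beta>} (\<lambda>v. \<Psi> v * W v)" by (intro continuous_intros cW test_fun_cont[OF \<Psi>])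
    show "(g has_real_derivative 2 * \<rho> - 2 * \<kappa> * x) (at \<rho> within {P \<alpha>..P \<beta>})" for \<rho>
      unfolding g_def by (auto intro!: derivative_eq_intros)
  qed
  also have "\<dots> = integral {\<alpha>..\<beta>} (\<lambda>v. \<Psi> v * W v)" using \<kappa> by (simp add: gP)
  finally show ?thesis unfolding g_def W_def P_def D_def .
qed

text \<open>Antipodal symmetry allows the ray integral at \<open>x\<close> to be averaged with
  \<open>(-1) ^ k\<close> times the one at \<open>- x\<close>. This combines both roots on the line
  into a difference of powers, which divided by the difference of the roots is a polynomial in
  \<open>x\<close> of degree at most \<open>k - 2\<close>, orthogonal to \<open>geg\<close> of
  degree \<open>k\<close>.\<close>

lemma sint_geg_ray_integral:
  fixes b :: "'a::euclidean_space"
  assumes b: "norm b = 1" and n: "2 \<le> DIM('a)" and m: "m < k"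
    and \<kappa>: "0 \<le> \<kappa>" "\<kappa>\<^sup>2 < \<alpha>" "\<alpha> < \<beta>" and \<Psi>: "test_fun 0 \<alpha> \<beta> \<Psi>"
    and l: "0 < l" "l + \<kappa> \<le> sqrt \<alpha>" and h: "sqrt \<beta> + \<kappa> \<le> h"
  shows "sint (\<lambda>w. poly (geg DIM('a) k) (b \<bullet> w) *
      integral {l..h} (\<lambda>\<rho>. \<rho> ^ (2 * m + 1) / \<rho> ^ k * \<Psi> (\<rho>\<^sup>2 - 2 * \<rho> * \<kappa> * (b \<bullet> w) + \<kappa>\<^sup>2))) = 0"
proof -
  let ?z = "geg DIM('a) k"
  define q where "q \<rho> = \<rho> ^ (2 * m + 1) / \<rho> ^ k" for \<rho> :: real
  define D where "D x v = sqrt ((\<kappa> * x)\<^sup>2 + v - \<kappa>\<^sup>2)" for x v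
  define R where "R x = integral {\<alpha>..\<beta>} (\<lambda>v. \<Psi> v * (q (\<kappa> * x + D x v) / (2 * D x v)))" for x
  have cq: "continuous_on {0<..} q" unfolding q_def by (intro continuous_intros) auto
  note bw = abs_inner_unit_le_1[OF b]
  have D: "0 < D x v" "(D x v)\<^sup>2 = (\<kappa> * x)\<^sup>2 + v - \<kappa>\<^sup>2" "\<bar>\<kappa> * x\<bar> < D x v" if "\<alpha> \<le> v" for x v
    unfolding D_def by (rule ray_discriminant[OF order.strict_trans2[OF \<kappa>(2) that]])+
  have cD: "continuous_on {\<alpha>..\<beta>} (D x)" for x unfolding D_def by (intro continuous_intros)
  have pos: "0 < \<kappa> * x + D x v" "D x v \<noteq> 0" if "\<alpha> \<le> v" for x v
    using D(1,3)[OF that, of x] by auto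
  define F where "F x v = \<Psi> v * (q (\<kappa> * x + D x v) / (2 * D x v))" for x v
  have R: "R x = integral {\<alpha>..\<beta>} (F x)" for x
    by (simp add: R_def F_def[abs_def])
  have int: "F x integrable_on {\<alpha>..\<beta>}" for x
    unfolding F_def
    by (intro integrable_continuous_interval continuous_intros cD test_fun_cont[OF \<Psi>] continuous_on_compose2[OF cq])
       (auto simp: pos)
  from power_quotient_diff_poly[OF m] obtain u where u: "\<And>j. continuous_on {..<0} (u j)"
    "\<And>x y. x * y < 0 \<Longrightarrow> q x - q y = (x - y) * (\<Sum>j<k - 1. u j (x * y) * (x + y) ^ j)"
    unfolding q_def by blast
  \<comment> \<open>The roots have sum \<open>2 * \<kappa> * x\<close> and product
    \<open>\<kappa>\<^sup>2 - v\<close>, so \<open>x\<close> enters only through powers of the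
    sum.\<close>
  define c where "c j = (2 * \<kappa>) ^ j * integral {\<alpha>..\<beta>} (\<lambda>v. \<Psi> v * u j (\<kappa>\<^sup>2 - v))" for j
  have sym: "R x + (-1) ^ k * R (- x) = (\<Sum>j<k - 1. c j * x ^ j)" for x
  proof -
    have "R x + (-1) ^ k * R (- x) = integral {\<alpha>..\<beta>} (\<lambda>v. F x v + (-1) ^ k * F (- x) v)"
      unfolding R by (simp add: Henstock_Kurzweil_Integration.integral_add int integrable_on_mult_right)
    also have "\<dots> = integral {\<alpha>..\<beta>} (\<lambda>v. \<Sum>j<k - 1. (2 * \<kappa>) ^ j * x ^ j * (\<Psi> v * u j (\<kappa>\<^sup>2 - v)))"
    proof (rule integral_cong)
      fix v assume "v \<in> {\<alpha>..\<beta>}"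
      then have v: "\<alpha> \<le> v" by simp
      define s t where "s = \<kappa> * x + D x v" and "t = \<kappa> * x - D x v"
      have st: "s + t = 2 * \<kappa> * x" "s - t = 2 * D x v" by (auto simp: s_def t_def)
      have p: "s * t = \<kappa>\<^sup>2 - v" using D(2)[OF v, of x] by (simp add: s_def t_def algebra_simps power2_eq_square)
      have neg: "s * t < 0" unfolding p using \<kappa> v by simp
      have D': "D (- x) v = D x v" by (simp add: D_def)
      have t': "\<kappa> * - x + D x v = - t" by (simp add: t_def)
      \<comment> \<open>The odd exponent \<open>2 * m + 1\<close> supplies the minus sign that turns
        the sum of the two contributions into a difference.\<close>
      have qt: "(-1) ^ k * q (- t) = - q t"
        by (cases "even k") (simp_all add: q_def)
      have "F x v = \<Psi> v * (q s / (2 * D x v))" unfolding F_def s_def ..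
      moreover have "F (- x) v = \<Psi> v * (q (- t) / (2 * D x v))" unfolding F_def D' t' ..
      ultimately have "F x v + (-1) ^ k * F (- x) v = \<Psi> v * ((q s + (-1) ^ k * q (- t)) / (2 * D x v))"
        by (simp add: algebra_simps add_divide_distrib)
      also have "\<dots> = \<Psi> v * ((q s - q t) / (s - t))" unfolding qt st(2) by simp
      also have "(q s - q t) / (s - t) = (\<Sum>j<k - 1. u j (\<kappa>\<^sup>2 - v) * (2 * \<kappa> * x) ^ j)"
        using D(1)[OF v, of x] unfolding u(2)[OF neg] st p by simp
      finally show "F x v + (-1) ^ k * F (- x) v = 
         (\<Sum>j<k - 1. (2 * \<kappa>) ^ j * x ^ j * (\<Psi> v * u j (\<kappa>\<^sup>2 - v)))"
        by (simp add: sum_distrib_left power_mult_distrib mult_ac)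
    qed
    also have "\<dots> = (\<Sum>j<k - 1. (2 * \<kappa>) ^ j * x ^ j * integral {\<alpha>..\<beta>} (\<lambda>v. \<Psi> v * u j (\<kappa>\<^sup>2 - v)))"
    proof (subst integral_sum)
      show "(\<lambda>v. (2 * \<kappa>) ^ j * x ^ j * (\<Psi> v * u j (\<kappa>\<^sup>2 - v))) integrable_on {\<alpha>..\<beta>}" for j
        by (intro integrable_continuous_interval continuous_intros test_fun_cont[OF \<Psi>] continuous_on_compose2[OF u(1)])
           (use \<kappa> in auto)
    qed auto
    finally show ?thesis by (simp add: c_def mult_ac)
  qed
  have cR: "continuous_on {-1..1} R"
    unfolding R_def cbox_interval[symmetric]
  proof (rule integral_continuous_on_param)
    have "continuous_on ({- 1..1} \<times> {\<alpha>..\<beta>}) (\<lambda>z. D (fst z) (snd z))"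
      unfolding D_def by (intro continuous_intros)
    then show "continuous_on (cbox (- 1) 1 \<times> cbox \<alpha> \<beta>) (\<lambda>(x, v). \<Psi> v * (q (\<kappa> * x + D x v) / (2 * D x v)))"
      unfolding case_prod_beta' cbox_interval
      by (intro continuous_intros continuous_on_compose2[OF test_fun_cont[OF \<Psi>, of UNIV]] continuous_on_compose2[OF cq])
         (auto simp: pos)
  qed
  have cR': "continuous_on (sphere 0 1) (\<lambda>w. R (b \<bullet> w))" "continuous_on (sphere 0 1) (\<lambda>w. R (- (b \<bullet> w)))"
    by (intro continuous_on_compose2[OF cR] continuous_intros; use bw in \<open>force simp: abs_le_iff\<close>)+
  let ?S = "sint (\<lambda>w. poly ?z (b \<bullet> w) * R (b \<bullet> w))"
  have "?S = sint (\<lambda>w. poly ?z (b \<bullet> (- w)) * R (b \<bullet> (- w)))"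
    by (rule sint_uminus[symmetric]) (intro continuous_intros cR')
  also have "\<dots> = sint (\<lambda>w. poly ?z (b \<bullet> w) * ((-1) ^ k * R (- (b \<bullet> w))))"
    by (simp add: poly_geg_minus mult_ac)
  finally have "?S + ?S = sint (\<lambda>w. poly ?z (b \<bullet> w) * R (b \<bullet> w)) + sint (\<lambda>w. poly ?z (b \<bullet> w) * ((-1) ^ k * R (- (b \<bullet> w))))"
    by simp
  also have "\<dots> = sint (\<lambda>w. poly ?z (b \<bullet> w) * R (b \<bullet> w) + poly ?z (b \<bullet> w) * ((-1) ^ k * R (- (b \<bullet> w))))"
    by (rule sint_add[symmetric]) (intro continuous_intros cR')+
  also have "\<dots> = sint (\<lambda>w. poly ((\<Sum>j<k - 1. monom (c j) j) * ?z) (b \<bullet> w))"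
  proof (rule sint_cong)
    fix w :: 'a
    have "poly (\<Sum>j<k - 1. monom (c j) j) (b \<bullet> w) = R (b \<bullet> w) + (-1) ^ k * R (- (b \<bullet> w))"
      unfolding sym by (simp add: poly_sum poly_monom)
    then show "poly ?z (b \<bullet> w) * R (b \<bullet> w) + poly ?z (b \<bullet> w) * ((-1) ^ k * R (- (b \<bullet> w))) = poly ((\<Sum>j<k - 1. monom (c j) j) * ?z) (b \<bullet> w)"
      by (simp only: poly_mult distrib_left mult.commute)
  qed
  also have "\<dots> = zint b ((\<Sum>j<k - 1. monom (c j) j) * ?z)" by (simp add: zint_def)
  also have "\<dots> = 0"
  proof (rule zint_geg_orthogonal[OF b n])
    fix i assume "k \<le> i"
    then show "coeff (\<Sum>j<k - 1. monom (c j) j) i = 0"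
      unfolding coeff_sum coeff_monom by (intro sum.neutral) auto
  qed
  finally have "?S = 0" by simp
  moreover have "?S = sint (\<lambda>w. poly ?z (b \<bullet> w) *
      integral {l..h} (\<lambda>\<rho>. \<rho> ^ (2 * m + 1) / \<rho> ^ k * \<Psi> (\<rho>\<^sup>2 - 2 * \<rho> * \<kappa> * (b \<bullet> w) + \<kappa>\<^sup>2)))"
  proof (rule sint_cong)
    fix w :: 'a assume "norm w = 1"
    from integral_ray_substitution[OF \<kappa> \<Psi> bw[OF this] l h cq]
    show "poly ?z (b \<bullet> w) * R (b \<bullet> w) = poly ?z (b \<bullet> w) * integral {l..h} (\<lambda>\<rho>. \<rho> ^ (2 * m + 1) / \<rho> ^ k * \<Psi> (\<rho>\<^sup>2 - 2 * \<rho> * \<kappa> * (b \<bullet> w) + \<kappa>\<^sup>2))"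
      unfolding R_def D_def by (simp only: q_def)
  qed
  ultimately show ?thesis by simp
qed

section \<open>From radial coefficients to vanishing sphere integrals\<close>

text \<open>Degenerate Cauchy-Schwarz: the integral of
  \<open>(\<psi> w - s * \<phi> w)\<^sup>2\<close> is affine in \<open>s\<close> and nonnegative for
  all \<open>s\<close>, hence constant. It lets zonal projections be treated without showing that
  the zonal harmonics have nonzero norm.\<close>

lemma sint_sq_eq_0_imp:
  fixes \<phi> \<psi> :: "'a::euclidean_space \<Rightarrow> real"
  assumes c: "continuous_on (sphere 0 1) \<phi>" "continuous_on (sphere 0 1) \<psi>" and z: "sint (\<lambda>w. (\<phi> w)\<^sup>2) = 0"
  shows "sint (\<lambda>w. \<psi> w * \<phi> w) = 0"
proof (rule ccontr)
  let ?A = "sint (\<lambda>w. (\<psi> w)\<^sup>2)" and ?B = "sint (\<lambda>w. \<psi> w * \<phi> w)"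
  assume B: "?B \<noteq> 0"
  have ge: "0 \<le> ?A - 2 * s * ?B" for s
  proof -
    have "0 \<le> sint (\<lambda>w. (\<psi> w - s * \<phi> w)\<^sup>2)"
      using sint_mono[of "\<lambda>_. 0" "\<lambda>w. (\<psi> w - s * \<phi> w)\<^sup>2"] c by (simp add: continuous_intros)
    also have "\<dots> = sint (\<lambda>w. (\<psi> w)\<^sup>2 - (2 * s * (\<psi> w * \<phi> w) - s\<^sup>2 * (\<phi> w)\<^sup>2))"
      by (simp add: power2_eq_square algebra_simps)
    also have "\<dots> = ?A - 2 * s * ?B"
      using c z by (simp add: sint_diff sint_cmult continuous_intros)
    finally show ?thesis .
  qed
  \<comment> \<open>At this value of \<open>s\<close> the affine function equals -1.\<close>
  have "2 * ((?A + 1) / (2 * ?B)) * ?B = ?A + 1" using B by simp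
  with ge[of "(?A + 1) / (2 * ?B)"] show False by simp
qed

text \<open>The sum is the pairing of \<open>\<psi>\<close> with the mean-square projection of
  \<open>\<phi> (e \<bullet> w)\<close> onto the zonal harmonics of degree at most \<open>N\<close>.
  The polynomial \<open>Q\<close> lies in their span, so the projection error is no larger in mean
  square than that of \<open>Q\<close>.\<close>

lemma geg_expansion_bound:
  fixes e :: "'a::euclidean_space" and \<psi> :: "'a \<Rightarrow> real" and \<phi> :: "real \<Rightarrow> real"
  assumes e: "norm e = 1" and n: "2 \<le> DIM('a)"
    and \<phi>: "continuous_on {-1..1} \<phi>" and \<psi>: "continuous_on (sphere 0 1) \<psi>"
    and \<epsilon>: "0 < \<epsilon>" and Q: "\<And>i. N < i \<Longrightarrow> coeff Q i = 0" "\<And>x. \<bar>x\<bar> \<le> 1 \<Longrightarrow> \<bar>\<phi> x - poly Q x\<bar> \<le> \<epsilon>"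
    and G: "\<And>w. norm w = 1 \<Longrightarrow> \<bar>\<psi> w\<bar> \<le> G"
  defines "z \<equiv> \<lambda>k w. poly (geg DIM('a) k) (e \<bullet> w)"
  shows "\<bar>sint (\<lambda>w. \<psi> w * \<phi> (e \<bullet> w)) - (\<Sum>k\<le>N. sint (\<lambda>w. \<phi> (e \<bullet> w) * z k w) / sint (\<lambda>w. (z k w)\<^sup>2) * sint (\<lambda>w. \<psi> w * z k w))\<bar>
    \<le> G * \<epsilon> * sint (\<lambda>w::'a. 1)"
proof -
  \<comment> \<open>Should a norm vanish, division by zero gives the coefficient 0, which is still
    correct because the numerator vanishes too.\<close>
  define f where "f k = sint (\<lambda>w. \<phi> (e \<bullet> w) * z k w) / sint (\<lambda>w. (z k w)\<^sup>2)" for k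
  note ew = abs_inner_unit_le_1[OF e]
  have c\<phi>: "continuous_on (sphere 0 1) (\<lambda>w. \<phi> (e \<bullet> w))"
    by (rule continuous_on_compose2[OF \<phi>]) (use ew in \<open>auto intro!: continuous_intros simp: abs_le_iff minus_le_iff\<close>)
  have cz: "continuous_on (sphere 0 1) (z k)" for k unfolding z_def by (rule zint_cont)
  define r where "r w = \<phi> (e \<bullet> w) - (\<Sum>k\<le>N. f k * z k w)" for w
  have cr: "continuous_on (sphere 0 1) r" unfolding r_def by (intro continuous_intros c\<phi> cz)
  have orth: "sint (\<lambda>w. z j w * z k w) = (if j = k then sint (\<lambda>w. (z k w)\<^sup>2) else 0)" for j k
  proof -
    have "sint (\<lambda>w. z j w * z k w) = 0" if "j < k" for j k
      using zint_geg_orthogonal[OF e n, of k "geg DIM('a) j"] that by (simp add: coeff_geg zint_def z_def)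
    from this[of j k] this[of k j] show ?thesis by (cases j k rule: linorder_cases) (auto simp: power2_eq_square mult.commute)
  qed
  have rz: "sint (\<lambda>w. r w * z k w) = 0" if "k \<le> N" for k
  proof -
    have "sint (\<lambda>w. r w * z k w) = sint (\<lambda>w. \<phi> (e \<bullet> w) * z k w - (\<Sum>j\<le>N. f j * (z j w * z k w)))"
      by (simp add: r_def left_diff_distrib sum_distrib_right mult.assoc)
    also have "\<dots> = sint (\<lambda>w. \<phi> (e \<bullet> w) * z k w) - (\<Sum>j\<le>N. f j * sint (\<lambda>w. z j w * z k w))"
    proof -
      have "sint (\<lambda>w. \<Sum>j\<le>N. f j * (z j w * z k w)) = (\<Sum>j\<le>N. f j * sint (\<lambda>w. z j w * z k w))"
        by (subst sint_sum) (auto intro!: continuous_intros cz simp: sint_cmult)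
      then show ?thesis by (subst sint_diff) (auto intro!: continuous_intros c\<phi> cz)
    qed
    also have "(\<Sum>j\<le>N. f j * sint (\<lambda>w. z j w * z k w)) = (\<Sum>j\<le>N. if j = k then f k * sint (\<lambda>w. (z k w)\<^sup>2) else 0)"
      by (rule sum.cong) (auto simp: orth)
    also have "\<dots> = f k * sint (\<lambda>w. (z k w)\<^sup>2)" using that by simp
    also have "\<dots> = sint (\<lambda>w. \<phi> (e \<bullet> w) * z k w)"
      using sint_sq_eq_0_imp[OF cz c\<phi>, of k] by (cases "sint (\<lambda>w. (z k w)\<^sup>2) = 0") (auto simp: f_def)
    finally show ?thesis by simp
  qed
  obtain d where d: "Q = (\<Sum>k\<le>N. smult (d k) (geg DIM('a) k))"
    using poly_eq_sum_geg[of N Q "DIM('a)"] Q(1) by auto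
  define s where "s w = (\<Sum>k\<le>N. (f k - d k) * z k w)" for w
  have cs: "continuous_on (sphere 0 1) s" unfolding s_def by (intro continuous_intros cz)
  have rs: "\<phi> (e \<bullet> w) - poly Q (e \<bullet> w) = r w + s w" for w
    by (simp add: r_def s_def d poly_sum z_def left_diff_distrib sum_subtractf)
  have "sint (\<lambda>w. r w * s w) = sint (\<lambda>w. \<Sum>k\<le>N. (f k - d k) * (r w * z k w))"
    by (simp add: s_def sum_distrib_left mult_ac)
  also have "\<dots> = (\<Sum>k\<le>N. (f k - d k) * sint (\<lambda>w. r w * z k w))"
    by (subst sint_sum) (auto intro!: continuous_intros cr cz simp: sint_cmult)
  also have "\<dots> = 0" by (simp add: rz)
  finally have ortho: "sint (\<lambda>w. r w * s w) = 0" .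
  \<comment> \<open>Pythagoras: \<open>r\<close> is orthogonal to \<open>s\<close>, and
    \<open>r + s\<close> is the approximation error of \<open>Q\<close>.\<close>
  have "sint (\<lambda>w. (r w)\<^sup>2) \<le> sint (\<lambda>w. (r w)\<^sup>2) + sint (\<lambda>w. (s w)\<^sup>2) + 2 * sint (\<lambda>w. r w * s w)"
    using sint_mono[of "\<lambda>_. 0" "\<lambda>w. (s w)\<^sup>2"] cs ortho by (simp add: continuous_intros)
  also have "\<dots> = sint (\<lambda>w. (r w)\<^sup>2 + (s w)\<^sup>2 + 2 * (r w * s w))"
    by (simp add: sint_add sint_cmult continuous_intros cr cs)
  also have "\<dots> = sint (\<lambda>w. (\<phi> (e \<bullet> w) - poly Q (e \<bullet> w))\<^sup>2)"
    unfolding rs by (simp add: power2_sum mult.assoc)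
  also have "\<dots> \<le> sint (\<lambda>w::'a. \<epsilon>\<^sup>2 * 1)"
  proof (rule sint_mono)
    show "(\<phi> (e \<bullet> w) - poly Q (e \<bullet> w))\<^sup>2 \<le> \<epsilon>\<^sup>2 * 1" if "norm w = 1" for w
      using Q(2)[OF ew[OF that]] \<epsilon> by (simp add: abs_le_square_iff[symmetric])
  qed (intro continuous_intros c\<phi> zint_cont)+
  finally have r2: "sint (\<lambda>w. (r w)\<^sup>2) \<le> \<epsilon>\<^sup>2 * sint (\<lambda>w::'a. 1)" by (simp only: sint_cmult)
  have G0: "0 \<le> G" using G[OF e] by linarith
  have "sint (\<lambda>w. \<psi> w * \<phi> (e \<bullet> w)) - (\<Sum>k\<le>N. f k * sint (\<lambda>w. \<psi> w * z k w)) = sint (\<lambda>w. \<psi> w * \<phi> (e \<bullet> w)) - sint (\<lambda>w. \<Sum>k\<le>N. f k * (\<psi> w * z k w))"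
    by (subst sint_sum) (auto intro!: continuous_intros \<psi> cz simp: sint_cmult)
  also have "\<dots> = sint (\<lambda>w. \<psi> w * \<phi> (e \<bullet> w) - (\<Sum>k\<le>N. f k * (\<psi> w * z k w)))"
    by (rule sint_diff[symmetric]) (intro continuous_intros \<psi> c\<phi> cz)+
  also have "\<dots> = sint (\<lambda>w. \<psi> w * r w)"
    by (simp add: r_def right_diff_distrib sum_distrib_left mult_ac)
  also have "\<bar>\<dots>\<bar> \<le> sint (\<lambda>w. \<bar>\<psi> w * r w\<bar>)"
    by (intro sint_abs_le continuous_intros \<psi> cr)
  also have "\<dots> \<le> sint (\<lambda>w. G * \<epsilon> / 2 * 1 + G / (2 * \<epsilon>) * (r w)\<^sup>2)"
  proof (rule sint_mono)
    fix w :: 'a assume w: "norm w = 1"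
    \<comment> \<open>A pointwise arithmetic-geometric inequality with weight
      \<open>\<epsilon>\<close> passes from the mean-square bound to a bound on the integral of
      \<open>\<bar>r w\<bar>\<close>.\<close>
    have "0 \<le> (\<bar>r w\<bar> - \<epsilon>)\<^sup>2" by simp
    then have "2 * \<epsilon> * \<bar>r w\<bar> \<le> \<epsilon>\<^sup>2 + (r w)\<^sup>2" by (simp add: power2_diff mult_ac)
    then have "\<bar>r w\<bar> \<le> \<epsilon> / 2 + (r w)\<^sup>2 / (2 * \<epsilon>)" using \<epsilon> by (simp add: field_simps power2_eq_square)
    then have "\<bar>\<psi> w\<bar> * \<bar>r w\<bar> \<le> G * (\<epsilon> / 2 + (r w)\<^sup>2 / (2 * \<epsilon>))"
      using G[OF w] G0 by (intro mult_mono) auto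
    then show "\<bar>\<psi> w * r w\<bar> \<le> G * \<epsilon> / 2 * 1 + G / (2 * \<epsilon>) * (r w)\<^sup>2"
      by (simp add: abs_mult algebra_simps)
  qed (intro continuous_intros \<psi> cr)+
  also have "\<dots> = G * \<epsilon> / 2 * sint (\<lambda>w::'a. 1) + G / (2 * \<epsilon>) * sint (\<lambda>w. (r w)\<^sup>2)"
    by (subst sint_add) (intro continuous_intros cr | simp only: sint_cmult)+
  also have "\<dots> \<le> G * \<epsilon> / 2 * sint (\<lambda>w::'a. 1) + G / (2 * \<epsilon>) * (\<epsilon>\<^sup>2 * sint (\<lambda>w::'a. 1))"
    using r2 G0 \<epsilon> by (intro add_left_mono mult_left_mono) auto
  also have "\<dots> = G * \<epsilon> * sint (\<lambda>w::'a. 1)" using \<epsilon> by (simp add: field_simps power2_eq_square)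
  finally show ?thesis unfolding f_def .
qed

lemma weierstrass_poly:
  assumes "continuous_on {x..y} \<Psi>" "0 < \<epsilon>"
  obtains p :: "real poly" where "\<And>v. v \<in> {x..y} \<Longrightarrow> \<bar>\<Psi> v - poly p v\<bar> < \<epsilon>"
proof -
  obtain g where g: "real_polynomial_function g" "\<And>v. v \<in> {x..y} \<Longrightarrow> \<bar>\<Psi> v - g v\<bar> < \<epsilon>"
    using Stone_Weierstrass_real_polynomial_function[OF compact_Icc assms] by metis
  obtain a n where "g = (\<lambda>x. \<Sum>i\<le>n. a i * x ^ i)"
    using g(1) unfolding real_polynomial_function_iff_sum by blast
  then have "g v = poly (\<Sum>i\<le>n. monom (a i) i) v" for v by (simp add: poly_sum poly_monom)
  with g(2) that show ?thesis by metis
qed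

text \<open>Each term of the zonal expansion integrates to 0: the polar density times the
  coefficient of \<open>g\<close> is a combination of
  \<open>\<rho> ^ (2 * m + 1) / \<rho> ^ k\<close> with \<open>m < k\<close>, and interchanging the
  integrals leads to the ray integrals. The remainder is a multiple of an arbitrary
  \<open>\<epsilon>\<close>.\<close>

lemma coeff_poly_imp_integral_radial_eq_0:
  fixes g :: "'a::euclidean_space \<Rightarrow> real"
  assumes DIM: "2 \<le> DIM('a)" and a: "0 \<le> a"
    and g: "continuous_on (annulus a b) g" and e: "norm e = 1"
    and coeffs: "\<And>k. \<exists>p. (\<forall>i\<ge>k. coeff p i = 0) \<and>
      (\<forall>\<rho>. a < \<rho> \<and> \<rho> < b \<longrightarrow> \<rho> ^ (DIM('a) + k - 2) * sint (\<lambda>w. g (\<rho> *\<^sub>R w) * poly (geg DIM('a) k) (e \<bullet> w)) = poly p (\<rho>\<^sup>2))"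
    and \<kappa>: "0 \<le> \<kappa>" "\<kappa>\<^sup>2 < \<alpha>" "\<alpha> < \<beta>" and \<Psi>: "test_fun 0 \<alpha> \<beta> \<Psi>"
    and l: "a < l" "l + \<kappa> \<le> sqrt \<alpha>" and h: "sqrt \<beta> + \<kappa> \<le> h" "h < b" and lh: "l \<le> h"
  shows "integral {l..h} (\<lambda>\<rho>. \<rho> ^ (DIM('a) - 1) * sint (\<lambda>w. g (\<rho> *\<^sub>R w) * \<Psi> (\<rho>\<^sup>2 - 2 * \<rho> * \<kappa> * (e \<bullet> w) + \<kappa>\<^sup>2))) = 0"
proof -
  let ?n = "DIM('a)"
  have l0: "0 < l" using a l by simp
  note ew = abs_inner_unit_le_1[OF e]
  define F where "F \<rho> x = \<Psi> (\<rho>\<^sup>2 - 2 * \<rho> * \<kappa> * x + \<kappa>\<^sup>2)" for \<rho> x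
  define z where "z k w = poly (geg ?n k) (e \<bullet> w)" for k w
  have cF: "continuous_on ({l..h} \<times> sphere 0 1) (\<lambda>(\<rho>, w). F \<rho> (e \<bullet> w))"
    unfolding F_def case_prod_beta' by (intro continuous_intros continuous_on_compose2[OF test_fun_cont[OF \<Psi>, of UNIV]]) auto
  have sub: "(\<lambda>x. fst x *\<^sub>R snd x) ` ({l..h} \<times> sphere (0::'a) 1) \<subseteq> annulus a b"
    using l h l0 by (auto simp: annulus_def)
  have cg: "continuous_on ({l..h} \<times> sphere 0 1) (\<lambda>(\<rho>, w). g (\<rho> *\<^sub>R w))"
    unfolding case_prod_beta' by (rule continuous_on_compose2[OF g _ sub]) (intro continuous_intros)
  have cz: "continuous_on A (\<lambda>x. z k (snd x))" for k and A :: "(real \<times> 'a) set"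
    unfolding z_def by (intro continuous_intros)
  have c1: "continuous_on {l..h} (\<lambda>\<rho>. sint (\<lambda>w. g (\<rho> *\<^sub>R w) * F \<rho> (e \<bullet> w)))"
    using continuous_on_mult[OF cg cF] by (intro continuous_on_sint) (simp add: case_prod_beta')
  have c2: "continuous_on {l..h} (\<lambda>\<rho>. sint (\<lambda>w. g (\<rho> *\<^sub>R w) * z k w))" for k
    using continuous_on_mult[OF cg cz] by (intro continuous_on_sint) (simp add: case_prod_beta')
  have c3': "continuous_on ({l..h} \<times> sphere 0 1) (\<lambda>(\<rho>, w). F \<rho> (e \<bullet> w) * z k w)" for k
    using continuous_on_mult[OF cF cz] by (simp add: case_prod_beta')
  have c3: "continuous_on {l..h} (\<lambda>\<rho>. sint (\<lambda>w. F \<rho> (e \<bullet> w) * z k w))" for k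
    using c3' by (rule continuous_on_sint)
  have "bounded ((\<lambda>(\<rho>, w). g (\<rho> *\<^sub>R w)) ` ({l..h} \<times> sphere 0 1))"
    by (intro compact_imp_bounded compact_continuous_image cg compact_Times) auto
  then obtain G where G: "\<And>\<rho> w. \<rho> \<in> {l..h} \<Longrightarrow> norm w = 1 \<Longrightarrow> \<bar>g (\<rho> *\<^sub>R w)\<bar> \<le> G"
    by (fastforce simp: bounded_iff)
  have zero: "integral {l..h} (\<lambda>\<rho>. \<rho> ^ (?n - 1) * (sint (\<lambda>w. F \<rho> (e \<bullet> w) * z k w) / sint (\<lambda>w. (z k w)\<^sup>2) * sint (\<lambda>w. g (\<rho> *\<^sub>R w) * z k w))) = 0" for k
  proof -
    from coeffs[of k] obtain p where p: "\<And>i. k \<le> i \<Longrightarrow> coeff p i = 0"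
      "\<And>\<rho>. a < \<rho> \<Longrightarrow> \<rho> < b \<Longrightarrow> \<rho> ^ (?n + k - 2) * sint (\<lambda>w. g (\<rho> *\<^sub>R w) * z k w) = poly p (\<rho>\<^sup>2)"
      unfolding z_def by blast
    have ps: "poly p x = (\<Sum>m<k. coeff p m * x ^ m)" for x
      by (rule poly_altdef_lessThan[OF p(1)])
    let ?N = "sint (\<lambda>w. (z k w)\<^sup>2)"
    have "integral {l..h} (\<lambda>\<rho>. \<rho> ^ (?n - 1) * (sint (\<lambda>w. F \<rho> (e \<bullet> w) * z k w) / ?N * sint (\<lambda>w. g (\<rho> *\<^sub>R w) * z k w))) =
      integral {l..h} (\<lambda>\<rho>. \<Sum>m<k. coeff p m / ?N * sint (\<lambda>w. \<rho> ^ (2 * m + 1) / \<rho> ^ k * (F \<rho> (e \<bullet> w) * z k w)))"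
    proof (rule integral_cong)
      fix \<rho> assume \<rho>: "\<rho> \<in> {l..h}"
      then have \<rho>0: "0 < \<rho>" using l0 by simp
      have e1: "\<rho> ^ (?n - 1) / \<rho> ^ (?n + k - 2) = \<rho> / \<rho> ^ k"
      proof -
        have "(?n - 1) + k = Suc (?n + k - 2)" using DIM by simp
        then have "\<rho> ^ (?n - 1) * \<rho> ^ k = \<rho> * \<rho> ^ (?n + k - 2)" by (metis power_add power_Suc)
        then show ?thesis using \<rho>0 by (simp add: field_simps)
      qed
      have "sint (\<lambda>w. g (\<rho> *\<^sub>R w) * z k w) = poly p (\<rho>\<^sup>2) / \<rho> ^ (?n + k - 2)"
        using p(2)[of \<rho>] \<rho> l h \<rho>0 by (simp add: field_simps)
      then have "\<rho> ^ (?n - 1) * (sint (\<lambda>w. F \<rho> (e \<bullet> w) * z k w) / ?N * sint (\<lambda>w. g (\<rho> *\<^sub>R w) * z k w)) =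
         (\<rho> ^ (?n - 1) / \<rho> ^ (?n + k - 2)) * (sint (\<lambda>w. F \<rho> (e \<bullet> w) * z k w) / ?N * poly p (\<rho>\<^sup>2))"
        by simp
      also have "\<dots> = (\<Sum>m<k. coeff p m / ?N * (\<rho> ^ (2 * m + 1) / \<rho> ^ k * sint (\<lambda>w. F \<rho> (e \<bullet> w) * z k w)))"
        unfolding e1 ps by (simp add: sum_distrib_left sum_divide_distrib mult_ac flip: power_mult)
      finally show "\<rho> ^ (?n - 1) * (sint (\<lambda>w. F \<rho> (e \<bullet> w) * z k w) / ?N * sint (\<lambda>w. g (\<rho> *\<^sub>R w) * z k w)) =
         (\<Sum>m<k. coeff p m / ?N * sint (\<lambda>w. \<rho> ^ (2 * m + 1) / \<rho> ^ k * (F \<rho> (e \<bullet> w) * z k w)))"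
        by (simp only: sint_cmult)
    qed
    also have "\<dots> = (\<Sum>m<k. coeff p m / ?N * integral {l..h} (\<lambda>\<rho>. sint (\<lambda>w. \<rho> ^ (2 * m + 1) / \<rho> ^ k * (F \<rho> (e \<bullet> w) * z k w))))"
    proof (subst integral_sum)
      show "(\<lambda>\<rho>. coeff p m / ?N * sint (\<lambda>w. \<rho> ^ (2 * m + 1) / \<rho> ^ k * (F \<rho> (e \<bullet> w) * z k w))) integrable_on {l..h}" for m
        unfolding sint_cmult using l0 by (intro integrable_continuous_interval continuous_intros c3) auto
    qed auto
    also have "\<dots> = (\<Sum>m<k. 0)"
    proof (rule sum.cong[OF refl])
      fix m assume "m \<in> {..<k}"
      then have m: "m < k" by simp
      have "continuous_on ({l..h} \<times> sphere (0::'a) 1) (\<lambda>(\<rho>, w). \<rho> ^ (2 * m + 1) / \<rho> ^ k * (F \<rho> (e \<bullet> w) * z k w))"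
        unfolding case_prod_beta'
        by (intro continuous_on_mult continuous_on_divide continuous_on_power continuous_on_fst continuous_on_id
            cF[unfolded case_prod_beta'] cz) (use l0 in auto)
      from sint_Fubini[OF this] have "integral {l..h} (\<lambda>\<rho>. sint (\<lambda>w. \<rho> ^ (2 * m + 1) / \<rho> ^ k * (F \<rho> (e \<bullet> w) * z k w))) =
          sint (\<lambda>w. integral {l..h} (\<lambda>\<rho>. \<rho> ^ (2 * m + 1) / \<rho> ^ k * (F \<rho> (e \<bullet> w) * z k w)))" .
      also have "\<dots> = sint (\<lambda>w. z k w * integral {l..h} (\<lambda>\<rho>. \<rho> ^ (2 * m + 1) / \<rho> ^ k * F \<rho> (e \<bullet> w)))"
        by (intro arg_cong[where f=sint] ext) (simp only: mult.assoc[symmetric] integral_mult_left, simp only: mult.commute)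
      also have "\<dots> = 0"
        unfolding z_def F_def by (rule sint_geg_ray_integral[OF e DIM m \<kappa> \<Psi> l0 l(2) h(1)])
      finally show "coeff p m / ?N * integral {l..h} (\<lambda>\<rho>. sint (\<lambda>w. \<rho> ^ (2 * m + 1) / \<rho> ^ k * (F \<rho> (e \<bullet> w) * z k w))) = 0"
        by simp
    qed
    finally show ?thesis by simp
  qed
  let ?I = "integral {l..h} (\<lambda>\<rho>. \<rho> ^ (?n - 1) * sint (\<lambda>w. g (\<rho> *\<^sub>R w) * F \<rho> (e \<bullet> w)))"
  let ?C = "h ^ (?n - 1) * (G * sint (\<lambda>w::'a. 1)) * (h - l)"
  have bound: "\<bar>?I\<bar> \<le> \<epsilon> * ?C" if \<epsilon>: "0 < \<epsilon>" for \<epsilon>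
  proof -
    \<comment> \<open>The interval contains every squared distance from the centre that occurs, so
      one polynomial, and with it one cut-off \<open>N\<close>, serves all radii.\<close>
    obtain p :: "real poly" where p: "\<And>v. v \<in> {0..(h + \<kappa>)\<^sup>2} \<Longrightarrow> \<bar>\<Psi> v - poly p v\<bar> < \<epsilon>"
      using weierstrass_poly[OF test_fun_cont[OF \<Psi>] \<epsilon>] by metis
    define N where "N = degree p"
    define T where "T k \<rho> = sint (\<lambda>w. F \<rho> (e \<bullet> w) * z k w) / sint (\<lambda>w. (z k w)\<^sup>2) * sint (\<lambda>w. g (\<rho> *\<^sub>R w) * z k w)" for k \<rho>
    have cT: "continuous_on {l..h} (T k)" for k
      unfolding T_def divide_inverse by (intro continuous_intros c2 c3)
    have "?I = ?I - (\<Sum>k\<le>N. integral {l..h} (\<lambda>\<rho>. \<rho> ^ (?n - 1) * T k \<rho>))"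
      by (simp only: T_def zero sum.neutral_const diff_zero)
    also have "\<dots> = integral {l..h} (\<lambda>\<rho>. \<rho> ^ (?n - 1) * sint (\<lambda>w. g (\<rho> *\<^sub>R w) * F \<rho> (e \<bullet> w)) - (\<Sum>k\<le>N. \<rho> ^ (?n - 1) * T k \<rho>))"
      by (subst Henstock_Kurzweil_Integration.integral_diff, (intro integrable_continuous_interval continuous_intros c1 cT)+,
          subst integral_sum, auto intro!: integrable_continuous_interval continuous_intros cT)
    finally have I: "?I = \<dots>" .
    have "norm \<dots> \<le> \<epsilon> * (h ^ (?n - 1) * (G * sint (\<lambda>w::'a. 1))) * (h - l)"
    proof (rule integral_bound[OF lh])
      show "continuous_on {l..h} (\<lambda>\<rho>. \<rho> ^ (?n - 1) * sint (\<lambda>w. g (\<rho> *\<^sub>R w) * F \<rho> (e \<bullet> w)) - (\<Sum>k\<le>N. \<rho> ^ (?n - 1) * T k \<rho>))"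
        by (intro continuous_intros c1 cT)
      fix \<rho> assume \<rho>: "\<rho> \<in> {l..h}"
      then have \<rho>0: "0 < \<rho>" using l0 by simp
      have "\<bar>sint (\<lambda>w. g (\<rho> *\<^sub>R w) * F \<rho> (e \<bullet> w)) - (\<Sum>k\<le>N. T k \<rho>)\<bar> \<le> G * \<epsilon> * sint (\<lambda>w::'a. 1)"
        unfolding T_def z_def
      proof (rule geg_expansion_bound[OF e DIM _ _ \<epsilon>])
        show "continuous_on {-1..1} (F \<rho>)"
          unfolding F_def by (intro continuous_intros continuous_on_compose2[OF test_fun_cont[OF \<Psi>, of UNIV]]) auto
        show "continuous_on (sphere 0 1) (\<lambda>w. g (\<rho> *\<^sub>R w))"
          using continuous_on_curry[OF cg \<rho>] .
        show "\<bar>g (\<rho> *\<^sub>R w)\<bar> \<le> G" if "norm w = 1" for w using G[OF \<rho> that] .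
        \<comment> \<open>For fixed radius the squared distance is affine in the direction cosine,
          so composition does not raise the degree.\<close>
        define Q where "Q = pcompose p [:\<rho>\<^sup>2 + \<kappa>\<^sup>2, - (2 * \<rho> * \<kappa>):]"
        have "degree Q \<le> N * 1" unfolding Q_def N_def
          by (rule order_trans[OF degree_pcompose_le]) (auto intro!: mult_left_mono simp: degree_pCons_eq_if)
        then show "coeff Q i = 0" if "N < i" for i using that by (simp add: coeff_eq_0)
        show "\<bar>F \<rho> x - poly Q x\<bar> \<le> \<epsilon>" if x: "\<bar>x\<bar> \<le> 1" for x
        proof -
          define v where "v = \<rho>\<^sup>2 - 2 * \<rho> * \<kappa> * x + \<kappa>\<^sup>2"
          have "\<bar>\<kappa> * x\<bar> \<le> \<kappa>" using \<kappa> x by (simp add: abs_mult mult_left_le)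
          then have kx: "- (\<kappa> * x) \<le> \<kappa>" "\<kappa> * x \<le> \<kappa>" by linarith+
          have "v \<le> (\<rho> + \<kappa>)\<^sup>2"
            using mult_left_mono[OF kx(1), of "2 * \<rho>"] \<rho>0 unfolding v_def by (simp add: power2_eq_square algebra_simps)
          also have "\<dots> \<le> (h + \<kappa>)\<^sup>2" using \<rho> \<rho>0 \<kappa> by (intro power_mono) auto
          finally have "v \<le> (h + \<kappa>)\<^sup>2" .
          moreover have "(\<rho> - \<kappa>)\<^sup>2 \<le> v"
            using mult_left_mono[OF kx(2), of "2 * \<rho>"] \<rho>0 unfolding v_def by (simp add: power2_eq_square algebra_simps)
          then have "0 \<le> v" using zero_le_power2 order_trans by blast
          ultimately have "\<bar>\<Psi> v - poly p v\<bar> < \<epsilon>" using p by simp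
          moreover have "poly Q x = poly p v" by (simp add: Q_def poly_pcompose v_def algebra_simps)
          ultimately show ?thesis by (simp add: F_def v_def)
        qed
      qed
      then have bd: "\<rho> ^ (?n - 1) * \<bar>sint (\<lambda>w. g (\<rho> *\<^sub>R w) * F \<rho> (e \<bullet> w)) - (\<Sum>k\<le>N. T k \<rho>)\<bar> \<le> h ^ (?n - 1) * (G * \<epsilon> * sint (\<lambda>w::'a. 1))"
        using \<rho> \<rho>0 by (intro mult_mono power_mono) auto
      show "norm (\<rho> ^ (?n - 1) * sint (\<lambda>w. g (\<rho> *\<^sub>R w) * F \<rho> (e \<bullet> w)) - (\<Sum>k\<le>N. \<rho> ^ (?n - 1) * T k \<rho>)) \<le> \<epsilon> * (h ^ (?n - 1) * (G * sint (\<lambda>w::'a. 1)))"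
      proof -
        have "\<rho> ^ (?n - 1) * sint (\<lambda>w. g (\<rho> *\<^sub>R w) * F \<rho> (e \<bullet> w)) - (\<Sum>k\<le>N. \<rho> ^ (?n - 1) * T k \<rho>) =
            \<rho> ^ (?n - 1) * (sint (\<lambda>w. g (\<rho> *\<^sub>R w) * F \<rho> (e \<bullet> w)) - (\<Sum>k\<le>N. T k \<rho>))"
          by (simp only: right_diff_distrib sum_distrib_left)
        with bd show ?thesis using \<rho>0 by (simp only: real_norm_def abs_mult power_abs abs_of_pos) (simp add: mult_ac)
      qed
    qed
    then show ?thesis unfolding I by (simp add: mult_ac)
  qed
  have "?I = 0"
  proof (rule ccontr)
    assume "?I \<noteq> 0"
    define K where "K = \<bar>?C\<bar> + 1"
    have K: "0 < K" "?C \<le> K" unfolding K_def by linarith+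
    define \<epsilon> where "\<epsilon> = \<bar>?I\<bar> / (2 * K)"
    have "0 < \<epsilon>" unfolding \<epsilon>_def using \<open>?I \<noteq> 0\<close> K by (intro divide_pos_pos) auto
    have "\<bar>?I\<bar> \<le> \<epsilon> * ?C" by (rule bound) fact
    also have "\<dots> \<le> \<epsilon> * K" using \<open>0 < \<epsilon>\<close> K(2) by (intro mult_left_mono) auto
    also have "\<dots> = \<bar>?I\<bar> / 2" unfolding \<epsilon>_def using K(1) by simp
    finally show False using \<open>?I \<noteq> 0\<close> by simp
  qed
  then show ?thesis unfolding F_def .
qed

text \<open>With the centre fixed, the weighted integral over spheres about \<open>c\<close> is a
  continuous function of the squared radius. Tested against any compactly supported function it
  becomes a volume integral, which vanishes when computed in polar coordinates about the origin.
  Orthogonality to test functions of order 0 then forces the zero polynomial.\<close>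

lemma coeff_poly_imp_zero_sphere_means:
  fixes g :: "'a::euclidean_space \<Rightarrow> real"
  assumes DIM: "2 \<le> DIM('a)" and a: "0 \<le> a"
    and g: "continuous_on (annulus a b) g"
    and coeffs: "\<And>e k. norm e = 1 \<Longrightarrow> \<exists>p. (\<forall>i\<ge>k. coeff p i = 0) \<and>
      (\<forall>\<rho>. a < \<rho> \<and> \<rho> < b \<longrightarrow> \<rho> ^ (DIM('a) + k - 2) * sint (\<lambda>w. g (\<rho> *\<^sub>R w) * poly (geg DIM('a) k) (e \<bullet> w)) = poly p (\<rho>\<^sup>2))"
  shows "zero_sphere_means a b g"
  unfolding zero_sphere_means_def
proof (intro allI impI)
  fix c :: 'a and t assume ct: "a + norm c < t \<and> t < b - norm c"
  let ?n = "DIM('a)"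
  define \<kappa> where "\<kappa> = norm c"
  obtain e where e: "norm e = 1" and c: "c = \<kappa> *\<^sub>R e"
    unfolding \<kappa>_def by (rule unit_vector_cases)
  have \<kappa>: "0 \<le> \<kappa>" by (simp add: \<kappa>_def)
  define L H where "L = (a + \<kappa>)\<^sup>2" and "H = (b - \<kappa>)\<^sup>2"
  have ab: "a + \<kappa> < t" "t < b - \<kappa>" "0 < t" using ct a norm_ge_zero[of c] unfolding \<kappa>_def by linarith+
  have LtH: "L < t\<^sup>2" "t\<^sup>2 < H" unfolding L_def H_def using ab a \<kappa> by (auto intro!: power_strict_mono)
  define W where "W \<tau> = sint (\<lambda>w. g (c + \<tau> *\<^sub>R w))" for \<tau>
  have cg: "continuous_on (shell l h) (\<lambda>y. g (c + y))" if "a + \<kappa> < l" "h < b - \<kappa>" for l h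
    by (rule continuous_on_compose2[OF g]) (use shell_translate_subset_annulus[of a c l h b] that in \<open>auto simp: \<kappa>_def intro!: continuous_intros\<close>)
  have cW: "continuous_on {l..h} W" if "a + \<kappa> < l" "h < b - \<kappa>" for l h
    unfolding W_def using polar_shell(1)[OF _ cg[OF that]] that a \<kappa> by (intro continuous_on_sint) auto
  define w where "w u = sqrt u ^ (?n - 2) * W (sqrt u)" for u
  have sq: "a + \<kappa> < sqrt \<alpha>" if "L < \<alpha>" for \<alpha>
    using that a \<kappa> real_sqrt_less_iff[of L \<alpha>] by (simp add: L_def)
  have sq': "sqrt \<beta> < b - \<kappa>" if "\<beta> < H" for \<beta>
    using that ab real_sqrt_less_iff[of \<beta> H] by (simp add: H_def)
  have cw: "continuous_on {\<alpha>..\<beta>} w" if "L < \<alpha>" "\<beta> < H" for \<alpha> \<beta>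
  proof -
    note cW' = cW[OF sq[OF that(1)] sq'[OF that(2)]]
    show ?thesis
      unfolding w_def
      by (intro continuous_on_mult continuous_on_power continuous_on_real_sqrt continuous_on_id continuous_on_compose2[OF cW']) auto
  qed
  have "\<exists>p. (\<forall>i\<ge>0. coeff p i = 0) \<and> (\<forall>u. L < u \<and> u < H \<longrightarrow> w u = poly p u)"
  proof (rule orthogonal_test_fun_imp_poly_open)
    show "L < H" using LtH by simp
    show "continuous_on {L<..<H} w" by (rule continuous_on_Ioo_if_Icc[OF cw])
    fix \<alpha> \<beta> \<Psi> assume \<alpha>\<beta>: "L < \<alpha>" "\<alpha> < \<beta>" "\<beta> < H" and \<Psi>: "test_fun 0 \<alpha> \<beta> \<Psi>"
    have "\<kappa>\<^sup>2 \<le> L" unfolding L_def using a \<kappa> by (intro power_mono) auto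
    then have \<kappa>\<alpha>: "\<kappa>\<^sup>2 < \<alpha>" using \<alpha>\<beta> by simp
    then have \<alpha>0: "0 < \<alpha>" by (rule order.strict_trans1[OF zero_le_power2])
    \<comment> \<open>The range of distances from the origin on the shell about \<open>c\<close>
      between radii \<open>sqrt \<alpha>\<close> and \<open>sqrt \<beta>\<close>.\<close>
    define l h where "l = sqrt \<alpha> - \<kappa>" and "h = sqrt \<beta> + \<kappa>"
    have lh: "a < l" "h < b" "l \<le> h" "0 < l"
      using sq[OF \<alpha>\<beta>(1)] sq'[OF \<alpha>\<beta>(3)] \<kappa> a real_sqrt_less_mono[OF \<alpha>\<beta>(2)] unfolding l_def h_def by linarith+
    have r: "0 < sqrt \<alpha>" "(sqrt \<alpha>)\<^sup>2 = \<alpha>" "(sqrt \<beta>)\<^sup>2 = \<beta>" "sqrt \<alpha> \<le> sqrt \<beta>" using \<alpha>0 \<alpha>\<beta>(2) by auto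
    have dist2: "(norm (y - c))\<^sup>2 = \<rho>\<^sup>2 - 2 * \<rho> * \<kappa> * (e \<bullet> w) + \<kappa>\<^sup>2" if "y = \<rho> *\<^sub>R w" "norm w = 1" for y w \<rho>
      using that e unfolding c power2_norm_eq_inner
      by (simp add: inner_diff inner_commute norm_eq_1 power2_eq_square algebra_simps)
    have cgl: "continuous_on (shell l h) g"
      by (rule continuous_on_subset[OF g]) (use lh in \<open>auto simp: shell_def annulus_def\<close>)
    have c\<Psi>: "continuous_on A (\<lambda>y. \<Psi> ((norm (y - c))\<^sup>2))" for A
      by (intro continuous_on_compose2[OF test_fun_cont[OF \<Psi>, of UNIV]] continuous_intros) auto
    have mem: "y \<in> shell l h" if "y - c \<in> shell (sqrt \<alpha>) (sqrt \<beta>)" for y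
      using that norm_triangle_ineq2[of y c] norm_triangle_ineq2[of "y - c" y] norm_triangle_sub[of y c] norm_triangle_sub[of "y - c" y]
      by (auto simp: shell_def l_def h_def \<kappa>_def)
    have out: "\<Psi> ((norm z)\<^sup>2) = 0" if "z \<notin> shell (sqrt \<alpha>) (sqrt \<beta>)" for z :: 'a
    proof (rule test_fun_outside[OF \<Psi>])
      have "norm z \<le> sqrt \<alpha> \<or> sqrt \<beta> \<le> norm z" using that by (auto simp: shell_def)
      then show "(norm z)\<^sup>2 \<le> \<alpha> \<or> \<beta> \<le> (norm z)\<^sup>2"
        using r power_mono[of "norm z" "sqrt \<alpha>" 2] power_mono[of "sqrt \<beta>" "norm z" 2] by auto
    qed
    have "0 = integral {l..h} (\<lambda>\<rho>. \<rho> ^ (?n - 1) * sint (\<lambda>w. g (\<rho> *\<^sub>R w) * \<Psi> (\<rho>\<^sup>2 - 2 * \<rho> * \<kappa> * (e \<bullet> w) + \<kappa>\<^sup>2)))"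
      by (rule coeff_poly_imp_integral_radial_eq_0[symmetric, OF DIM a g e coeffs[OF e] \<kappa> \<kappa>\<alpha> \<alpha>\<beta>(2) \<Psi>])
         (use lh in \<open>auto simp: l_def h_def\<close>)
    also have "\<dots> = integral {l..h} (\<lambda>\<rho>. \<rho> ^ (?n - 1) * sint (\<lambda>w. g (\<rho> *\<^sub>R w) * \<Psi> ((norm (\<rho> *\<^sub>R w - c))\<^sup>2)))"
      by (intro integral_cong arg_cong2[where f="(*)"] refl sint_cong) (simp add: dist2)
    also have "\<dots> = (LINT y:shell l h|lborel. g y * \<Psi> ((norm (y - c))\<^sup>2))"
      by (rule polar_shell(2)[symmetric, OF lh(4)]) (intro continuous_intros cgl c\<Psi>)
    also have "\<dots> = (LINT z|lborel. indicator (shell l h) (c + z) * (g (c + z) * \<Psi> ((norm z)\<^sup>2)))"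
    proof -
      have "(\<lambda>y. indicator (shell l h) y *\<^sub>R (g y * \<Psi> ((norm (y - c))\<^sup>2))) \<in> borel_measurable borel"
        by (intro borel_measurable_continuous_on_indicator borel_compact compact_shell continuous_intros cgl c\<Psi>)
      from lborel_integral_shift[OF this, of c] show ?thesis by (simp add: set_lebesgue_integral_def)
    qed
    also have "\<dots> = (LINT z:shell (sqrt \<alpha>) (sqrt \<beta>)|lborel. \<Psi> ((norm z)\<^sup>2) * g (c + z))"
      unfolding set_lebesgue_integral_def
    proof (rule Bochner_Integration.integral_cong[OF refl])
      fix z :: 'a
      show "indicator (shell l h) (c + z) * (g (c + z) * \<Psi> ((norm z)\<^sup>2)) = indicator (shell (sqrt \<alpha>) (sqrt \<beta>)) z *\<^sub>R (\<Psi> ((norm z)\<^sup>2) * g (c + z))"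
        using mem[of "c + z"] out[of z] by (cases "z \<in> shell (sqrt \<alpha>) (sqrt \<beta>)") simp_all
    qed
    also have "\<dots> = integral {sqrt \<alpha>..sqrt \<beta>} (\<lambda>\<rho>. \<rho> ^ (?n - 1) * (\<Psi> (\<rho>\<^sup>2) * W \<rho>))"
      unfolding W_def by (rule integral_radial_shell[OF cg[OF sq[OF \<alpha>\<beta>(1)] sq'[OF \<alpha>\<beta>(3)]] r(1) test_fun_cont[OF \<Psi>]])
    also have "\<dots> = integral {sqrt \<alpha>..sqrt \<beta>} (\<lambda>\<rho>. \<rho> * (w (\<rho>\<^sup>2) * \<Psi> (\<rho>\<^sup>2)))"
    proof (rule integral_cong)
      fix \<rho> assume "\<rho> \<in> {sqrt \<alpha>..sqrt \<beta>}"
      then have "0 < \<rho>" using r(1) by (simp only: atLeastAtMost_iff) linarith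
      moreover have "?n - 1 = Suc (?n - 2)" using DIM by simp
      ultimately show "\<rho> ^ (?n - 1) * (\<Psi> (\<rho>\<^sup>2) * W \<rho>) = \<rho> * (w (\<rho>\<^sup>2) * \<Psi> (\<rho>\<^sup>2))"
        by (simp add: w_def mult_ac)
    qed
    also have "\<dots> = integral {(sqrt \<alpha>)\<^sup>2..(sqrt \<beta>)\<^sup>2} (\<lambda>u. w u * \<Psi> u) / 2"
      by (rule integral_square_substitution) (use r cw \<alpha>\<beta> test_fun_cont[OF \<Psi>] in \<open>auto intro!: continuous_intros\<close>)
    finally show "integral {\<alpha>..\<beta>} (\<lambda>u. w u * \<Psi> u) = 0" using r by simp
  qed
  then obtain p where "\<forall>i\<ge>0. coeff p i = 0" "\<forall>u. L < u \<and> u < H \<longrightarrow> w u = poly p u" by blast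
  moreover from this(1) have "p = 0" by (simp add: poly_eq_iff)
  ultimately have "w (t\<^sup>2) = 0" using LtH by simp
  then show "sint (\<lambda>w. g (c + t *\<^sub>R w)) = 0" using ab(3) by (simp add: w_def W_def)
qed

section \<open>Geodesic spheres as Euclidean spheres\<close>

lemma tanh_half_hyp_dist_0: "norm x < 1 \<Longrightarrow> tanh (hyp_dist x 0 / 2) = norm x"
  "norm x < 1 \<Longrightarrow> tanh (hyp_dist 0 x / 2) = norm x"
  using tanh_half_hyp_dist[of x 0] tanh_half_hyp_dist[of 0 x] by simp_all

lemma tanh_half_le_1: "tanh_half R \<le> 1"
  using tanh_real_lt_1[of "real_of_ereal R / 2"] by (auto simp: tanh_half_def less_imp_le)

lemma less_iff_tanh_half_less: "x < y \<longleftrightarrow> tanh (x / 2) < tanh (y / 2)" for x y :: real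
  by simp

lemma hyp_annulus_eq_annulus:
  assumes "0 \<le> r" "ereal r < R"
  shows "hyp_annulus r R = annulus (tanh (r / 2)) (tanh_half R)"
proof (intro set_eqI)
  fix x :: 'a
  have "r < hyp_dist x 0 \<longleftrightarrow> tanh (r / 2) < norm x" if "norm x < 1"
    using tanh_half_hyp_dist_0(1)[OF that] by (simp add: less_iff_tanh_half_less[of r])
  moreover have "ereal (hyp_dist x 0) < R \<longleftrightarrow> norm x < tanh_half R" if x: "norm x < 1"
  proof (cases R)
    case (real R')
    then show ?thesis
      using tanh_half_hyp_dist_0(1)[OF x] by (simp add: tanh_half_def less_iff_tanh_half_less[of _ R'])
  qed (use x assms in \<open>auto simp: tanh_half_def\<close>)
  moreover have "norm x < 1" if "norm x < tanh_half R" using that tanh_half_le_1[of R] by linarith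
  ultimately show "x \<in> hyp_annulus r R \<longleftrightarrow> x \<in> annulus (tanh (r / 2)) (tanh_half R)"
    by (auto simp: hyp_annulus_def annulus_def)
qed

context
  fixes x :: "'a::euclidean_space" and s :: real
  assumes x: "norm x < 1" and s: "0 < s"
begin

lemma tanh_half_bounds: "0 < tanh (s / 2)" "tanh (s / 2) < 1" "tanh (s / 2) * norm x < 1"
    "0 < 1 - (tanh (s / 2))\<^sup>2 * (norm x)\<^sup>2"
proof -
  let ?t = "tanh (s / 2)"
  show t: "0 < ?t" "?t < 1" using s tanh_real_lt_1 by simp_all
  have "?t * norm x \<le> 1 * norm x" using t by (intro mult_right_mono) auto
  then show "?t * norm x < 1" using x by simp
  moreover have "0 \<le> ?t * norm x" using t by simp
  ultimately have "(?t * norm x)\<^sup>2 < 1" by (simp add: abs_square_less_1)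
  then show "0 < 1 - ?t\<^sup>2 * (norm x)\<^sup>2" by (simp add: power_mult_distrib)
qed

lemma hyp_sphere_radius_pos: "0 < hyp_sphere_radius x s"
  using tanh_half_bounds x by (simp add: hyp_sphere_radius_def abs_square_less_1)

lemma norm_hyp_sphere_point:
  assumes "norm w = 1"
  shows "norm (hyp_sphere_center x s + hyp_sphere_radius x s *\<^sub>R w) < 1"
proof -
  have "hyp_sphere_center x s + hyp_sphere_radius x s *\<^sub>R w \<in> sphere (hyp_sphere_center x s) (hyp_sphere_radius x s)"
    using assms hyp_sphere_radius_pos by (simp add: dist_norm)
  then have "hyp_sphere_center x s + hyp_sphere_radius x s *\<^sub>R w \<in> hyp_sphere x s"
    by (simp only: hyp_sphere_eq_sphere[OF x s])
  then show ?thesis by (simp add: hyp_sphere_def)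
qed

lemma norm_hyp_sphere_center:
  "norm (hyp_sphere_center x s) = (1 - (tanh (s / 2))\<^sup>2) / (1 - (tanh (s / 2))\<^sup>2 * (norm x)\<^sup>2) * norm x"
  using tanh_half_bounds by (simp add: hyp_sphere_center_def abs_square_le_1)

text \<open>The diameter on the line through the origin and the centre has its ends at signed
  geodesic distances \<open>s \<plusminus> d\<close>, where \<open>d\<close> is the distance of
  \<open>x\<close> from the origin; the right-hand sides are the addition formulas for
  \<open>tanh\<close> at half these values.\<close>

lemma hyp_sphere_endpoints:
  "hyp_sphere_radius x s + norm (hyp_sphere_center x s) = (tanh (s / 2) + norm x) / (1 + tanh (s / 2) * norm x)"
  "hyp_sphere_radius x s - norm (hyp_sphere_center x s) = (tanh (s / 2) - norm x) / (1 - tanh (s / 2) * norm x)"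
proof -
  let ?t = "tanh (s / 2)" and ?a = "norm x"
  have E: "1 - ?t\<^sup>2 * ?a\<^sup>2 = (1 - ?t * ?a) * (1 + ?t * ?a)" by (simp add: power2_eq_square algebra_simps)
  have p: "0 < 1 - ?t * ?a" "0 < 1 + ?t * ?a" using tanh_half_bounds by (auto intro: add_pos_nonneg)
  have "hyp_sphere_radius x s + norm (hyp_sphere_center x s) = ((?t + ?a) * (1 - ?t * ?a)) / ((1 - ?t * ?a) * (1 + ?t * ?a))"
    unfolding norm_hyp_sphere_center hyp_sphere_radius_def E by (simp add: add_divide_distrib[symmetric] power2_eq_square algebra_simps)
  then show "hyp_sphere_radius x s + norm (hyp_sphere_center x s) = (?t + ?a) / (1 + ?t * ?a)" using p by simp
  have "hyp_sphere_radius x s - norm (hyp_sphere_center x s) = ((?t - ?a) * (1 + ?t * ?a)) / ((1 - ?t * ?a) * (1 + ?t * ?a))"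
    unfolding norm_hyp_sphere_center hyp_sphere_radius_def E by (simp add: diff_divide_distrib[symmetric] power2_eq_square algebra_simps)
  then show "hyp_sphere_radius x s - norm (hyp_sphere_center x s) = (?t - ?a) / (1 - ?t * ?a)" using p by simp
qed

text \<open>Completing the square shows that the defining difference of the geodesic ball is the
  positive factor \<open>E\<close> times that of the Euclidean ball, so the two inequalities
  coincide.\<close>

lemma hyp_dist_le_if_in_cball:
  assumes y: "norm y < 1" and d: "norm (y - hyp_sphere_center x s) \<le> hyp_sphere_radius x s"
  shows "hyp_dist x y \<le> s"
proof -
  define t where "t = tanh (s / 2)"
  define E where "E = 1 - t\<^sup>2 * (norm x)\<^sup>2"
  define m where "m = (1 - t\<^sup>2) / E"
  define \<rho> where "\<rho> = hyp_sphere_radius x s"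
  define D where "D = 1 - 2 * (x \<bullet> y) + (norm x)\<^sup>2 * (norm y)\<^sup>2"
  have E: "0 < E" and t: "0 < t" using tanh_half_bounds by (auto simp: E_def t_def)
  have c: "hyp_sphere_center x s = m *\<^sub>R x" by (simp add: hyp_sphere_center_def m_def E_def t_def)
  have m: "m * E = 1 - t\<^sup>2" and r: "\<rho> * E = t * (1 - (norm x)\<^sup>2)"
    using E by (simp_all add: m_def \<rho>_def hyp_sphere_radius_def E_def t_def)
  have N: "(norm (y - m *\<^sub>R x))\<^sup>2 = (norm y)\<^sup>2 - 2 * m * (x \<bullet> y) + m\<^sup>2 * (norm x)\<^sup>2"
    unfolding power2_norm_eq_inner by (simp add: inner_diff inner_commute power2_eq_square)
  have xy: "(norm (x - y))\<^sup>2 = (norm x)\<^sup>2 - 2 * (x \<bullet> y) + (norm y)\<^sup>2"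
    unfolding power2_norm_eq_inner by (simp add: inner_diff inner_commute)
  have "E * ((norm (x - y))\<^sup>2 - t\<^sup>2 * D) = E * (E * ((norm (y - m *\<^sub>R x))\<^sup>2 - \<rho>\<^sup>2))"
  proof -
    have "E * (E * ((norm (y - m *\<^sub>R x))\<^sup>2 - \<rho>\<^sup>2)) = E\<^sup>2 * (norm y)\<^sup>2 - 2 * E * (m * E) * (x \<bullet> y) + (m * E)\<^sup>2 * (norm x)\<^sup>2 - (\<rho> * E)\<^sup>2"
      unfolding N by (simp add: power2_eq_square algebra_simps)
    also have "\<dots> = E * ((norm (x - y))\<^sup>2 - t\<^sup>2 * D)"
      unfolding m r unfolding xy D_def E_def by algebra
    finally show ?thesis ..
  qed
  then have "(norm (x - y))\<^sup>2 - t\<^sup>2 * D = E * ((norm (y - m *\<^sub>R x))\<^sup>2 - \<rho>\<^sup>2)" using E by simp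
  also have "\<dots> \<le> 0"
  proof -
    have "(norm (y - m *\<^sub>R x))\<^sup>2 \<le> \<rho>\<^sup>2" using d unfolding c \<rho>_def by (intro power_mono) auto
    then show ?thesis using E by (simp add: mult_nonneg_nonpos)
  qed
  finally have le: "(norm (x - y))\<^sup>2 \<le> t\<^sup>2 * D" by simp
  have D: "0 < D" unfolding D_def by (rule hyp_quotient(2)[OF x y])
  have "norm (x - y) \<le> t * sqrt D"
  proof (rule power2_le_imp_le)
    show "(norm (x - y))\<^sup>2 \<le> (t * sqrt D)\<^sup>2" using le D by (simp add: power_mult_distrib)
  qed (use t D in simp)
  then have "norm (x - y) / sqrt D \<le> t" using D by (simp add: field_simps)
  then have "tanh (hyp_dist x y / 2) \<le> tanh (s / 2)"
    unfolding tanh_half_hyp_dist[OF x y] D_def t_def .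
  then show ?thesis by simp
qed

end

lemma tanh_add_real: "tanh (x + y) = (tanh x + tanh y) / (1 + tanh x * tanh y)" for x y :: real
  by (rule tanh_add) (use cosh_real_pos[of x] cosh_real_pos[of y] in auto)

text \<open>The model on the real line supplies the preimage: half the geodesic distance from
  \<open>u\<close> to 0.\<close>

lemma tanh_surj:
  assumes "0 \<le> u" "u < 1"
  obtains p :: real where "tanh p = u"
  using tanh_half_hyp_dist_0(1)[of u] assms by force

text \<open>The ends of the diameter through the origin determine the sphere. With \<open>p\<close>
  and \<open>q\<close> the inverse hyperbolic tangents of \<open>t + norm c\<close> and
  \<open>t - norm c\<close>, the geodesic radius is \<open>p + q\<close> and the geodesic centre
  lies at distance \<open>p - q\<close> from the origin.\<close>

lemma ex_hyp_sphere:
  fixes c :: "'a::euclidean_space"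
  assumes "norm c < t" "t + norm c < 1"
  shows "\<exists>x s. norm x < 1 \<and> 0 < s \<and> hyp_sphere_center x s = c \<and> hyp_sphere_radius x s = t"
proof -
  obtain p where p: "tanh p = t + norm c" by (rule tanh_surj[of "t + norm c"]) (use assms norm_ge_zero[of c] in linarith)+
  obtain q where q: "tanh q = t - norm c" by (rule tanh_surj[of "t - norm c"]) (use assms norm_ge_zero[of c] in linarith)+
  have q0: "0 < q" using q assms by (metis diff_gt_0_iff_gt tanh_real_pos_iff)
  have "tanh q \<le> tanh p" unfolding p q using norm_ge_zero[of c] by linarith
  then have pq: "q \<le> p" by simp
  define s where "s = p + q"
  define A where "A = tanh ((p - q) / 2)"
  define T where "T = tanh (s / 2)"
  have s: "0 < s" using q0 pq by (simp add: s_def)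
  have A: "0 \<le> A" "A < 1" using pq tanh_real_lt_1 by (auto simp: A_def)
  obtain e where e: "norm e = 1" "c = norm c *\<^sub>R e" by (rule unit_vector_cases)
  define x where "x = A *\<^sub>R e"
  have nx: "norm x = A" using A e by (simp add: x_def)
  have x1: "norm x < 1" using A nx by simp
  have 1: "hyp_sphere_radius x s + norm (hyp_sphere_center x s) = t + norm c"
  proof -
    have "p = s / 2 + (p - q) / 2" by (simp add: s_def field_simps)
    then have "tanh p = (T + A) / (1 + T * A)" using tanh_add_real[of "s / 2" "(p - q) / 2"] by (simp add: T_def A_def)
    then show ?thesis using hyp_sphere_endpoints(1)[OF x1 s] p by (simp add: nx T_def)
  qed
  have 2: "hyp_sphere_radius x s - norm (hyp_sphere_center x s) = t - norm c"
  proof -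
    have "q = s / 2 + - ((p - q) / 2)" by (simp add: s_def field_simps)
    then have "tanh q = (T - A) / (1 - T * A)" using tanh_add_real[of "s / 2" "- ((p - q) / 2)"] by (simp add: T_def A_def)
    then show ?thesis using hyp_sphere_endpoints(2)[OF x1 s] q by (simp add: nx T_def)
  qed
  have rad: "hyp_sphere_radius x s = t" and cen: "norm (hyp_sphere_center x s) = norm c"
    using 1 2 by linarith+
  have "hyp_sphere_center x s = norm (hyp_sphere_center x s) *\<^sub>R e"
    unfolding norm_hyp_sphere_center[OF x1 s] nx by (simp add: hyp_sphere_center_def x_def e(1))
  then have "hyp_sphere_center x s = c" using cen e(2) by simp
  with rad x1 s show ?thesis by blast
qed

text \<open>Lying in the annulus only gives a bound on the absolute value of
  \<open>norm c - t\<close>; the sphere could also sit beside the hole. The inclusion of balls fixes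
  the sign.\<close>

lemma admissible_hyp_sphere:
  fixes x :: "'a::euclidean_space"
  assumes r: "0 \<le> r" "ereal r < R" and x: "norm x < 1" and s: "0 < s"
  defines "c \<equiv> hyp_sphere_center x s" and "t \<equiv> hyp_sphere_radius x s"
  shows "hyp_sphere x s \<subseteq> hyp_annulus r R \<and> hyp_cball 0 r \<subseteq> hyp_cball x s \<longleftrightarrow>
    tanh (r / 2) + norm c < t \<and> t < tanh_half R - norm c"
proof
  let ?a = "tanh (r / 2)" and ?b = "tanh_half R"
  note sphere = hyp_sphere_eq_sphere[OF x s, folded c_def t_def]
  have t0: "0 < t" unfolding t_def by (rule hyp_sphere_radius_pos[OF x s])
  assume A: "hyp_sphere x s \<subseteq> hyp_annulus r R \<and> hyp_cball 0 r \<subseteq> hyp_cball x s"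
  then have sub: "sphere c t \<subseteq> annulus ?a ?b" using sphere hyp_annulus_eq_annulus[OF r] by metis
  obtain e where e: "norm e = 1" "c = norm c *\<^sub>R e" by (rule unit_vector_cases)
  \<comment> \<open>The points of the sphere farthest from and nearest to the origin.\<close>
  have "c + t *\<^sub>R e \<in> sphere c t" "c - t *\<^sub>R e \<in> sphere c t" using e t0 by (simp_all add: dist_norm)
  then have m: "c + t *\<^sub>R e \<in> annulus ?a ?b" "c - t *\<^sub>R e \<in> annulus ?a ?b" using sub by auto
  have "norm (c + t *\<^sub>R e) = norm c + t"
  proof -
    have "c + t *\<^sub>R e = (norm c + t) *\<^sub>R e" using e(2) by (metis scaleR_add_left)
    then show ?thesis using e(1) t0 by simp
  qed
  with m(1) have 1: "norm c + t < ?b" by (simp add: annulus_def)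
  have "norm (c - t *\<^sub>R e) = \<bar>norm c - t\<bar>"
  proof -
    have "c - t *\<^sub>R e = (norm c - t) *\<^sub>R e" using e(2) by (metis scaleR_diff_left)
    then show ?thesis using e(1) by simp
  qed
  with m(2) have 2: "?a < \<bar>norm c - t\<bar>" by (simp add: annulus_def)
  \<comment> \<open>That the origin lies in the geodesic ball about \<open>x\<close> yields
    \<open>norm x \<le> tanh (s / 2)\<close>, hence \<open>norm c \<le> t\<close>.\<close>
  have "hyp_dist 0 (0::'a) = 0" by (simp add: hyp_dist_def artanh_def)
  then have "0 \<in> hyp_cball (0::'a) r" using r by (simp add: hyp_cball_def)
  with A have "0 \<in> hyp_cball x s" by blast
  then have "hyp_dist x 0 \<le> s" by (simp add: hyp_cball_def)
  then have "norm x \<le> tanh (s / 2)" using tanh_half_hyp_dist_0(1)[OF x] by (metis divide_right_mono tanh_real_le_iff zero_le_numeral)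
  then have "0 \<le> t - norm c"
    unfolding t_def c_def hyp_sphere_endpoints(2)[OF x s] using tanh_half_bounds[OF x s] by simp
  with 1 2 show "?a + norm c < t \<and> t < ?b - norm c" by simp
next
  let ?a = "tanh (r / 2)" and ?b = "tanh_half R"
  note sphere = hyp_sphere_eq_sphere[OF x s, folded c_def t_def]
  assume A: "?a + norm c < t \<and> t < ?b - norm c"
  have "sphere c t \<subseteq> annulus ?a ?b"
  proof
    fix y assume "y \<in> sphere c t"
    then have "norm (y - c) = t" by (simp add: dist_norm norm_minus_commute)
    then show "y \<in> annulus ?a ?b"
      using A norm_triangle_sub[of y c] norm_triangle_ineq4[of y c] by (auto simp: annulus_def)
  qed
  moreover have "hyp_cball 0 r \<subseteq> hyp_cball x s"
  proof
    fix y :: 'a assume "y \<in> hyp_cball 0 r"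
    then have y: "norm y < 1" "hyp_dist 0 y \<le> r" by (auto simp: hyp_cball_def)
    then have "norm y \<le> ?a" using tanh_half_hyp_dist_0(2)[OF y(1)] by (metis divide_right_mono tanh_real_le_iff zero_le_numeral)
    then have "norm (y - c) \<le> t" using A norm_triangle_ineq4[of y c] by linarith
    then show "y \<in> hyp_cball x s" using hyp_dist_le_if_in_cball[OF x s y(1)] y(1) by (simp add: hyp_cball_def c_def t_def)
  qed
  ultimately show "hyp_sphere x s \<subseteq> hyp_annulus r R \<and> hyp_cball 0 r \<subseteq> hyp_cball x s"
    using sphere hyp_annulus_eq_annulus[OF r] by metis
qed

section \<open>Integrals over geodesic spheres in Euclidean form\<close>

definition csint :: "('a::euclidean_space \<Rightarrow> complex) \<Rightarrow> complex" where
  "csint \<phi> = (LINT w:sphere 0 1|sphere_measure 0 1. \<phi> w)"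

lemma csint_cong: "(\<And>w. norm w = 1 \<Longrightarrow> \<phi> w = \<psi> w) \<Longrightarrow> csint \<phi> = csint \<psi>"
  unfolding csint_def by (intro set_lebesgue_integral_cong) auto

lemma csint_cmult: "csint (\<lambda>w. c * \<phi> w) = c * csint \<phi>"
  unfolding csint_def by (rule set_integral_mult_right)

lemma csint_sum:
  assumes "\<And>i. i \<in> I \<Longrightarrow> continuous_on (sphere 0 1) (\<phi> i)"
  shows "csint (\<lambda>w. \<Sum>i\<in>I. \<phi> i w) = (\<Sum>i\<in>I. csint (\<phi> i))"
  using assms
proof (induction I rule: infinite_finite_induct)
  case (insert i I)
  then show ?case
    by (simp add: csint_def set_integral_add set_integrable_sphere continuous_on_sum)
qed (simp_all add: csint_def)

lemma Re_Im_csint: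
  assumes "continuous_on (sphere 0 1) \<phi>"
  shows "Re (csint \<phi>) = sint (\<lambda>w. Re (\<phi> w))" "Im (csint \<phi>) = sint (\<lambda>w. Im (\<phi> w))"
proof -
  have i: "integrable (sphere_measure 0 1) (\<lambda>w. indicator (sphere 0 1) w *\<^sub>R \<phi> w)"
    using set_integrable_sphere[OF assms] by (simp add: set_integrable_def)
  show "Re (csint \<phi>) = sint (\<lambda>w. Re (\<phi> w))"
    using integral_Re[OF i] by (simp add: csint_def sint_def set_lebesgue_integral_def)
  show "Im (csint \<phi>) = sint (\<lambda>w. Im (\<phi> w))"
    using integral_Im[OF i] by (simp add: csint_def sint_def set_lebesgue_integral_def)
qed

lemma sphere_measure_eq:
  fixes c :: "'a::euclidean_space"
  assumes t: "0 < t"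
  shows "sphere_measure c t = density (distr (sphere_measure 0 1) borel (\<lambda>w. c + t *\<^sub>R w)) (\<lambda>_. ennreal (t ^ (DIM('a) - 1)))"
proof -
  define \<kappa> where "\<kappa> = density lborel (\<lambda>x::'a. ennreal (real DIM('a)) * indicator (ball 0 1) x)"
  have [measurable_cong]: "sets \<kappa> = sets borel" by (simp add: \<kappa>_def)
  have m: "(\<lambda>x::'a. ennreal (real DIM('a)) * indicator (ball 0 1) x) \<in> borel_measurable borel"
    by (intro borel_measurable_times_ennreal borel_measurable_indicator) auto
  have S: "sphere_measure 0 1 = distr \<kappa> borel sgn"
    by (simp add: sphere_measure_def \<kappa>_def)
  have "density lborel (\<lambda>x::'a. ennreal (t ^ (DIM('a) - 1) * real DIM('a)) * indicator (ball 0 1) x) = density \<kappa> (\<lambda>_. ennreal (t ^ (DIM('a) - 1)))"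
    unfolding \<kappa>_def using m t by (subst density_density_eq) (auto simp: ennreal_mult mult_ac)
  then have "sphere_measure c t = distr (density \<kappa> (\<lambda>_. ennreal (t ^ (DIM('a) - 1)))) borel (\<lambda>x. c + t *\<^sub>R sgn x)"
    by (simp add: sphere_measure_def)
  also have "\<dots> = density (distr \<kappa> borel (\<lambda>x. c + t *\<^sub>R sgn x)) (\<lambda>_. ennreal (t ^ (DIM('a) - 1)))"
    by (subst density_distr) auto
  also have "distr \<kappa> borel (\<lambda>x. c + t *\<^sub>R sgn x) = distr (sphere_measure 0 1) borel (\<lambda>w. c + t *\<^sub>R w)"
    unfolding S by (subst distr_distr) (auto simp: o_def)
  finally show ?thesis .
qed

lemma integral_hyp_sphere:
  fixes x :: "'a::euclidean_space" and \<phi> :: "'a \<Rightarrow> 'b::{banach, second_countable_topology}"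
  assumes x: "norm x < 1" and s: "0 < s" and \<phi>: "continuous_on (hyp_sphere x s) \<phi>"
  defines "c \<equiv> hyp_sphere_center x s" and "t \<equiv> hyp_sphere_radius x s"
  shows "(LINT y:hyp_sphere x s|hyp_sphere_measure x s. \<phi> y) =
    (LINT w:sphere 0 1|sphere_measure 0 1. (t * conf_factor (c + t *\<^sub>R w)) ^ (DIM('a) - 1) *\<^sub>R \<phi> (c + t *\<^sub>R w))"
proof -
  let ?n = "DIM('a) - 1" and ?\<sigma> = "sphere_measure (0::'a) 1"
  note sphere = hyp_sphere_eq_sphere[OF x s, folded c_def t_def]
  have t: "0 < t" unfolding t_def by (rule hyp_sphere_radius_pos[OF x s])
  have mc[measurable]: "conf_factor \<in> borel_measurable (borel :: 'a measure)"
    unfolding conf_factor_def by measurable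
  define h where "h y = indicator (sphere c t) y *\<^sub>R \<phi> y" for y
  have mh[measurable]: "h \<in> borel_measurable borel"
    unfolding h_def using \<phi> sphere by (intro borel_measurable_continuous_on_indicator) auto
  have mT[measurable]: "(\<lambda>w. c + t *\<^sub>R w) \<in> borel \<rightarrow>\<^sub>M borel" by measurable
  let ?D = "distr ?\<sigma> borel (\<lambda>w. c + t *\<^sub>R w)"
  have M: "hyp_sphere_measure x s = density ?D (\<lambda>y. ennreal (t ^ ?n) * ennreal (conf_factor y ^ ?n))"
    unfolding hyp_sphere_measure_def c_def[symmetric] t_def[symmetric] sphere_measure_eq[OF t]
    by (subst density_density_eq) auto
  have pos: "0 \<le> conf_factor y" if "norm y < 1" for y :: 'a
    using that by (simp add: conf_factor_def abs_square_le_1)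
  have in_ball: "norm (c + t *\<^sub>R w) < 1" if "norm w = 1" for w
    using norm_hyp_sphere_point[OF x s that] by (simp add: c_def t_def)
  have AE1: "AE w in ?\<sigma>. norm w = 1" using AE_sphere_measure[where 'a='a] by simp
  \<comment> \<open>The conformal factor is negative outside the closed ball; truncation at 0 gives
    a globally nonnegative real density and changes nothing on the sphere itself.\<close>
  have M': "hyp_sphere_measure x s = density ?D (\<lambda>y. ennreal (max 0 (t * conf_factor y) ^ ?n))"
    unfolding M
  proof (rule density_cong)
    show "AE y in ?D. ennreal (t ^ ?n) * ennreal (conf_factor y ^ ?n) = ennreal (max 0 (t * conf_factor y) ^ ?n)"
    proof (subst AE_distr_iff)
      show "AE w in ?\<sigma>. ennreal (t ^ ?n) * ennreal (conf_factor (c + t *\<^sub>R w) ^ ?n) = ennreal (max 0 (t * conf_factor (c + t *\<^sub>R w)) ^ ?n)"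
        using AE1
      proof eventually_elim
        case (elim w)
        show ?case using pos[OF in_ball[OF elim]] t
          by (simp add: max_absorb2 power_mult_distrib ennreal_mult)
      qed
    qed simp_all
  qed simp_all
  have "(LINT y:hyp_sphere x s|hyp_sphere_measure x s. \<phi> y) = (LINT y|hyp_sphere_measure x s. h y)"
    by (simp add: set_lebesgue_integral_def h_def sphere)
  also have "\<dots> = (LINT y|?D. (max 0 (t * conf_factor y) ^ ?n) *\<^sub>R h y)"
    unfolding M' by (rule integral_density) auto
  also have "\<dots> = (LINT w|?\<sigma>. (max 0 (t * conf_factor (c + t *\<^sub>R w)) ^ ?n) *\<^sub>R h (c + t *\<^sub>R w))"
    by (rule integral_distr) measurable
  also have "\<dots> = (LINT w|?\<sigma>. indicator (sphere 0 1) w *\<^sub>R ((t * conf_factor (c + t *\<^sub>R w)) ^ ?n *\<^sub>R \<phi> (c + t *\<^sub>R w)))"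
  proof (rule Bochner_Integration.integral_cong[OF refl])
    fix w :: 'a
    have "c + t *\<^sub>R w \<in> sphere c t \<longleftrightarrow> norm w = 1" using t by (simp add: dist_norm)
    then show "(max 0 (t * conf_factor (c + t *\<^sub>R w)) ^ ?n) *\<^sub>R h (c + t *\<^sub>R w) = indicator (sphere 0 1) w *\<^sub>R ((t * conf_factor (c + t *\<^sub>R w)) ^ ?n *\<^sub>R \<phi> (c + t *\<^sub>R w))"
      using pos[OF in_ball, of w] t by (auto simp: h_def indicator_def max_absorb2)
  qed
  finally show ?thesis by (simp add: set_lebesgue_integral_def)
qed

definition euclid_weight :: "('a::euclidean_space \<Rightarrow> complex) \<Rightarrow> 'a \<Rightarrow> complex" where
  "euclid_weight f y = f y / complex_of_real ((1 - (norm y)\<^sup>2) ^ (DIM('a) - 1))"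

text \<open>The numerator is \<open>(2 * t) ^ (n - 1)\<close> times the Euclidean integral of the
  weighted function. The area is positive because the conformal factor is at least 2 in the ball;
  otherwise division by zero would make the mean vanish trivially.\<close>

lemma sph_mean_eq_0_iff:
  fixes x :: "'a::euclidean_space"
  assumes x: "norm x < 1" and s: "0 < s" and f: "continuous_on (hyp_sphere x s) f"
  shows "sph_mean s f x = 0 \<longleftrightarrow> csint (\<lambda>w. euclid_weight f (hyp_sphere_center x s + hyp_sphere_radius x s *\<^sub>R w)) = 0"
proof -
  define c t where "c = hyp_sphere_center x s" and "t = hyp_sphere_radius x s"
  note sphere = hyp_sphere_eq_sphere[OF x s, folded c_def t_def]
  let ?n = "DIM('a) - 1"
  have t: "0 < t" unfolding t_def by (rule hyp_sphere_radius_pos[OF x s])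
  have in_ball: "norm (c + t *\<^sub>R w) < 1" if "norm w = 1" for w
    using norm_hyp_sphere_point[OF x s that] by (simp add: c_def t_def)
  have nz: "(norm (c + t *\<^sub>R w))\<^sup>2 < 1" if "norm w = 1" for w
    using in_ball[OF that] by (simp add: abs_square_less_1)
  have "(LINT y:hyp_sphere x s|hyp_sphere_measure x s. f y) = csint (\<lambda>w. (t * conf_factor (c + t *\<^sub>R w)) ^ ?n *\<^sub>R f (c + t *\<^sub>R w))"
    unfolding csint_def c_def t_def by (rule integral_hyp_sphere[OF x s f])
  also have "\<dots> = csint (\<lambda>w. complex_of_real ((2 * t) ^ ?n) * euclid_weight f (c + t *\<^sub>R w))"
    by (rule csint_cong) (simp add: euclid_weight_def conf_factor_def scaleR_conv_of_real power_divide power_mult_distrib)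
  finally have I: "(LINT y:hyp_sphere x s|hyp_sphere_measure x s. f y) = complex_of_real ((2 * t) ^ ?n) * csint (\<lambda>w. euclid_weight f (c + t *\<^sub>R w))"
    by (simp only: csint_cmult)
  have "measure (hyp_sphere_measure x s) (hyp_sphere x s) = (LINT y:hyp_sphere x s|hyp_sphere_measure x s. 1)"
    by (simp add: set_lebesgue_integral_def sphere hyp_sphere_measure_def)
  also have "\<dots> = sint (\<lambda>w. (t * conf_factor (c + t *\<^sub>R w)) ^ ?n)"
    using integral_hyp_sphere[OF x s, of "\<lambda>_. 1::real"] by (simp add: sint_def c_def t_def)
  also have "\<dots> > 0"
  proof -
    have cc: "continuous_on (sphere 0 1) (\<lambda>w. (t * conf_factor (c + t *\<^sub>R w)) ^ ?n)"
      unfolding conf_factor_def by (intro continuous_intros) (use nz in force)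
    have "0 < (2 * t) ^ ?n * sint (\<lambda>w::'a. 1)" using t sint_1_pos[where 'a='a] by simp
    also have "\<dots> = sint (\<lambda>w::'a. (2 * t) ^ ?n * 1)" by (simp only: sint_cmult)
    also have "\<dots> \<le> sint (\<lambda>w. (t * conf_factor (c + t *\<^sub>R w)) ^ ?n)"
    proof (rule sint_mono[OF _ cc])
      fix w :: 'a assume "norm w = 1"
      then have "2 \<le> conf_factor (c + t *\<^sub>R w)"
        using nz[of w] zero_le_power2[of "norm (c + t *\<^sub>R w)"] by (simp add: conf_factor_def pos_le_divide_eq)
      then show "(2 * t) ^ ?n * 1 \<le> (t * conf_factor (c + t *\<^sub>R w)) ^ ?n"
        unfolding mult_1_right using t by (intro power_mono) auto
    qed (intro continuous_intros)
    finally show ?thesis .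
  qed
  finally have "measure (hyp_sphere_measure x s) (hyp_sphere x s) \<noteq> 0" by simp
  then show ?thesis using t by (simp add: sph_mean_def I c_def t_def)
qed

lemma continuous_on_euclid_weight:
  assumes f: "continuous_on (annulus a b) f" and b: "b \<le> 1"
  shows "continuous_on (annulus a b) (euclid_weight f)"
  unfolding euclid_weight_def
proof (intro continuous_intros f ballI)
  fix y :: 'a assume "y \<in> annulus a b"
  then have "norm y < 1" using b by (simp add: annulus_def)
  then have "(norm y)\<^sup>2 < 1" by (simp add: abs_square_less_1)
  then have "(1 - (norm y)\<^sup>2) ^ (DIM('a) - 1) \<noteq> 0" by simp
  then show "complex_of_real ((1 - (norm y)\<^sup>2) ^ (DIM('a) - 1)) \<noteq> 0" by (simp only: of_real_eq_0_iff not_False_eq_True)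
qed

text \<open>Admissible geodesic spheres are exactly the Euclidean spheres with
  \<open>a + norm c < t < b - norm c\<close>. Real and imaginary parts are separated since the
  orthogonality arguments are for real functions.\<close>

lemma Z_class_iff:
  fixes f :: "'a::euclidean_space \<Rightarrow> complex"
  assumes r: "0 \<le> r" "ereal r < R" and f: "continuous_on (hyp_annulus r R) f"
  shows "f \<in> Z_class r R \<longleftrightarrow>
    zero_sphere_means (tanh (r / 2)) (tanh_half R) (\<lambda>y. Re (euclid_weight f y)) \<and>
    zero_sphere_means (tanh (r / 2)) (tanh_half R) (\<lambda>y. Im (euclid_weight f y))"
proof -
  let ?a = "tanh (r / 2)" and ?b = "tanh_half R" and ?g = "euclid_weight f"
  note ann = hyp_annulus_eq_annulus[OF r, where 'a='a]
  have cg: "continuous_on (annulus ?a ?b) ?g"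
    using f ann tanh_half_le_1 by (intro continuous_on_euclid_weight) auto
  have key: "csint (\<lambda>w. ?g (c + t *\<^sub>R w)) = 0 \<longleftrightarrow>
      sint (\<lambda>w. Re (?g (c + t *\<^sub>R w))) = 0 \<and> sint (\<lambda>w. Im (?g (c + t *\<^sub>R w))) = 0"
    if ct: "?a + norm c < t" "t < ?b - norm c" for c t
  proof -
    have "0 \<le> ?a" using r by simp
    then have "0 < t" using ct(1) norm_ge_zero[of c] by linarith
    have "continuous_on (sphere 0 1) (\<lambda>w. ?g (c + t *\<^sub>R w))"
    proof (rule continuous_on_compose2[OF cg])
      show "(\<lambda>w. c + t *\<^sub>R w) ` sphere 0 1 \<subseteq> annulus ?a ?b"
        using shell_translate_subset_annulus[OF ct(1), of t ?b] ct(2) \<open>0 < t\<close> by (force simp: shell_def)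
    qed (intro continuous_intros)
    from Re_Im_csint[OF this] show ?thesis by (simp add: complex_eq_iff)
  qed
  have "f \<in> Z_class r R \<longleftrightarrow> (\<forall>c t. ?a + norm c < t \<and> t < ?b - norm c \<longrightarrow> csint (\<lambda>w. ?g (c + t *\<^sub>R w)) = 0)"
  proof
    assume Z: "f \<in> Z_class r R"
    show "\<forall>c t. ?a + norm c < t \<and> t < ?b - norm c \<longrightarrow> csint (\<lambda>w. ?g (c + t *\<^sub>R w)) = 0"
    proof (intro allI impI)
      fix c :: 'a and t assume ct: "?a + norm c < t \<and> t < ?b - norm c"
      have "0 \<le> ?a" "?b \<le> 1" using r tanh_half_le_1 by auto
      then have "norm c < t" "t + norm c < 1" using ct r by linarith+
      from ex_hyp_sphere[OF this] obtain x s where x: "norm x < 1" "0 < s"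
        and cen: "hyp_sphere_center x s = c" "hyp_sphere_radius x s = t" by blast
      have adm: "hyp_sphere x s \<subseteq> hyp_annulus r R \<and> hyp_cball 0 r \<subseteq> hyp_cball x s"
        using admissible_hyp_sphere[OF r x] ct cen by simp
      then have "sph_mean s f x = 0" using Z x by (auto simp: Z_class_def)
      then show "csint (\<lambda>w. ?g (c + t *\<^sub>R w)) = 0"
        using sph_mean_eq_0_iff[OF x continuous_on_subset[OF f]] adm cen by simp
    qed
  next
    assume Z: "\<forall>c t. ?a + norm c < t \<and> t < ?b - norm c \<longrightarrow> csint (\<lambda>w. ?g (c + t *\<^sub>R w)) = 0"
    show "f \<in> Z_class r R"
      unfolding Z_class_def
    proof (intro CollectI conjI f allI impI ballI)
      fix s :: real and x :: 'a assume s: "0 < s" and "x \<in> ball 0 1"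
        and adm: "hyp_sphere x s \<subseteq> hyp_annulus r R \<and> hyp_cball 0 r \<subseteq> hyp_cball x s"
      then have x: "norm x < 1" by simp
      show "sph_mean s f x = 0"
        using sph_mean_eq_0_iff[OF x s continuous_on_subset[OF f]] adm admissible_hyp_sphere[OF r x s] Z by simp
    qed
  qed
  then show ?thesis unfolding zero_sphere_means_def using key by blast
qed

lemma sph_inner_eq:
  fixes \<phi> \<psi> :: "'a::euclidean_space \<Rightarrow> complex"
  assumes "continuous_on (sphere 0 1) (\<lambda>w. \<phi> w * cnj (\<psi> w))"
  shows "sph_inner \<phi> \<psi> = csint (\<lambda>w. \<phi> w * cnj (\<psi> w)) / complex_of_real (sint (\<lambda>w::'a. 1))"
proof -
  let ?\<sigma> = "sphere_measure (0::'a) 1"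
  interpret finite_measure ?\<sigma> by (rule finite_sphere_measure)
  define h where "h w = indicator (sphere 0 1) w *\<^sub>R (\<phi> w * cnj (\<psi> w))" for w
  have mh: "h \<in> borel_measurable borel"
    unfolding h_def by (intro borel_measurable_continuous_on_indicator assms) auto
  have S: "sint (\<lambda>w::'a. 1) = measure ?\<sigma> (sphere 0 1)"
    by (simp add: sint_def set_lebesgue_integral_def)
  have "unit_sphere_measure = density ?\<sigma> (\<lambda>w. ennreal (indicator (sphere 0 1) w / measure ?\<sigma> (sphere 0 1)))"
    unfolding unit_sphere_measure_def uniform_measure_def
    using sint_1_pos[where 'a='a] S
    by (intro density_cong) (auto simp: emeasure_eq_measure divide_ennreal[symmetric] indicator_def)
  then have "sph_inner \<phi> \<psi> = (LINT w|density ?\<sigma> (\<lambda>w. ennreal (indicator (sphere 0 1) w / measure ?\<sigma> (sphere 0 1))). h w)"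
    by (simp add: sph_inner_def set_lebesgue_integral_def h_def)
  also have "\<dots> = (LINT w|?\<sigma>. (indicator (sphere 0 1) w / measure ?\<sigma> (sphere 0 1)) *\<^sub>R h w)"
    using mh by (intro integral_density) (auto intro!: borel_measurable_divide borel_measurable_indicator)
  also have "\<dots> = (LINT w|?\<sigma>. h w / complex_of_real (measure ?\<sigma> (sphere 0 1)))"
    by (intro Bochner_Integration.integral_cong[OF refl]) (auto simp: h_def indicator_def scaleR_conv_of_real divide_inverse)
  also have "\<dots> = csint (\<lambda>w. \<phi> w * cnj (\<psi> w)) / complex_of_real (measure ?\<sigma> (sphere 0 1))"
    by (simp add: csint_def set_lebesgue_integral_def h_def)
  finally show ?thesis unfolding S .
qed

section \<open>Homogeneous polynomials and zonal harmonic polynomials\<close>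

lemma hom_poly_zero: "hom_poly k (\<lambda>x. 0)"
proof (induction k)
  case 0
  show ?case by (rule hom_poly.const)
next
  case (Suc k)
  from hom_poly.mult[OF this, of 0] show ?case by simp
qed

lemma hom_poly_cmult: "hom_poly k P \<Longrightarrow> hom_poly k (\<lambda>x. c * P x)"
proof (induction rule: hom_poly.induct)
  case (const d)
  show ?case by (rule hom_poly.const)
next
  case (mult k P v)
  from hom_poly.mult[OF mult.IH, of v] show ?case by (simp add: mult.left_commute)
next
  case (add k P Q)
  from hom_poly.add[OF add.IH] show ?case by (simp add: distrib_left)
qed

lemma hom_poly_mult: "hom_poly k P \<Longrightarrow> hom_poly l Q \<Longrightarrow> hom_poly (k + l) (\<lambda>x. P x * Q x)"
proof (induction rule: hom_poly.induct)
  case (const c)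
  then show ?case by (simp add: hom_poly_cmult)
next
  case (mult k P v)
  from hom_poly.mult[OF mult.IH[OF mult.prems], of v] show ?case by (simp add: mult.assoc)
next
  case (add k P Q')
  from hom_poly.add[OF add.IH(1)[OF add.prems] add.IH(2)[OF add.prems]] show ?case by (simp add: distrib_right)
qed

text \<open>An intermediate class closed under all polynomial operations, from which a single
  homogeneous component can be extracted.\<close>

definition sum_hom_poly :: "('a::euclidean_space \<Rightarrow> real) \<Rightarrow> bool" where
  "sum_hom_poly p \<longleftrightarrow> (\<exists>P N. (\<forall>d. hom_poly d (P d)) \<and> (\<forall>x. p x = (\<Sum>d\<le>N. P d x)))"

lemma sum_hom_poly_single:
  assumes "hom_poly k P"
  shows "sum_hom_poly P"
proof -
  have "hom_poly d (if d = k then P else (\<lambda>x. 0))" for d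
    using assms hom_poly_zero by auto
  moreover have "P x = (\<Sum>d\<le>k. (if d = k then P else (\<lambda>x. 0)) x)" for x
    by (subst sum.remove[of _ k]) auto
  ultimately show ?thesis unfolding sum_hom_poly_def by (intro exI[of _ "\<lambda>d. if d = k then P else (\<lambda>x. 0)"] exI[of _ k]) blast
qed

lemma sum_hom_poly_add:
  assumes "sum_hom_poly p" "sum_hom_poly q"
  shows "sum_hom_poly (\<lambda>x. p x + q x)"
proof -
  have ext: "\<exists>P N0. (\<forall>d. hom_poly d (P d)) \<and> (\<forall>N\<ge>N0. \<forall>x. p x = (\<Sum>d\<le>N. P d x))" if p: "sum_hom_poly p" for p :: "'a \<Rightarrow> real"
  proof -
    from p obtain P N0 where P: "\<And>d. hom_poly d (P d)" "\<And>x. p x = (\<Sum>d\<le>N0. P d x)" unfolding sum_hom_poly_def by blast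
    define P' where "P' d = (if d \<le> N0 then P d else (\<lambda>x. 0))" for d
    have "hom_poly d (P' d)" for d using P(1) by (simp add: P'_def hom_poly_zero)
    moreover have "p x = (\<Sum>d\<le>N. P' d x)" if "N0 \<le> N" for N x
      unfolding P(2) using that by (intro sum.mono_neutral_cong_left) (auto simp: P'_def)
    ultimately show ?thesis by blast
  qed
  obtain P N1 where P: "\<And>d. hom_poly d (P d)" "\<And>N x. N1 \<le> N \<Longrightarrow> p x = (\<Sum>d\<le>N. P d x)"
    using ext[OF assms(1)] by blast
  obtain Q N2 where Q: "\<And>d. hom_poly d (Q d)" "\<And>N x. N2 \<le> N \<Longrightarrow> q x = (\<Sum>d\<le>N. Q d x)"
    using ext[OF assms(2)] by blast
  show ?thesis
    unfolding sum_hom_poly_def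
  proof (intro exI conjI allI)
    show "hom_poly d (\<lambda>x. P d x + Q d x)" for d by (intro hom_poly.add P Q)
    show "p x + q x = (\<Sum>d\<le>max N1 N2. P d x + Q d x)" for x
      using P(2)[of "max N1 N2" x] Q(2)[of "max N1 N2" x] by (simp add: sum.distrib)
  qed
qed

lemma sum_hom_poly_sum:
  assumes "\<And>i. i \<in> I \<Longrightarrow> sum_hom_poly (p i)" "finite I"
  shows "sum_hom_poly (\<lambda>x. \<Sum>i\<in>I. p i x)"
  using assms(2,1) by (induction I) (auto intro: sum_hom_poly_add sum_hom_poly_single[OF hom_poly_zero])

lemma sum_hom_poly_mult:
  assumes "sum_hom_poly p" "sum_hom_poly q"
  shows "sum_hom_poly (\<lambda>x. p x * q x)"
proof -
  from assms obtain P N Q M where "\<And>d. hom_poly d (P d)" "\<And>x. p x = (\<Sum>d\<le>N. P d x)"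
    "\<And>d. hom_poly d (Q d)" "\<And>x. q x = (\<Sum>d\<le>M. Q d x)"
    unfolding sum_hom_poly_def by metis
  then show ?thesis
    by (simp add: sum_product)
       (intro sum_hom_poly_sum sum_hom_poly_single[OF hom_poly_mult] finite_atMost; simp)
qed

lemma real_polynomial_function_imp_sum_hom_poly:
  "real_polynomial_function p \<Longrightarrow> sum_hom_poly p"
proof (induction rule: real_polynomial_function.induct)
  case (linear f)
  \<comment> \<open>The vector representing the functional is its adjoint at 1; the trailing factor
    1 is the polynomial of degree 0 that the linear factor multiplies.\<close>
  have "f x = (x \<bullet> adjoint f 1) * 1" for x
    using adjoint_works[OF bounded_linear.linear[OF linear], of x 1] by simp
  then have "f = (\<lambda>x. (x \<bullet> adjoint f 1) * 1)" by blast
  with hom_poly.mult[OF hom_poly.const, of "adjoint f 1" 1] show ?case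
    by (metis sum_hom_poly_single)
next
  case (const c)
  show ?case by (rule sum_hom_poly_single[OF hom_poly.const])
qed (simp_all add: sum_hom_poly_add sum_hom_poly_mult)

text \<open>On the line through \<open>x\<close> both homogeneity and the decomposition into
  components are identities between polynomials in \<open>s\<close>; comparing coefficients of
  \<open>s ^ k\<close> leaves the component of degree \<open>k\<close>.\<close>

lemma homogeneous_polynomial_function_imp_hom_poly:
  assumes "real_polynomial_function p" and hom: "\<And>s x. p (s *\<^sub>R x) = s ^ k * p x"
  shows "hom_poly k p"
proof -
  obtain P N where P: "\<And>d. hom_poly d (P d)" "\<And>x. p x = (\<Sum>d\<le>N. P d x)"
    using real_polynomial_function_imp_sum_hom_poly[OF assms(1)] unfolding sum_hom_poly_def by blast
  have "p x = (if k \<le> N then P k x else 0)" for x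
  proof -
    have "poly (monom (p x) k) s = poly (\<Sum>d\<le>N. monom (P d x) d) s" for s
      using P(2)[of "s *\<^sub>R x"] unfolding hom hom_poly_scaleR[OF P(1)] by (simp add: poly_monom poly_sum mult.commute)
    then have "monom (p x) k = (\<Sum>d\<le>N. monom (P d x) d)" by (simp add: poly_eq_poly_eq_iff[symmetric] fun_eq_iff)
    then have "coeff (monom (p x) k) k = coeff (\<Sum>d\<le>N. monom (P d x) d) k" by simp
    then show ?thesis by (simp add: coeff_sum)
  qed
  then have "p = (if k \<le> N then P k else (\<lambda>x. 0))" by auto
  then show ?thesis using P(1) by (simp add: hom_poly_zero)
qed

text \<open>The homogeneous extension of \<open>geg\<close> from the sphere: each lower power of
  \<open>e \<bullet> y\<close> is filled up to degree \<open>k\<close> by powers of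
  \<open>y \<bullet> y\<close>.\<close>

definition zonal :: "'a::euclidean_space \<Rightarrow> nat \<Rightarrow> 'a \<Rightarrow> real" where
  "zonal e k y = (\<Sum>i\<le>k div 2. geg_coeff DIM('a) k i * ((y \<bullet> y) ^ i * (e \<bullet> y) ^ (k - 2 * i)))"

lemma zonal_sphere: "norm w = 1 \<Longrightarrow> zonal e k w = poly (geg DIM('a::euclidean_space) k) (e \<bullet> (w::'a))"
  by (simp add: zonal_def geg_def poly_sum poly_monom norm_eq_1)

lemma zonal_scaleR: "zonal e k (s *\<^sub>R y) = s ^ k * zonal e k y"
proof -
  have "(s *\<^sub>R y \<bullet> s *\<^sub>R y) ^ i * (e \<bullet> s *\<^sub>R y) ^ (k - 2 * i) = s ^ k * ((y \<bullet> y) ^ i * (e \<bullet> y) ^ (k - 2 * i))" if "i \<le> k div 2" for i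
  proof -
    have "k = i + i + (k - 2 * i)" using that by linarith
    then have "s ^ k = s ^ i * s ^ i * s ^ (k - 2 * i)" by (metis power_add)
    then show ?thesis by (simp add: power_mult_distrib mult_ac)
  qed
  then show ?thesis unfolding zonal_def sum_distrib_left
    by (intro sum.cong) (simp_all add: mult.left_commute)
qed

lemma real_polynomial_function_zonal: "real_polynomial_function (zonal e k)"
proof -
  have i: "real_polynomial_function (\<lambda>y. v \<bullet> y)" for v :: 'a
    by (intro real_polynomial_function.intros(1) bounded_linear_inner_right)
  have "real_polynomial_function (\<lambda>y::'a. \<Sum>b\<in>Basis. (y \<bullet> b) * (y \<bullet> b))"
    by (intro real_polynomial_function_sum real_polynomial_function.intros(1,4) bounded_linear_inner_left finite_Basis)
  moreover have "(\<lambda>y::'a. \<Sum>b\<in>Basis. (y \<bullet> b) * (y \<bullet> b)) = (\<lambda>y. y \<bullet> y)"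
    by (intro ext euclidean_inner[symmetric])
  ultimately have s: "real_polynomial_function (\<lambda>y::'a. y \<bullet> y)" by simp
  show ?thesis
    unfolding zonal_def[abs_def]
    by (intro real_polynomial_function_sum real_polynomial_function.intros(4) real_polynomial_function.intros(2)
        real_polynomial_function_power i s finite_atMost)
qed

lemma polynomial_function_of_real:
  assumes "real_polynomial_function p"
  shows "polynomial_function (\<lambda>x. complex_of_real (p x))"
  unfolding polynomial_function_def
proof (intro allI impI)
  fix f :: "complex \<Rightarrow> real" assume f: "bounded_linear f"
  have "f (complex_of_real u) = u * f 1" for u
    using linear_scale[OF bounded_linear.linear[OF f], of u 1] by (simp add: scaleR_conv_of_real)
  then have "f \<circ> (\<lambda>x. complex_of_real (p x)) = (\<lambda>x. p x * f 1)" by (simp add: fun_eq_iff)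
  then show "real_polynomial_function (f \<circ> (\<lambda>x. complex_of_real (p x)))"
    using assms by (simp add: real_polynomial_function.intros(4) real_polynomial_function.intros(2))
qed

text \<open>The Laplacian of \<open>(y \<bullet> y) ^ i * (e \<bullet> y) ^ j\<close> has two terms,
  lowering \<open>i\<close> by 1 or \<open>j\<close> by 2. For \<open>j = k - 2 * i\<close> the
  second term for \<open>i\<close> has the shape of the first for \<open>i + 1\<close>, and the
  recursion for \<open>geg_coeff\<close> cancels them.\<close>

lemma laplacian_zonal:
  fixes e x :: "'a::euclidean_space"
  assumes n: "2 \<le> DIM('a)" and e: "norm e = 1"
  shows "laplacian (\<lambda>y. complex_of_real (zonal e k y)) x = 0"
proof -
  let ?n = "DIM('a)"
  let ?A = "\<lambda>b u. (x + u *\<^sub>R b) \<bullet> (x + u *\<^sub>R b)" and ?B = "\<lambda>b u. e \<bullet> (x + u *\<^sub>R b)"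
  define D1 where "D1 i j b u = real i * (2 * ((x + u *\<^sub>R b) \<bullet> b) * ?A b u ^ (i - 1)) * ?B b u ^ j +
      real j * ((e \<bullet> b) * ?B b u ^ (j - 1)) * ?A b u ^ i" for i j b u
  define D2 where "D2 i j b = real i * (2 * (b \<bullet> b) * (x \<bullet> x) ^ (i - 1) + 2 * (x \<bullet> b) * (real (i - 1) * (2 * (x \<bullet> b) * (x \<bullet> x) ^ (i - 2)))) * (e \<bullet> x) ^ j
      + 4 * (real i * real j) * ((x \<bullet> b) * (e \<bullet> b)) * (x \<bullet> x) ^ (i - 1) * (e \<bullet> x) ^ (j - 1)
      + real j * (real (j - 1) * ((e \<bullet> b) * (e \<bullet> b)) * (e \<bullet> x) ^ (j - 2)) * (x \<bullet> x) ^ i" for i j b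
  have dA: "(?A b has_real_derivative 2 * ((x + u *\<^sub>R b) \<bullet> b)) (at u)" for b u
    unfolding inner_add_left inner_add_right inner_scaleR_left inner_scaleR_right
    by (auto intro!: derivative_eq_intros simp: inner_commute algebra_simps)
  have dB: "(?B b has_real_derivative e \<bullet> b) (at u)" for b u
    unfolding inner_add_right inner_scaleR_right by (auto intro!: derivative_eq_intros)
  have dA': "((\<lambda>u. 2 * ((x + u *\<^sub>R b) \<bullet> b)) has_real_derivative 2 * (b \<bullet> b)) (at u)" for b u
    unfolding inner_add_left inner_scaleR_left by (auto intro!: derivative_eq_intros)
  have d1: "((\<lambda>u. ?A b u ^ i * ?B b u ^ j) has_real_derivative D1 i j b u) (at u)" for i j b u
    by (rule DERIV_cong[OF DERIV_mult[OF DERIV_power[OF dA] DERIV_power[OF dB]]]) (simp add: D1_def mult_ac)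
  have d2: "((\<lambda>u. D1 i j b u) has_real_derivative D2 i j b) (at 0)" for i j b
    unfolding D1_def
    by (rule DERIV_cong[OF DERIV_add[OF DERIV_mult[OF DERIV_cmult[OF DERIV_mult[OF dA' DERIV_power[OF dA]]] DERIV_power[OF dB]]
          DERIV_mult[OF DERIV_cmult[OF DERIV_cmult[OF DERIV_power[OF dB]]] DERIV_power[OF dA]]]])
       (simp add: D2_def algebra_simps numeral_2_eq_2)
  define c where "c i = geg_coeff ?n k i" for i
  have L: "laplacian (\<lambda>y. complex_of_real (zonal e k y)) x = complex_of_real (\<Sum>b\<in>Basis. \<Sum>i\<le>k div 2. c i * D2 i (k - 2 * i) b)"
  proof -
    have "vector_derivative (\<lambda>t. vector_derivative (\<lambda>u. complex_of_real (zonal e k (x + u *\<^sub>R b))) (at t)) (at 0) =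
        complex_of_real (\<Sum>i\<le>k div 2. c i * D2 i (k - 2 * i) b)" for b
    proof -
      have "((\<lambda>u. zonal e k (x + u *\<^sub>R b)) has_real_derivative (\<Sum>i\<le>k div 2. c i * D1 i (k - 2 * i) b t)) (at t)" for t
        unfolding zonal_def c_def by (intro DERIV_sum DERIV_cmult d1)
      then have "vector_derivative (\<lambda>u. complex_of_real (zonal e k (x + u *\<^sub>R b))) (at t) = complex_of_real (\<Sum>i\<le>k div 2. c i * D1 i (k - 2 * i) b t)" for t
        by (intro vector_derivative_at has_vector_derivative_of_real)
           (simp add: has_real_derivative_iff_has_vector_derivative)
      moreover have "((\<lambda>t. \<Sum>i\<le>k div 2. c i * D1 i (k - 2 * i) b t) has_real_derivative (\<Sum>i\<le>k div 2. c i * D2 i (k - 2 * i) b)) (at 0)"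
        by (intro DERIV_sum DERIV_cmult d2)
      then have "vector_derivative (\<lambda>t. complex_of_real (\<Sum>i\<le>k div 2. c i * D1 i (k - 2 * i) b t)) (at 0) = complex_of_real (\<Sum>i\<le>k div 2. c i * D2 i (k - 2 * i) b)"
        by (intro vector_derivative_at has_vector_derivative_of_real)
           (simp add: has_real_derivative_iff_has_vector_derivative)
      ultimately show ?thesis by simp
    qed
    then show ?thesis by (simp add: laplacian_def)
  qed
  have S: "(\<Sum>b\<in>Basis. D2 i j b) = 2 * real i * (real ?n + 2 * real i + 2 * real j - 2) * ((x \<bullet> x) ^ (i - 1) * (e \<bullet> x) ^ j)
      + real j * real (j - 1) * ((x \<bullet> x) ^ i * (e \<bullet> x) ^ (j - 2))" for i j
  proof -
    have s1: "(\<Sum>b\<in>Basis. (x \<bullet> b) * (x \<bullet> b)) = x \<bullet> x" "(\<Sum>b\<in>Basis. (x \<bullet> b) * (e \<bullet> b)) = e \<bullet> x"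
      "(\<Sum>b\<in>Basis. (e \<bullet> b) * (e \<bullet> b)) = 1" "(\<Sum>b\<in>(Basis :: 'a set). b \<bullet> b) = real ?n"
    proof -
      show "(\<Sum>b\<in>Basis. (x \<bullet> b) * (x \<bullet> b)) = x \<bullet> x" by (rule euclidean_inner[symmetric])
      show "(\<Sum>b\<in>Basis. (x \<bullet> b) * (e \<bullet> b)) = e \<bullet> x" by (simp only: euclidean_inner[of e x] mult.commute)
      show "(\<Sum>b\<in>Basis. (e \<bullet> b) * (e \<bullet> b)) = 1" using e by (simp only: euclidean_inner[of e e, symmetric] norm_eq_1)
    qed simp
    have "D2 i j b = (2 * real i * (x \<bullet> x) ^ (i - 1) * (e \<bullet> x) ^ j) * (b \<bullet> b)
       + (4 * real i * real (i - 1) * (x \<bullet> x) ^ (i - 2) * (e \<bullet> x) ^ j) * ((x \<bullet> b) * (x \<bullet> b))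
       + (4 * (real i * real j) * (x \<bullet> x) ^ (i - 1) * (e \<bullet> x) ^ (j - 1)) * ((x \<bullet> b) * (e \<bullet> b))
       + (real j * real (j - 1) * (e \<bullet> x) ^ (j - 2) * (x \<bullet> x) ^ i) * ((e \<bullet> b) * (e \<bullet> b))" for b
      by (simp add: D2_def algebra_simps)
    then have sum_eq: "(\<Sum>b\<in>Basis. D2 i j b) = (2 * real i * (x \<bullet> x) ^ (i - 1) * (e \<bullet> x) ^ j) * real ?n
       + (4 * real i * real (i - 1) * (x \<bullet> x) ^ (i - 2) * (e \<bullet> x) ^ j) * (x \<bullet> x)
       + (4 * (real i * real j) * (x \<bullet> x) ^ (i - 1) * (e \<bullet> x) ^ (j - 1)) * (e \<bullet> x)
       + (real j * real (j - 1) * (e \<bullet> x) ^ (j - 2) * (x \<bullet> x) ^ i) * 1"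
      by (simp only: sum.distrib sum_distrib_left[symmetric] s1)
    \<comment> \<open>Where natural subtraction truncates an exponent, the accompanying factor
      \<open>i\<close>, \<open>i - 1\<close> or \<open>j\<close> is 0.\<close>
    have f12: "real i * real (i - 1) * ((x \<bullet> x) ^ (i - 2) * (x \<bullet> x)) = real i * (real i - 1) * (x \<bullet> x) ^ (i - 1)"
      "real j * ((e \<bullet> x) ^ (j - 1) * (e \<bullet> x)) = real j * (e \<bullet> x) ^ j"
    proof -
      consider "i = 0" | "i = 1" | i' where "i = Suc (Suc i')" by (metis One_nat_def old.nat.exhaust)
      then show "real i * real (i - 1) * ((x \<bullet> x) ^ (i - 2) * (x \<bullet> x)) = real i * (real i - 1) * (x \<bullet> x) ^ (i - 1)"
        by cases auto
      show "real j * ((e \<bullet> x) ^ (j - 1) * (e \<bullet> x)) = real j * (e \<bullet> x) ^ j"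
        by (cases j) auto
    qed
    have gen: "2 * I * A1 * Bj * N + 4 * I * I1 * A2 * Bj * a + 4 * (I * J) * A1 * B1 * b + C * B2 * A0 * 1 =
        2 * I * (N + 2 * I + 2 * J - 2) * (A1 * Bj) + C * (A0 * B2)"
      if "I * I1 * (A2 * a) = I * (I - 1) * A1" "J * (B1 * b) = J * Bj" for I A1 Bj N I1 A2 a J B1 b C B2 A0 :: real
    proof -
      have e12: "4 * I * I1 * A2 * Bj * a = 4 * (I * I1 * (A2 * a)) * Bj" "4 * (I * J) * A1 * B1 * b = 4 * I * A1 * (J * (B1 * b))"
        by (simp_all only: mult_ac)
      show ?thesis unfolding e12 unfolding that by (simp add: algebra_simps)
    qed
    show ?thesis unfolding sum_eq by (rule gen[OF f12])
  qed
  have "(\<Sum>b\<in>Basis. \<Sum>i\<le>k div 2. c i * D2 i (k - 2 * i) b) = (\<Sum>i\<le>k div 2. c i * (\<Sum>b\<in>Basis. D2 i (k - 2 * i) b))"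
    by (subst sum.swap) (simp add: sum_distrib_left)
  also have "\<dots> = (\<Sum>i\<le>k div 2. c i * real (k - 2 * i) * real (k - 2 * i - 1) * ((x \<bullet> x) ^ i * (e \<bullet> x) ^ (k - 2 * i - 2))
      + c i * (2 * real i * (real ?n + 2 * real k - 2 * real i - 2)) * ((x \<bullet> x) ^ (i - 1) * (e \<bullet> x) ^ (k - 2 * i)))"
  proof (rule sum.cong[OF refl])
    fix i assume "i \<in> {..k div 2}"
    then have "real (k - 2 * i) = real k - 2 * real i" by (simp add: of_nat_diff)
    then have r: "real ?n + 2 * real i + 2 * real (k - 2 * i) - 2 = real ?n + 2 * real k - 2 * real i - 2" by simp
    show "c i * (\<Sum>b\<in>Basis. D2 i (k - 2 * i) b) = c i * real (k - 2 * i) * real (k - 2 * i - 1) * ((x \<bullet> x) ^ i * (e \<bullet> x) ^ (k - 2 * i - 2))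
      + c i * (2 * real i * (real ?n + 2 * real k - 2 * real i - 2)) * ((x \<bullet> x) ^ (i - 1) * (e \<bullet> x) ^ (k - 2 * i))"
      unfolding S r by (simp only: distrib_left mult.assoc add.commute)
  qed
  also have "\<dots> = 0"
  proof (rule sum_telescope_zero)
    have "k - 2 * (k div 2) = k mod 2" by (simp add: minus_mult_div_eq_mod)
    then show "c (k div 2) * real (k - 2 * (k div 2)) * real (k - 2 * (k div 2) - 1) * ((x \<bullet> x) ^ (k div 2) * (e \<bullet> x) ^ (k - 2 * (k div 2) - 2)) = 0"
      by (simp add: mod_2_eq_odd)
    fix i assume i: "i < k div 2"
    have "k - 2 * Suc i = k - 2 * i - 2" by simp
    then have "c i * real (k - 2 * i) * real (k - 2 * i - 1) * ((x \<bullet> x) ^ i * (e \<bullet> x) ^ (k - 2 * i - 2)) +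
       c (Suc i) * (2 * real (Suc i) * (real ?n + 2 * real k - 2 * real (Suc i) - 2)) * ((x \<bullet> x) ^ (Suc i - 1) * (e \<bullet> x) ^ (k - 2 * Suc i)) =
      (c (Suc i) * (2 * real (Suc i) * (real ?n + 2 * real k - 2 * real (Suc i) - 2)) + c i * real (k - 2 * i) * real (k - 2 * i - 1)) * ((x \<bullet> x) ^ i * (e \<bullet> x) ^ (k - 2 * i - 2))"
      by (simp only: diff_Suc_1 distrib_right add.commute)
    then show "c i * real (k - 2 * i) * real (k - 2 * i - 1) * ((x \<bullet> x) ^ i * (e \<bullet> x) ^ (k - 2 * i - 2)) +
       c (Suc i) * (2 * real (Suc i) * (real ?n + 2 * real k - 2 * real (Suc i) - 2)) * ((x \<bullet> x) ^ (Suc i - 1) * (e \<bullet> x) ^ (k - 2 * Suc i)) = 0"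
      unfolding c_def geg_coeff_rec[OF n i] by simp
  qed simp
  finally show ?thesis unfolding L by simp
qed

lemma zonal_harmonic:
  fixes e :: "'a::euclidean_space"
  assumes "2 \<le> DIM('a)" "norm e = 1"
  shows "(\<lambda>y. complex_of_real (zonal e k y)) \<in> harmonic_polys k"
  unfolding harmonic_polys_def
  using assms by (auto simp: zonal_scaleR laplacian_zonal intro: polynomial_function_of_real real_polynomial_function_zonal)

lemma harmonic_polys_imp_hom_poly:
  assumes "p \<in> harmonic_polys k"
  shows "hom_poly k (\<lambda>x. Re (p x))" "hom_poly k (\<lambda>x. Im (p x))"
proof -
  have p: "polynomial_function p" "\<And>c x. p (c *\<^sub>R x) = complex_of_real c ^ k * p x"
    using assms by (auto simp: harmonic_polys_def)
  have "real_polynomial_function (Re \<circ> p)" "real_polynomial_function (Im \<circ> p)"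
    using p(1) bounded_linear_Re bounded_linear_Im unfolding polynomial_function_def by blast+
  then show "hom_poly k (\<lambda>x. Re (p x))" "hom_poly k (\<lambda>x. Im (p x))"
    by (auto intro!: homogeneous_polynomial_function_imp_hom_poly simp: o_def p(2) of_real_power[symmetric] simp del: of_real_power)
qed

section \<open>Spherical harmonic coefficients\<close>

text \<open>Composition with \<open>1 - u\<close>, an involution, gives the expansion about 1. The
  shifted index runs from 1 to \<open>k\<close>, as in the theorem.\<close>

lemma poly_in_powers_of_one_minus:
  fixes p :: "real poly"
  assumes "\<And>i. k \<le> i \<Longrightarrow> coeff p i = 0"
  shows "\<exists>c. \<forall>u. poly p u = (\<Sum>i=1..k. c i * (1 - u) ^ (i - 1))"
proof -
  define q where "q = pcompose p [:1, -1:]"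
  have q: "coeff q i = 0" if "k \<le> i" for i
  proof (cases "p = 0")
    case True
    then show ?thesis by (simp add: q_def)
  next
    case False
    have "degree p < k" using assms[of "degree p"] False by (meson leI leading_coeff_0_iff)
    moreover have "degree q = degree p" by (simp add: q_def degree_pcompose)
    ultimately show ?thesis using that by (intro coeff_eq_0) simp
  qed
  have "poly p u = (\<Sum>i=1..k. coeff q (i - 1) * (1 - u) ^ (i - 1))" for u
  proof -
    have "poly p u = poly q (1 - u)" by (simp add: q_def poly_pcompose)
    also have "\<dots> = (\<Sum>m<k. coeff q m * (1 - u) ^ m)" by (rule poly_altdef_lessThan[OF q])
    also have "\<dots> = (\<Sum>i=1..k. coeff q (i - 1) * (1 - u) ^ (i - 1))"
      by (rule sum.reindex_bij_witness[of _ "\<lambda>i. i - 1" Suc]) auto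
    finally show ?thesis .
  qed
  then show ?thesis by (intro exI[of _ "\<lambda>i. coeff q (i - 1)"] allI)
qed

text \<open>The dimension is read off from the given basis. Elements of degree 0 are constant, so
  two of them cannot be orthonormal, and the constant 1 must be spanned by at least one. This makes
  index 1 valid, and the only one, in degree 0.\<close>

lemma cdim_harmonic_polys_0:
  fixes Y :: "nat \<Rightarrow> 'a::euclidean_space \<Rightarrow> complex"
  assumes "orthonormal_harmonic_basis 0 Y"
  shows "cdim (harmonic_polys 0 :: ('a \<Rightarrow> complex) set) = 1"
proof -
  define d where "d = cdim (harmonic_polys 0 :: ('a \<Rightarrow> complex) set)"
  have Y: "\<And>j. j \<in> {1..d} \<Longrightarrow> \<exists>p\<in>harmonic_polys 0. \<forall>\<omega>\<in>sphere 0 1. Y j \<omega> = p \<omega>"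
    "\<And>i j. i \<in> {1..d} \<Longrightarrow> j \<in> {1..d} \<Longrightarrow> sph_inner (Y i) (Y j) = (if i = j then 1 else 0)"
    "\<And>p. p \<in> harmonic_polys 0 \<Longrightarrow> \<exists>c. \<forall>\<omega>\<in>sphere 0 1. p \<omega> = (\<Sum>j=1..d. c j * Y j \<omega>)"
    using assms unfolding orthonormal_harmonic_basis_def d_def Let_def by blast+
  have const: "\<exists>y. \<forall>w. norm w = 1 \<longrightarrow> Y j w = y" if j: "j \<in> {1..d}" for j
  proof -
    from Y(1)[OF j] obtain p where p: "p \<in> harmonic_polys 0" "\<forall>\<omega>\<in>sphere 0 1. Y j \<omega> = p \<omega>" by blast
    have "p w = p 0" for w
    proof -
      have "p (0 *\<^sub>R w) = complex_of_real 0 ^ 0 * p w" using p(1) unfolding harmonic_polys_def by blast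
      then show ?thesis by simp
    qed
    with p(2) show ?thesis by (metis mem_sphere_0)
  qed
  then obtain y where y: "\<And>j w. j \<in> {1..d} \<Longrightarrow> norm w = 1 \<Longrightarrow> Y j w = y j" by metis
  have ip: "sph_inner (Y i) (Y j) = y i * cnj (y j)" if "i \<in> {1..d}" "j \<in> {1..d}" for i j
  proof -
    have e: "Y i w * cnj (Y j w) = y i * cnj (y j)" if "w \<in> sphere 0 1" for w
      using y \<open>i \<in> {1..d}\<close> \<open>j \<in> {1..d}\<close> that by simp
    have "continuous_on (sphere 0 1) (\<lambda>w. Y i w * cnj (Y j w))"
      by (subst continuous_on_cong[OF refl e]) auto
    from sph_inner_eq[OF this]
    have "sph_inner (Y i) (Y j) = csint (\<lambda>w::'a. (y i * cnj (y j)) * 1) / complex_of_real (sint (\<lambda>w::'a. 1))"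
      using e by (simp cong: csint_cong)
    also have "\<dots> = y i * cnj (y j) * (csint (\<lambda>w::'a. 1) / complex_of_real (sint (\<lambda>w::'a. 1)))"
      by (simp only: csint_cmult times_divide_eq_right)
    also have "csint (\<lambda>w::'a. 1) = complex_of_real (sint (\<lambda>w::'a. 1))"
      using Re_Im_csint[of "\<lambda>w::'a. 1"] by (simp add: complex_eq_iff)
    finally show ?thesis using sint_1_pos[where 'a='a] by simp
  qed
  have "d \<noteq> 0"
  proof
    assume d: "d = 0"
    have "(\<lambda>x::'a. 1) \<in> harmonic_polys 0"
      by (simp add: harmonic_polys_def laplacian_def)
    from Y(3)[OF this] have "\<forall>\<omega>\<in>sphere (0::'a) 1. (1::complex) = 0" using d by auto
    then show False using vector_choose_size[of 1] by (metis mem_sphere_0 zero_le_one zero_neq_one)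
  qed
  moreover have "\<not> 2 \<le> d"
  proof
    assume d: "2 \<le> d"
    have "y 1 * cnj (y 1) = 1" "y 2 * cnj (y 2) = 1" "y 1 * cnj (y 2) = 0"
      using Y(2)[of 1 1] Y(2)[of 2 2] Y(2)[of 1 2] d by (simp_all add: ip)
    then show False by auto
  qed
  ultimately show ?thesis unfolding d_def by linarith
qed

section \<open>Transfer between sphere integrals and spherical harmonic coefficients\<close>

context
  fixes f :: "'a::euclidean_space \<Rightarrow> complex" and a b :: real
  assumes DIM: "2 \<le> DIM('a)" and a: "0 \<le> a" and b: "b \<le> 1" and f: "continuous_on (annulus a b) f"
begin

lemma continuous_weight_slice:
  assumes "a < \<rho>" "\<rho> < b"
  shows "continuous_on (sphere 0 1) (\<lambda>w. euclid_weight f (\<rho> *\<^sub>R w))"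
  by (rule continuous_on_compose2[OF continuous_on_euclid_weight[OF f b]])
     (use assms a in \<open>auto simp: annulus_def intro!: continuous_intros\<close>)

lemma sph_coeff_eq:
  assumes \<rho>: "a < \<rho>" "\<rho> < b" and Y: "\<And>w. norm w = 1 \<Longrightarrow> Y w = p w" and p: "continuous_on (sphere 0 1) p"
  shows "sph_coeff Y f \<rho> = complex_of_real ((1 - \<rho>\<^sup>2) ^ (DIM('a) - 1) / sint (\<lambda>w::'a. 1)) *
    csint (\<lambda>w. euclid_weight f (\<rho> *\<^sub>R w) * cnj (p w))"
proof -
  have "\<rho>\<^sup>2 < 1" using \<rho> a b by (simp add: abs_square_less_1)
  then have fw: "f (\<rho> *\<^sub>R w) * cnj (Y w) = complex_of_real ((1 - \<rho>\<^sup>2) ^ (DIM('a) - 1)) * (euclid_weight f (\<rho> *\<^sub>R w) * cnj (p w))"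
    if "norm w = 1" for w
  proof -
    have "complex_of_real ((1 - \<rho>\<^sup>2) ^ (DIM('a) - 1)) \<noteq> 0" unfolding of_real_eq_0_iff using \<open>\<rho>\<^sup>2 < 1\<close> by simp
    then show ?thesis using that Y[OF that] by (simp only: euclid_weight_def norm_scaleR power_mult_distrib power2_abs) simp
  qed
  have "continuous_on (sphere 0 1) (\<lambda>w. complex_of_real ((1 - \<rho>\<^sup>2) ^ (DIM('a) - 1)) * (euclid_weight f (\<rho> *\<^sub>R w) * cnj (p w)))"
    by (intro continuous_intros continuous_weight_slice \<rho> p)
  then have "continuous_on (sphere 0 1) (\<lambda>w. f (\<rho> *\<^sub>R w) * cnj (Y w))"
    by (subst continuous_on_cong[OF refl fw]) auto
  from sph_inner_eq[OF this]
  have "sph_coeff Y f \<rho> = csint (\<lambda>w. f (\<rho> *\<^sub>R w) * cnj (Y w)) / complex_of_real (sint (\<lambda>w::'a. 1))"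
    by (simp add: sph_coeff_def)
  also have "csint (\<lambda>w. f (\<rho> *\<^sub>R w) * cnj (Y w)) = complex_of_real ((1 - \<rho>\<^sup>2) ^ (DIM('a) - 1)) * csint (\<lambda>w. euclid_weight f (\<rho> *\<^sub>R w) * cnj (p w))"
    unfolding csint_cmult[symmetric] by (rule csint_cong[OF fw])
  finally show ?thesis by simp
qed

lemma zero_sphere_means_imp_sph_coeff:
  assumes Z: "zero_sphere_means a b (\<lambda>y. Re (euclid_weight f y))" "zero_sphere_means a b (\<lambda>y. Im (euclid_weight f y))"
    and ab: "a < b" and p: "p \<in> harmonic_polys k" and Y: "\<And>w. norm w = 1 \<Longrightarrow> Y w = p w"
  shows "\<exists>C :: nat \<Rightarrow> complex. \<forall>\<rho>. a < \<rho> \<and> \<rho> < b \<longrightarrow> sph_coeff Y f \<rho> =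
    (\<Sum>i=1..k. C i * complex_of_real ((1 - \<rho>\<^sup>2) ^ (DIM('a) + i - 2) / \<rho> ^ (DIM('a) + k - 2)))"
proof -
  let ?n = "DIM('a)" and ?g = "euclid_weight f"
  note hom = harmonic_polys_imp_hom_poly[OF p]
  have cg: "continuous_on (annulus a b) (\<lambda>y. Re (?g y))" "continuous_on (annulus a b) (\<lambda>y. Im (?g y))"
    by (intro continuous_intros continuous_on_euclid_weight[OF f b])+
  \<comment> \<open>\<open>u\<close> selects a part of \<open>g\<close> and \<open>P\<close> a part
    of the harmonic polynomial; the four combinations are instances of the real result.\<close>
  define I where "I u P \<rho> = sint (\<lambda>w. u (?g (\<rho> *\<^sub>R w)) * P (p w))" for u P :: "complex \<Rightarrow> real" and \<rho>
  have ex: "\<exists>c. \<forall>\<rho>. a < \<rho> \<and> \<rho> < b \<longrightarrow> \<rho> ^ (?n + k - 2) * I u P \<rho> = (\<Sum>i=1..k. c i * (1 - \<rho>\<^sup>2) ^ (i - 1))"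
    if "u = Re \<or> u = Im" "P = Re \<or> P = Im" for u P
  proof -
    have "continuous_on (annulus a b) (\<lambda>y. u (?g y))" "zero_sphere_means a b (\<lambda>y. u (?g y))" "hom_poly k (\<lambda>x. P (p x))"
      using that cg Z hom by auto
    from zero_sphere_means_imp_coeff_poly[OF DIM a ab this] obtain q where
      q: "\<And>i. k \<le> i \<Longrightarrow> coeff q i = 0" "\<And>\<rho>. a < \<rho> \<and> \<rho> < b \<Longrightarrow> \<rho> ^ (?n + k - 2) * I u P \<rho> = poly q (\<rho>\<^sup>2)"
      unfolding I_def by blast
    from poly_in_powers_of_one_minus[OF q(1)] q(2) show ?thesis by metis
  qed
  obtain c1 c2 c3 c4 where c: "\<And>\<rho>. a < \<rho> \<and> \<rho> < b \<Longrightarrow> \<rho> ^ (?n + k - 2) * I Re Re \<rho> = (\<Sum>i=1..k. c1 i * (1 - \<rho>\<^sup>2) ^ (i - 1))"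
    "\<And>\<rho>. a < \<rho> \<and> \<rho> < b \<Longrightarrow> \<rho> ^ (?n + k - 2) * I Im Im \<rho> = (\<Sum>i=1..k. c2 i * (1 - \<rho>\<^sup>2) ^ (i - 1))"
    "\<And>\<rho>. a < \<rho> \<and> \<rho> < b \<Longrightarrow> \<rho> ^ (?n + k - 2) * I Im Re \<rho> = (\<Sum>i=1..k. c3 i * (1 - \<rho>\<^sup>2) ^ (i - 1))"
    "\<And>\<rho>. a < \<rho> \<and> \<rho> < b \<Longrightarrow> \<rho> ^ (?n + k - 2) * I Re Im \<rho> = (\<Sum>i=1..k. c4 i * (1 - \<rho>\<^sup>2) ^ (i - 1))"
    using ex[of Re Re] ex[of Im Im] ex[of Im Re] ex[of Re Im] by blast
  let ?S = "sint (\<lambda>w::'a. 1)"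
  \<comment> \<open>The signs are those of the real and imaginary parts of \<open>g * cnj p\<close>;
    the division by \<open>?S\<close> comes from the normalised measure in
    \<open>sph_inner\<close>.\<close>
  define C where "C i = Complex (c1 i + c2 i) (c3 i - c4 i) / complex_of_real ?S" for i
  have cp: "continuous_on (sphere 0 1) (\<lambda>w. Re (p w))" "continuous_on (sphere 0 1) (\<lambda>w. Im (p w))"
    by (rule hom_poly_continuous[OF hom(1)], rule hom_poly_continuous[OF hom(2)])
  then have cp': "continuous_on (sphere 0 1) p"
    using continuous_on_add[OF continuous_on_of_real[OF cp(1)] continuous_on_mult[OF continuous_on_const continuous_on_of_real[OF cp(2)], of \<i>]]
    by (simp flip: complex_eq)
  have "sph_coeff Y f \<rho> = (\<Sum>i=1..k. C i * complex_of_real ((1 - \<rho>\<^sup>2) ^ (?n + i - 2) / \<rho> ^ (?n + k - 2)))"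
    if \<rho>: "a < \<rho>" "\<rho> < b" for \<rho>
  proof -
    have \<rho>0: "0 < \<rho>" using \<rho> a by simp
    note cs = continuous_weight_slice[OF \<rho>]
    let ?W = "csint (\<lambda>w. ?g (\<rho> *\<^sub>R w) * cnj (p w))"
    have cW: "continuous_on (sphere 0 1) (\<lambda>w. ?g (\<rho> *\<^sub>R w) * cnj (p w))"
      by (intro continuous_intros cs cp')
    have "Re ?W = I Re Re \<rho> + I Im Im \<rho>" "Im ?W = I Im Re \<rho> - I Re Im \<rho>"
      unfolding Re_Im_csint[OF cW] I_def
      by (simp_all add: sint_add[symmetric] sint_diff[symmetric] continuous_intros cs cp')
    then have "Re (\<rho> ^ (?n + k - 2) * ?W) = (\<Sum>i=1..k. (c1 i + c2 i) * (1 - \<rho>\<^sup>2) ^ (i - 1))"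
      "Im (\<rho> ^ (?n + k - 2) * ?W) = (\<Sum>i=1..k. (c3 i - c4 i) * (1 - \<rho>\<^sup>2) ^ (i - 1))"
      using c \<rho> by (simp_all add: distrib_left right_diff_distrib distrib_right left_diff_distrib sum.distrib sum_subtractf flip: of_real_power)
    then have "\<rho> ^ (?n + k - 2) * ?W = (\<Sum>i=1..k. Complex (c1 i + c2 i) (c3 i - c4 i) * complex_of_real ((1 - \<rho>\<^sup>2) ^ (i - 1)))"
      by (simp add: complex_eq_iff flip: of_real_power)
    then have W: "?W = (\<Sum>i=1..k. Complex (c1 i + c2 i) (c3 i - c4 i) * complex_of_real ((1 - \<rho>\<^sup>2) ^ (i - 1))) / complex_of_real (\<rho> ^ (?n + k - 2))"
      using \<rho>0 by (simp add: field_simps)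
    have "sph_coeff Y f \<rho> = complex_of_real ((1 - \<rho>\<^sup>2) ^ (?n - 1) / ?S) * ?W"
      by (rule sph_coeff_eq[OF \<rho> Y cp'])
    also have "\<dots> = (\<Sum>i=1..k. C i * complex_of_real ((1 - \<rho>\<^sup>2) ^ (?n + i - 2) / \<rho> ^ (?n + k - 2)))"
      unfolding W sum_divide_distrib sum_distrib_left
    proof (rule sum.cong[OF refl])
      fix i assume "i \<in> {1..k}"
      \<comment> \<open>The weight removed in passing to \<open>g\<close> returns here and joins the
        power \<open>i - 1\<close>.\<close>
      then have "?n + i - 2 = (?n - 1) + (i - 1)" using DIM by auto
      then have "(1 - \<rho>\<^sup>2) ^ (?n + i - 2) = (1 - \<rho>\<^sup>2) ^ (?n - 1) * (1 - \<rho>\<^sup>2) ^ (i - 1)" by (simp only: power_add)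
      then show "complex_of_real ((1 - \<rho>\<^sup>2) ^ (?n - 1) / ?S) * (Complex (c1 i + c2 i) (c3 i - c4 i) * complex_of_real ((1 - \<rho>\<^sup>2) ^ (i - 1)) / complex_of_real (\<rho> ^ (?n + k - 2))) =
        C i * complex_of_real ((1 - \<rho>\<^sup>2) ^ (?n + i - 2) / \<rho> ^ (?n + k - 2))"
        by (simp only: C_def of_real_mult of_real_divide times_divide_eq_left times_divide_eq_right divide_divide_eq_left mult_ac)
    qed
    finally show ?thesis .
  qed
  then show ?thesis by blast
qed

text \<open>For any axis the zonal harmonic of degree \<open>k\<close> is a combination of the basis
  functions of that degree, so the coefficient of \<open>g\<close> against it inherits the
  polynomial form from the given coefficients.\<close>

lemma sph_coeff_imp_zero_sphere_means:
  assumes basis: "\<And>k. orthonormal_harmonic_basis k (Y k)"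
    and zero: "\<And>\<rho>. a < \<rho> \<Longrightarrow> \<rho> < b \<Longrightarrow> sph_coeff (Y 0 1) f \<rho> = 0"
    and coeff: "\<And>k j. 1 \<le> k \<Longrightarrow> j \<in> {1..cdim (harmonic_polys k :: ('a \<Rightarrow> complex) set)} \<Longrightarrow>
      \<exists>C :: nat \<Rightarrow> complex. \<forall>\<rho>. a < \<rho> \<and> \<rho> < b \<longrightarrow> sph_coeff (Y k j) f \<rho> =
       (\<Sum>i=1..k. C i * complex_of_real ((1 - \<rho>\<^sup>2) ^ (DIM('a) + i - 2) / \<rho> ^ (DIM('a) + k - 2)))"
  shows "zero_sphere_means a b (\<lambda>y. Re (euclid_weight f y)) \<and> zero_sphere_means a b (\<lambda>y. Im (euclid_weight f y))"
proof -
  let ?n = "DIM('a)" and ?g = "euclid_weight f" and ?S = "sint (\<lambda>w::'a. 1)"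
  define d where "d k = cdim (harmonic_polys k :: ('a \<Rightarrow> complex) set)" for k
  have C: "\<exists>C :: nat \<Rightarrow> complex. \<forall>\<rho>. a < \<rho> \<and> \<rho> < b \<longrightarrow> sph_coeff (Y k j) f \<rho> =
       (\<Sum>i=1..k. C i * complex_of_real ((1 - \<rho>\<^sup>2) ^ (?n + i - 2) / \<rho> ^ (?n + k - 2)))" if j: "j \<in> {1..d k}" for k j
  proof (cases "k = 0")
    \<comment> \<open>In degree 0 the sum over \<open>{1..0}\<close> is empty, so the hypothesis on
      the first coefficient has the same form as the others.\<close>
    case True
    have "d 0 = 1" unfolding d_def by (rule cdim_harmonic_polys_0[OF basis])
    then have "j = 1" using j True by simp
    have "sph_coeff (Y k j) f \<rho> = 0" if "a < \<rho>" "\<rho> < b" for \<rho>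
      unfolding True \<open>j = 1\<close> by (rule zero[OF that])
    then show ?thesis unfolding True by simp
  next
    case False
    with coeff j show ?thesis by (simp add: d_def)
  qed
  have key: "\<exists>D :: nat \<Rightarrow> complex. \<forall>\<rho>. a < \<rho> \<and> \<rho> < b \<longrightarrow>
      complex_of_real (\<rho> ^ (?n + k - 2)) * csint (\<lambda>w. ?g (\<rho> *\<^sub>R w) * complex_of_real (poly (geg ?n k) (e \<bullet> w))) =
      (\<Sum>i=1..k. D i * complex_of_real ((1 - \<rho>\<^sup>2) ^ (i - 1)))"
    if e: "norm e = 1" for e k
  proof -
    let ?z = "\<lambda>w. complex_of_real (zonal e k w)"
    have Yp: "\<exists>p\<in>harmonic_polys k. \<forall>\<omega>\<in>sphere 0 1. Y k j \<omega> = p \<omega>" if "j \<in> {1..d k}" for j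
      using basis[of k] that unfolding orthonormal_harmonic_basis_def d_def Let_def by blast
    then obtain p where p: "\<And>j. j \<in> {1..d k} \<Longrightarrow> p j \<in> harmonic_polys k" "\<And>j w. j \<in> {1..d k} \<Longrightarrow> norm w = 1 \<Longrightarrow> Y k j w = p j w"
      by (metis mem_sphere_0)
    have cp: "continuous_on (sphere 0 1) (p j)" if "j \<in> {1..d k}" for j
    proof -
      have "polynomial_function (p j)" using p(1)[OF that] by (simp add: harmonic_polys_def)
      then show ?thesis by (rule continuous_on_polymonial_function)
    qed
    have "\<forall>q\<in>harmonic_polys k. \<exists>c. \<forall>\<omega>\<in>sphere 0 1. q \<omega> = (\<Sum>j=1..d k. c j * Y k j \<omega>)"
      using basis[of k] unfolding orthonormal_harmonic_basis_def d_def Let_def by blast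
    from bspec[OF this zonal_harmonic[OF DIM e]]
    obtain c where c: "\<And>w. norm w = 1 \<Longrightarrow> ?z w = (\<Sum>j=1..d k. c j * Y k j w)"
      by auto
    have "\<forall>j\<in>{1..d k}. \<exists>C :: nat \<Rightarrow> complex. \<forall>\<rho>. a < \<rho> \<and> \<rho> < b \<longrightarrow> sph_coeff (Y k j) f \<rho> =
       (\<Sum>i=1..k. C i * complex_of_real ((1 - \<rho>\<^sup>2) ^ (?n + i - 2) / \<rho> ^ (?n + k - 2)))"
      using C[of _ k] by blast
    from bchoice[OF this]
    obtain C where CC: "\<And>j \<rho>. j \<in> {1..d k} \<Longrightarrow> a < \<rho> \<Longrightarrow> \<rho> < b \<Longrightarrow> sph_coeff (Y k j) f \<rho> =
       (\<Sum>i=1..k. C j i * complex_of_real ((1 - \<rho>\<^sup>2) ^ (?n + i - 2) / \<rho> ^ (?n + k - 2)))"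
      by blast
    define D where "D i = (\<Sum>j=1..d k. cnj (c j) * (complex_of_real ?S * C j i))" for i
    have "complex_of_real (\<rho> ^ (?n + k - 2)) * csint (\<lambda>w. ?g (\<rho> *\<^sub>R w) * complex_of_real (poly (geg ?n k) (e \<bullet> w))) =
      (\<Sum>i=1..k. D i * complex_of_real ((1 - \<rho>\<^sup>2) ^ (i - 1)))" if \<rho>: "a < \<rho>" "\<rho> < b" for \<rho>
    proof -
      have \<rho>0: "0 < \<rho>" using \<rho> a by simp
      have "\<rho>\<^sup>2 < 1" using \<rho> a b by (simp add: abs_square_less_1)
      then have nz: "complex_of_real ((1 - \<rho>\<^sup>2) ^ (?n - 1)) \<noteq> 0" "complex_of_real (\<rho> ^ (?n + k - 2)) \<noteq> 0" "complex_of_real ?S \<noteq> 0"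
        unfolding of_real_eq_0_iff using \<rho>0 sint_1_pos[where 'a='a] by simp_all
      have "csint (\<lambda>w. ?g (\<rho> *\<^sub>R w) * complex_of_real (poly (geg ?n k) (e \<bullet> w))) = csint (\<lambda>w. \<Sum>j=1..d k. cnj (c j) * (?g (\<rho> *\<^sub>R w) * cnj (p j w)))"
      proof (rule csint_cong)
        fix w :: 'a assume w: "norm w = 1"
        \<comment> \<open>Zonal values are real; conjugating them brings the basis functions into
          the conjugated form in which they enter the coefficients.\<close>
        have "complex_of_real (poly (geg ?n k) (e \<bullet> w)) = cnj (?z w)" using zonal_sphere[OF w] by simp
        also have "\<dots> = (\<Sum>j=1..d k. cnj (c j) * cnj (p j w))" using c[OF w] p(2)[OF _ w] by simp
        finally show "?g (\<rho> *\<^sub>R w) * complex_of_real (poly (geg ?n k) (e \<bullet> w)) = (\<Sum>j=1..d k. cnj (c j) * (?g (\<rho> *\<^sub>R w) * cnj (p j w)))"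
          by (simp add: sum_distrib_left mult_ac)
      qed
      also have "\<dots> = (\<Sum>j=1..d k. cnj (c j) * csint (\<lambda>w. ?g (\<rho> *\<^sub>R w) * cnj (p j w)))"
        by (subst csint_sum) (auto intro!: continuous_intros continuous_weight_slice[OF \<rho>] cp simp: csint_cmult)
      also have "\<dots> = (\<Sum>j=1..d k. cnj (c j) * (complex_of_real ?S * (\<Sum>i=1..k. C j i * complex_of_real ((1 - \<rho>\<^sup>2) ^ (i - 1))) / complex_of_real (\<rho> ^ (?n + k - 2))))"
      proof (rule sum.cong[OF refl])
        fix j assume j: "j \<in> {1..d k}"
        let ?W = "csint (\<lambda>w. ?g (\<rho> *\<^sub>R w) * cnj (p j w))" and ?X = "\<Sum>i=1..k. C j i * complex_of_real ((1 - \<rho>\<^sup>2) ^ (i - 1))"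
        have "complex_of_real ((1 - \<rho>\<^sup>2) ^ (?n - 1) / ?S) * ?W = sph_coeff (Y k j) f \<rho>"
          by (rule sph_coeff_eq[OF \<rho> p(2)[OF j] cp[OF j], symmetric])
        also have "\<dots> = complex_of_real ((1 - \<rho>\<^sup>2) ^ (?n - 1)) * ?X / complex_of_real (\<rho> ^ (?n + k - 2))"
          unfolding CC[OF j \<rho>] sum_distrib_left sum_divide_distrib
        proof (rule sum.cong[OF refl])
          fix i assume "i \<in> {1..k}"
          then have "?n + i - 2 = (?n - 1) + (i - 1)" using DIM by auto
          then have "(1 - \<rho>\<^sup>2) ^ (?n + i - 2) = (1 - \<rho>\<^sup>2) ^ (?n - 1) * (1 - \<rho>\<^sup>2) ^ (i - 1)" by (simp only: power_add)
          then show "C j i * complex_of_real ((1 - \<rho>\<^sup>2) ^ (?n + i - 2) / \<rho> ^ (?n + k - 2)) =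
            complex_of_real ((1 - \<rho>\<^sup>2) ^ (?n - 1)) * (C j i * complex_of_real ((1 - \<rho>\<^sup>2) ^ (i - 1))) / complex_of_real (\<rho> ^ (?n + k - 2))"
            by (simp only: of_real_mult of_real_divide times_divide_eq_left times_divide_eq_right mult_ac)
        qed
        finally have eq: "complex_of_real ((1 - \<rho>\<^sup>2) ^ (?n - 1)) / complex_of_real ?S * ?W =
            complex_of_real ((1 - \<rho>\<^sup>2) ^ (?n - 1)) * ?X / complex_of_real (\<rho> ^ (?n + k - 2))"
          by (simp only: of_real_divide)
        have "W = s * X / r" if "q / s * W = q * X / r" "q \<noteq> 0" "s \<noteq> 0" for q s W X r :: complex
        proof -
          have "q * (W / s) = q * (X / r)"
            using that(1) by (simp only: times_divide_eq_right times_divide_eq_left)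
          then have "W / s = X / r" by (simp only: mult_left_cancel[OF that(2)])
          then show ?thesis using that(3) by (simp add: field_simps)
        qed
        from this[OF eq nz(1,3)]
        show "cnj (c j) * ?W = cnj (c j) * (complex_of_real ?S * ?X / complex_of_real (\<rho> ^ (?n + k - 2)))" by simp
      qed
      finally have expand: "csint (\<lambda>w. ?g (\<rho> *\<^sub>R w) * complex_of_real (poly (geg ?n k) (e \<bullet> w))) =
         (\<Sum>j=1..d k. cnj (c j) * (complex_of_real ?S * (\<Sum>i=1..k. C j i * complex_of_real ((1 - \<rho>\<^sup>2) ^ (i - 1))) / complex_of_real (\<rho> ^ (?n + k - 2))))" .
      have cancel: "q * (x * (y / q)) = x * y" if "q \<noteq> 0" for q x y :: complex using that by simp
      have "complex_of_real (\<rho> ^ (?n + k - 2)) * csint (\<lambda>w. ?g (\<rho> *\<^sub>R w) * complex_of_real (poly (geg ?n k) (e \<bullet> w))) =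
         (\<Sum>j=1..d k. cnj (c j) * (complex_of_real ?S * (\<Sum>i=1..k. C j i * complex_of_real ((1 - \<rho>\<^sup>2) ^ (i - 1)))))"
        unfolding expand sum_distrib_left[of "complex_of_real (\<rho> ^ (?n + k - 2))"] cancel[OF nz(2)] ..
      also have "\<dots> = (\<Sum>j=1..d k. \<Sum>i=1..k. cnj (c j) * (complex_of_real ?S * C j i) * complex_of_real ((1 - \<rho>\<^sup>2) ^ (i - 1)))"
        by (simp only: sum_distrib_left mult.assoc)
      also have "\<dots> = (\<Sum>i=1..k. D i * complex_of_real ((1 - \<rho>\<^sup>2) ^ (i - 1)))"
        by (subst sum.swap) (simp only: D_def sum_distrib_right)
      finally show ?thesis .
    qed
    then show ?thesis by blast
  qed
  have polys: "\<exists>p. (\<forall>i\<ge>k. poly.coeff p i = 0) \<and>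
      (\<forall>\<rho>. a < \<rho> \<and> \<rho> < b \<longrightarrow> \<rho> ^ (?n + k - 2) * sint (\<lambda>w. u (?g (\<rho> *\<^sub>R w)) * poly (geg ?n k) (e \<bullet> w)) = poly p (\<rho>\<^sup>2))"
    if e: "norm e = 1" and u: "u = Re \<or> u = Im" for e k u
  proof -
    from key[OF e, of k] obtain D :: "nat \<Rightarrow> complex" where D: "\<And>\<rho>. a < \<rho> \<Longrightarrow> \<rho> < b \<Longrightarrow> 
      complex_of_real (\<rho> ^ (?n + k - 2)) * csint (\<lambda>w. ?g (\<rho> *\<^sub>R w) * complex_of_real (poly (geg ?n k) (e \<bullet> w))) =
      (\<Sum>i=1..k. D i * complex_of_real ((1 - \<rho>\<^sup>2) ^ (i - 1)))" by blast
    have um: "u (complex_of_real r * z) = r * u z" "u (z * complex_of_real r) = u z * r" for r z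
      using u by (elim disjE; simp)+
    have us: "u (\<Sum>i=1..k. h i) = (\<Sum>i=1..k. u (h i))" for h
      using u by (elim disjE) simp_all
    define p where "p = (\<Sum>i=1..k. Polynomial.smult (u (D i)) ([:1, -1:] ^ (i - 1)))"
    show ?thesis
    proof (intro exI[of _ p] conjI allI impI)
      fix i assume i: "k \<le> i"
      have "poly.coeff ([:1, -1:] ^ (j - 1) :: real poly) i = 0" if "j \<in> {1..k}" for j
      proof (rule coeff_eq_0)
        have "degree ([:1, -1:] ^ (j - 1) :: real poly) \<le> 1 * (j - 1)"
          using degree_power_le[of "[:1, -1:] :: real poly" "j - 1"] by simp
        also have "\<dots> < i" using that i by auto
        finally show "degree ([:1, -1:] ^ (j - 1) :: real poly) < i" .
      qed
      then show "poly.coeff p i = 0" by (simp add: p_def coeff_sum)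
    next
      fix \<rho> assume \<rho>: "a < \<rho> \<and> \<rho> < b"
      have cW: "continuous_on (sphere 0 1) (\<lambda>w. ?g (\<rho> *\<^sub>R w) * complex_of_real (poly (geg ?n k) (e \<bullet> w)))"
        using \<rho> by (intro continuous_intros continuous_weight_slice) auto
      have "u (csint (\<lambda>w. ?g (\<rho> *\<^sub>R w) * complex_of_real (poly (geg ?n k) (e \<bullet> w)))) =
          sint (\<lambda>w. u (?g (\<rho> *\<^sub>R w) * complex_of_real (poly (geg ?n k) (e \<bullet> w))))"
        using u by (elim disjE) (simp_all only: Re_Im_csint[OF cW])
      also have "\<dots> = sint (\<lambda>w. u (?g (\<rho> *\<^sub>R w)) * poly (geg ?n k) (e \<bullet> w))" by (simp only: um)
      finally have "\<rho> ^ (?n + k - 2) * sint (\<lambda>w. u (?g (\<rho> *\<^sub>R w)) * poly (geg ?n k) (e \<bullet> w)) =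
          u (complex_of_real (\<rho> ^ (?n + k - 2)) * csint (\<lambda>w. ?g (\<rho> *\<^sub>R w) * complex_of_real (poly (geg ?n k) (e \<bullet> w))))"
        by (simp only: um)
      also have "\<dots> = (\<Sum>i=1..k. u (D i) * (1 - \<rho>\<^sup>2) ^ (i - 1))"
        using \<rho> by (simp only: D us um)
      also have "\<dots> = poly p (\<rho>\<^sup>2)" by (simp add: p_def poly_sum)
      finally show "\<rho> ^ (?n + k - 2) * sint (\<lambda>w. u (?g (\<rho> *\<^sub>R w)) * poly (geg ?n k) (e \<bullet> w)) = poly p (\<rho>\<^sup>2)" .
    qed
  qed
  have cg: "continuous_on (annulus a b) (\<lambda>y. Re (?g y))" "continuous_on (annulus a b) (\<lambda>y. Im (?g y))"
    by (intro continuous_intros continuous_on_euclid_weight[OF f b])+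
  show ?thesis
  proof
    show "zero_sphere_means a b (\<lambda>y. Re (?g y))"
      by (rule coeff_poly_imp_zero_sphere_means[OF DIM a cg(1)], rule polys[OF _ disjI1[OF refl]])
    show "zero_sphere_means a b (\<lambda>y. Im (?g y))"
      by (rule coeff_poly_imp_zero_sphere_means[OF DIM a cg(2)], rule polys[OF _ disjI2[OF refl]])
  qed
qed

end

theorem theorem1p2:
  fixes f :: "real ^ 'n \<Rightarrow> complex"
    and Y :: "nat \<Rightarrow> nat \<Rightarrow> real ^ 'n \<Rightarrow> complex"
    and r :: real and R :: ereal
  assumes "2 \<le> CARD('n)"
    and "0 \<le> r" and "ereal r < R"
    and "continuous_on (hyp_annulus r R) f"
    and "\<forall>k. orthonormal_harmonic_basis k (Y k)"
  shows "f \<in> Z_class r R \<longleftrightarrow>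
    (\<forall>\<rho>. tanh (r / 2) < \<rho> \<and> \<rho> < tanh_half R \<longrightarrow> sph_coeff (Y 0 1) f \<rho> = 0) \<and>
    (\<forall>k\<ge>1. \<forall>j\<in>{1..cdim (harmonic_polys k :: (real ^ 'n \<Rightarrow> complex) set)}.
       \<exists>C :: nat \<Rightarrow> complex. \<forall>\<rho>. tanh (r / 2) < \<rho> \<and> \<rho> < tanh_half R \<longrightarrow>
         sph_coeff (Y k j) f \<rho> =
           (\<Sum>i=1..k. C i * complex_of_real
              ((1 - \<rho>\<^sup>2) ^ (CARD('n) + i - 2) / \<rho> ^ (CARD('n) + k - 2))))"
proof -
  let ?a = "tanh (r / 2)" and ?b = "tanh_half R"
  have DIM: "2 \<le> DIM(real ^ 'n)" and D: "CARD('n) = DIM(real ^ 'n)" using assms(1) by simp_all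
  have a: "0 \<le> ?a" using assms(2) by simp
  have ab: "?a < ?b"
  proof (cases R)
    case (real R')
    then show ?thesis using assms(3) by (simp add: tanh_half_def)
  next
    case PInf
    then show ?thesis using tanh_real_lt_1 by (simp add: tanh_half_def)
  qed (use assms(3) in simp)
  have f: "continuous_on (annulus ?a ?b) f"
    using assms(4) hyp_annulus_eq_annulus[OF assms(2,3), where 'a="real ^ 'n"] by simp
  have basis: "orthonormal_harmonic_basis k (Y k)" for k using assms(5) by blast
  have Yp: "\<exists>p\<in>harmonic_polys k. \<forall>w. norm w = 1 \<longrightarrow> Y k j w = p w"
    if "j \<in> {1..cdim (harmonic_polys k :: (real ^ 'n \<Rightarrow> complex) set)}" for k j
    using basis[of k] that unfolding orthonormal_harmonic_basis_def Let_def by (metis mem_sphere_0)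
  note fwd = zero_sphere_means_imp_sph_coeff[OF DIM a tanh_half_le_1 f _ _ ab]
  show ?thesis
    unfolding Z_class_iff[OF assms(2-4)]
  proof (intro iffI conjI allI ballI impI)
    fix \<rho>
    assume Z: "zero_sphere_means ?a ?b (\<lambda>y. Re (euclid_weight f y)) \<and> zero_sphere_means ?a ?b (\<lambda>y. Im (euclid_weight f y))"
      and \<rho>: "?a < \<rho> \<and> \<rho> < ?b"
    \<comment> \<open>In degree 0 the general formula is an empty sum, which is the claimed
      vanishing.\<close>
    obtain p where "p \<in> harmonic_polys 0" "\<And>w. norm w = 1 \<Longrightarrow> Y 0 1 w = p w"
      using Yp[of 1 0] cdim_harmonic_polys_0[OF basis[of 0]] by auto
    from fwd[OF _ _ this] Z \<rho> show "sph_coeff (Y 0 1) f \<rho> = 0" by simp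
  next
    fix k j :: nat
    assume Z: "zero_sphere_means ?a ?b (\<lambda>y. Re (euclid_weight f y)) \<and> zero_sphere_means ?a ?b (\<lambda>y. Im (euclid_weight f y))"
      and j: "j \<in> {1..cdim (harmonic_polys k :: (real ^ 'n \<Rightarrow> complex) set)}"
    obtain p where "p \<in> harmonic_polys k" "\<And>w. norm w = 1 \<Longrightarrow> Y k j w = p w"
      using Yp[OF j] by blast
    from fwd[OF _ _ this] Z
    show "\<exists>C :: nat \<Rightarrow> complex. \<forall>\<rho>. ?a < \<rho> \<and> \<rho> < ?b \<longrightarrow> sph_coeff (Y k j) f \<rho> =
           (\<Sum>i=1..k. C i * complex_of_real ((1 - \<rho>\<^sup>2) ^ (CARD('n) + i - 2) / \<rho> ^ (CARD('n) + k - 2)))"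
      unfolding D by blast
  next
    assume H: "(\<forall>\<rho>. ?a < \<rho> \<and> \<rho> < ?b \<longrightarrow> sph_coeff (Y 0 1) f \<rho> = 0) \<and>
      (\<forall>k\<ge>1. \<forall>j\<in>{1..cdim (harmonic_polys k :: (real ^ 'n \<Rightarrow> complex) set)}.
       \<exists>C :: nat \<Rightarrow> complex. \<forall>\<rho>. ?a < \<rho> \<and> \<rho> < ?b \<longrightarrow>
         sph_coeff (Y k j) f \<rho> =
           (\<Sum>i=1..k. C i * complex_of_real
              ((1 - \<rho>\<^sup>2) ^ (CARD('n) + i - 2) / \<rho> ^ (CARD('n) + k - 2))))"
    have "zero_sphere_means ?a ?b (\<lambda>y. Re (euclid_weight f y)) \<and> zero_sphere_means ?a ?b (\<lambda>y. Im (euclid_weight f y))"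
      by (rule sph_coeff_imp_zero_sphere_means[OF DIM a tanh_half_le_1 f basis]) (use H[unfolded D] in blast)+
    then show "zero_sphere_means ?a ?b (\<lambda>y. Re (euclid_weight f y))" "zero_sphere_means ?a ?b (\<lambda>y. Im (euclid_weight f y))"
      by simp_all
  qed
qed

end
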